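(* Let $\mathbb{K}$ be a field, $\mathcal{E}$ a finite non-empty set, and $W\subseteq\mathbb{K}^{\mathcal{E}}$ a configuration with matroid $\mathsf{M}_W$. (a) If $\mathrm{rk}\,\mathsf{M}_W>0$ and $e\in\mathcal{E}$ is a loop or parallel to some $f\in\mathcal{E}$ in $\mathsf{M}_W$, then $[Y_W]=[Y_{W\setminus e}]\cdot\mathbb{L}\in\mathrm{K}_0(\mathrm{Var}_{\mathbb{K}})$. In particular, $[Y_W]\equiv[Y_{W\setminus e}]\mod\mathbb{T}$. (b) If $\mathrm{rk}\,\mathsf{M}_W>1$ and $e\in\mathcal{E}$ is a coloop in $\mathsf{M}_W$, then $[Y_W]=[Y_{W\setminus e}]\cdot\mathbb{T}\in\mathrm{K}_0(\mathrm{Var}_{\mathbb{K}})$. In particular, $[Y_W]\equiv0\mod\mathbb{T}$. (c) If $\mathsf{M}_W$ is loopless and disconnected, then $[Y_W]\equiv0\mod\mathbb{T}$ in $\mathrm{K}_0(\mathrm{Var}_{\mathbb{K}})$. In particular, if $G$ is a loopless graph without isolated vertices, and is disconnected or has a nexus, then $[Y_G]\equiv0\mod\mathbb{T}$ in $\mathrm{K}_0(\mathrm{Var}_{\mathbb{K}})$.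
   Context: $\mathrm{K}_0(\mathrm{Var}_{\mathbb{K}})$ is the Grothendieck ring of varieties over $\mathbb{K}$, $[-]$ denotes classes in it, $\mathbb{L}:=[\mathbb{A}^1]$, $\mathbb{T}:=[\mathbb{G}_m]$ is the class of the $1$-torus, and "$\mathrm{mod}\ \mathbb{T}$" means modulo the ideal generated by $\mathbb{T}$. Configurations: a configuration is a subspace $W\subseteq V:=\mathbb{K}^{\mathcal{E}}$, where $\mathcal{E}$ is identified with the standard basis of $V$; $x_e=e^\vee$, $e\in\mathcal{E}$, are the coordinates on $V$. Its matroid $\mathsf{M}_W$ on $\mathcal{E}$ is defined by the linear dependence relations of the family $(e^\vee|_W)_{e\in\mathcal{E}}$ in $W^\vee$. The deletion $W\setminus e\subseteq\mathbb{K}^{\mathcal{E}\setminus\{e\}}$ is the image of $W$ under the coordinate projection $\mathbb{K}^{\mathcal{E}}\to\mathbb{K}^{\mathcal{E}\setminus\{e\}}$. Elements $e,f$ are parallel in $\mathsf{M}_W$ if $\{e,f\}$ is a circuit. Configuration hypersurface: $Q_W$ is the restriction to $W\times W$ of the symmetric bilinear form $V\times V\to V^\vee$, $(w,w')\mapsto\sum_{e}w_ew'_e\cdot x_e$. Its determinant with respect to a basis of $W$ is the configuration polynomial $\psi_W=\det Q_W\in\mathrm{Sym}\,V^\vee=\mathbb{K}[V]$ (well-defined up to a factor in $\mathbb{K}^*$; $\psi_W=1$ if $W=0$). Set $X_W:=V(\psi_W)\subseteq\mathbb{P}V$ and $Y_W:=\mathbb{P}V\setminus X_W$. Graphs: graphs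 $G=(\mathcal{V},\mathcal{E})$ are finite and undirected, multiple edges are allowed, and $G$ is assumed to have at least one edge which is not a loop. $W_G\subseteq\mathbb{K}^{\mathcal{E}}$ is the span of the vertex incidence vectors (with respect to some orientation of the edges): for $v\in\mathcal{V}$, the vector $(v_e)_{e\in\mathcal{E}}$ has $v_e=-1$ or $v_e=1$ if $v$ is respectively the source or target of the non-loop edge $e$, and $v_e=0$ otherwise. Set $Y_G:=Y_{W_G}$; equivalently, $Y_G$ is the complement in $\mathbb{P}\mathbb{K}^{\mathcal{E}}$ of the hypersurface defined by $\psi_G=\sum_T\prod_{e\in T}x_e$, $T$ running over spanning forests (bases of the graphic matroid). A nexus of $G$ is a vertex $v$ whose deletion results in a disconnected graph $G-v$. *)

theory Defs
  imports
    "HOL-Analysis.Abstract_Topology"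
    "HOL-Library.Poly_Mapping"
    "HOL-Library.Multiset"
    "HOL-Library.Function_Algebras"
    "HOL-Algebra.Algebraic_Closure_Type"
    "Jordan_Normal_Form.Determinant"
begin

(* HOL-Algebra reserves the token X for its polynomial indeterminate; here X names spaces. *)
no_notation var (\<open>X\<index>\<close>)

section \<open>Multivariate polynomials\<close>

text \<open>
  Polynomials over \<open>'k\<close> in variables indexed by \<open>'i\<close>; the ring structure is the convolution
  product of finitely supported functions.
\<close>

type_synonym ('i, 'k) mpoly = "('i \<Rightarrow>\<^sub>0 nat) \<Rightarrow>\<^sub>0 'k"

definition mp_const :: "'k::field \<Rightarrow> ('i, 'k) mpoly" where
  "mp_const c = Poly_Mapping.single 0 c"

definition mp_var :: "'i \<Rightarrow> ('i, 'k::field) mpoly" where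
  "mp_var i = Poly_Mapping.single (Poly_Mapping.single i 1) 1"

text \<open>Value at a point with coordinates in the algebraic closure of the coefficient field.\<close>

definition mp_eval :: "('i, 'k::field) mpoly \<Rightarrow> ('i \<Rightarrow> 'k alg_closure) \<Rightarrow> 'k alg_closure" where
  "mp_eval p x =
     (\<Sum>m\<in>Poly_Mapping.keys p. to_ac (Poly_Mapping.lookup p m) *
        (\<Prod>i\<in>Poly_Mapping.keys m. x i ^ Poly_Mapping.lookup m i))"

definition mp_homogeneous :: "nat \<Rightarrow> ('i, 'k::field) mpoly \<Rightarrow> bool" where
  "mp_homogeneous d p \<longleftrightarrow>
     (\<forall>m\<in>Poly_Mapping.keys p. (\<Sum>i\<in>Poly_Mapping.keys m. Poly_Mapping.lookup m i) = d)"


section \<open>Varieties over a field\<close>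

text \<open>
  A variety over \<open>'k\<close> (a reduced separated scheme of finite type) is represented by the set of
  its points over the algebraic closure, together with the Zariski topology whose closed sets are
  defined over \<open>'k\<close>, and the sheaf of regular functions defined over \<open>'k\<close>, viewed as
  functions into the algebraic closure. All polynomials below have coefficients in \<open>'k\<close> itself,
  so conjugate points are topologically indistinguishable, as they should be. By the
  Nullstellensatz, for a closed subset of affine space the regular functions form the reduced
  coordinate ring over \<open>'k\<close>. This holds for every field, perfect or not.

  Only the values on \<open>U\<close> of the functions in \<open>regular X U\<close> are meaningful, and only for
  open \<open>U\<close>.
\<close>

record (overloaded) ('p, 'k::field) kspace =
  ktop :: "'p topology"
  regular :: "'p set \<Rightarrow> ('p \<Rightarrow> 'k alg_closure) set"

abbreviation points :: "('p, 'k::field) kspace \<Rightarrow> 'p set" where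
  "points X \<equiv> topspace (ktop X)"

definition function_sheaf :: "('p, 'k::field) kspace \<Rightarrow> bool" where
  "function_sheaf X \<longleftrightarrow>
     (\<forall>U f g. openin (ktop X) U \<and> f \<in> regular X U \<and> (\<forall>x\<in>U. g x = f x) \<longrightarrow> g \<in> regular X U) \<and>
     (\<forall>U V f. openin (ktop X) U \<and> openin (ktop X) V \<and> V \<subseteq> U \<and> f \<in> regular X U
        \<longrightarrow> f \<in> regular X V) \<and>
     (\<forall>U f. openin (ktop X) U \<and>
        (\<forall>x\<in>U. \<exists>V. openin (ktop X) V \<and> x \<in> V \<and> V \<subseteq> U \<and> f \<in> regular X V)
        \<longrightarrow> f \<in> regular X U)"

definition kmorphism :: "('p, 'k::field) kspace \<Rightarrow> ('q, 'k) kspace \<Rightarrow> ('p \<Rightarrow> 'q) \<Rightarrow> bool" where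
  "kmorphism X Y \<phi> \<longleftrightarrow>
     continuous_map (ktop X) (ktop Y) \<phi> \<and>
     (\<forall>U f. openin (ktop Y) U \<and> f \<in> regular Y U
        \<longrightarrow> f \<circ> \<phi> \<in> regular X {x \<in> points X. \<phi> x \<in> U})"

definition kiso :: "('p, 'k::field) kspace \<Rightarrow> ('q, 'k) kspace \<Rightarrow> bool" where
  "kiso X Y \<longleftrightarrow>
     (\<exists>\<phi> \<chi>. kmorphism X Y \<phi> \<and> kmorphism Y X \<chi> \<and>
        (\<forall>x\<in>points X. \<chi> (\<phi> x) = x) \<and> (\<forall>y\<in>points Y. \<phi> (\<chi> y) = y))"

text \<open>
  The structure induced on a subset; for a locally closed subset this is the reduced subvariety
  structure.
\<close>

definition induced :: "('p, 'k::field) kspace \<Rightarrow> 'p set \<Rightarrow> ('p, 'k) kspace" where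
  "induced X S = \<lparr>
     ktop = subtopology (ktop X) S,
     regular = (\<lambda>U. {f. \<forall>x\<in>U. \<exists>V g. openin (ktop X) V \<and> x \<in> V \<and> g \<in> regular X V \<and>
                          (\<forall>y\<in>U \<inter> V. f y = g y)}) \<rparr>"

text \<open>
  Affine space with coordinates indexed by \<open>I\<close>; points are functions vanishing outside \<open>I\<close>.
\<close>

definition coord_space :: "'i set \<Rightarrow> ('i \<Rightarrow> 'a::zero) set" where
  "coord_space I = {x. \<forall>i. i \<notin> I \<longrightarrow> x i = 0}"

definition affine_space :: "'i set \<Rightarrow> ('i \<Rightarrow> 'k alg_closure, 'k::field) kspace" where
  "affine_space I = (
     let T = topology_generated_by
               (range (\<lambda>p :: ('i, 'k) mpoly. {x \<in> coord_space I. mp_eval p x \<noteq> 0}))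
     in \<lparr> ktop = T,
          regular = (\<lambda>U. {f. \<forall>x\<in>U. \<exists>V (p :: ('i, 'k) mpoly) q.
             openin T V \<and> x \<in> V \<and> V \<subseteq> U \<and>
             (\<forall>y\<in>V. mp_eval q y \<noteq> 0 \<and> f y = mp_eval p y / mp_eval q y)}) \<rparr>)"

text \<open>
  Projective space with homogeneous coordinates indexed by \<open>E\<close>; points are the lines through the
  origin.
\<close>

definition line :: "('i \<Rightarrow> 'a::field) \<Rightarrow> ('i \<Rightarrow> 'a) set" where
  "line x = range (\<lambda>c i. c * x i)"

definition proj_locus :: "'i set \<Rightarrow> (('i \<Rightarrow> 'a::field) \<Rightarrow> bool) \<Rightarrow> ('i \<Rightarrow> 'a) set set" where
  "proj_locus E P = {line x | x. x \<in> coord_space E \<and> x \<noteq> 0 \<and> P x}"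

definition projective_space :: "'i set \<Rightarrow> (('i \<Rightarrow> 'k alg_closure) set, 'k::field) kspace" where
  "projective_space E = (
     let T = topology_generated_by
               {proj_locus E (\<lambda>x. mp_eval p x \<noteq> 0) | (p :: ('i, 'k) mpoly) d. mp_homogeneous d p}
     in \<lparr> ktop = T,
          regular = (\<lambda>U. {f. \<forall>l\<in>U. \<exists>V d (p :: ('i, 'k) mpoly) q.
             openin T V \<and> l \<in> V \<and> V \<subseteq> U \<and> mp_homogeneous d p \<and> mp_homogeneous d q \<and>
             (\<forall>x\<in>coord_space E. x \<noteq> 0 \<and> line x \<in> V \<longrightarrow>
                mp_eval q x \<noteq> 0 \<and> f (line x) = mp_eval p x / mp_eval q x)}) \<rparr>)"

text \<open>
  Products (with reduced structure). The functions \<open>\<Sum> g\<^sub>i(x) h\<^sub>i(y)\<close> on \<open>U \<times> V\<close> play the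
  role of the coordinate ring of a product of affine charts: their non-vanishing loci generate the
  topology, and regular functions are locally quotients of such functions.
\<close>

definition tensor_functions ::
  "('p, 'k::field) kspace \<Rightarrow> ('q, 'k) kspace \<Rightarrow> 'p set \<Rightarrow> 'q set \<Rightarrow> ('p \<times> 'q \<Rightarrow> 'k alg_closure) set"
  where
  "tensor_functions X Y U V =
     {\<lambda>z. \<Sum>i<n. g i (fst z) * h i (snd z) | (n :: nat) g h.
        \<forall>i<n. g i \<in> regular X U \<and> h i \<in> regular Y V}"

definition kprod ::
  "('p, 'k::field) kspace \<Rightarrow> ('q, 'k) kspace \<Rightarrow> ('p \<times> 'q, 'k) kspace" where
  "kprod X Y = (
     let T = topology_generated_by
               {{z \<in> U \<times> V. t z \<noteq> 0} | U V t.
                  openin (ktop X) U \<and> openin (ktop Y) V \<and> t \<in> tensor_functions X Y U V}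
     in \<lparr> ktop = T,
          regular = (\<lambda>D. {f. \<forall>z\<in>D. \<exists>N U V s t.
             openin T N \<and> z \<in> N \<and> N \<subseteq> D \<and>
             openin (ktop X) U \<and> openin (ktop Y) V \<and> N \<subseteq> U \<times> V \<and>
             s \<in> tensor_functions X Y U V \<and> t \<in> tensor_functions X Y U V \<and>
             (\<forall>w\<in>N. t w \<noteq> 0 \<and> f w = s w / t w)}) \<rparr>)"

definition affine_variety :: "('p, 'k::field) kspace \<Rightarrow> bool" where
  "affine_variety X \<longleftrightarrow>
     (\<exists>(n :: nat) Z. closedin (ktop (affine_space {..<n} :: (nat \<Rightarrow> 'k alg_closure, 'k) kspace)) Z \<and>
        kiso X (induced (affine_space {..<n} :: (nat \<Rightarrow> 'k alg_closure, 'k) kspace) Z))"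

definition separated :: "('p, 'k::field) kspace \<Rightarrow> bool" where
  "separated X \<longleftrightarrow> closedin (ktop (kprod X X)) {(x, x) | x. x \<in> points X}"

definition is_variety :: "('p, 'k::field) kspace \<Rightarrow> bool" where
  "is_variety X \<longleftrightarrow>
     function_sheaf X \<and>
     (\<exists>\<U>. finite \<U> \<and> \<Union>\<U> = points X \<and>
        (\<forall>U\<in>\<U>. openin (ktop X) U \<and> affine_variety (induced X U))) \<and>
     separated X"


section \<open>The Grothendieck ring of varieties\<close>

text \<open>
  Every variety has at most as many points as there are finite lists over the (infinite) algebraic
  closure, so every variety is isomorphic to one whose points are such lists. These represent all
  isomorphism classes.
\<close>

typedef (overloaded) 'k variety =
  "{X :: ('k alg_closure list, 'k::field) kspace. is_variety X}"
proof -
  define X :: "('k alg_closure list, 'k) kspace"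
    where "X = \<lparr> ktop = discrete_topology {}, regular = (\<lambda>_. UNIV) \<rparr>"
  have "is_variety X"
    by (auto simp: is_variety_def function_sheaf_def separated_def X_def intro: exI[of _ "{}"])
  thus ?thesis by blast
qed

inductive_set ideal_generated :: "'r::comm_ring set \<Rightarrow> 'r set" for S where
  ideal_generated_0: "0 \<in> ideal_generated S"
| ideal_generated_base: "a \<in> S \<Longrightarrow> a \<in> ideal_generated S"
| ideal_generated_diff:
    "a \<in> ideal_generated S \<Longrightarrow> b \<in> ideal_generated S \<Longrightarrow> a - b \<in> ideal_generated S"
| ideal_generated_mult: "a \<in> ideal_generated S \<Longrightarrow> c * a \<in> ideal_generated S"

lemma ideal_generated_add:
  "a \<in> ideal_generated S \<Longrightarrow> b \<in> ideal_generated S \<Longrightarrow> a + b \<in> ideal_generated S"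
  using ideal_generated_diff[of a S "0 - b"] ideal_generated_diff[OF ideal_generated_0, of b S]
  by simp

text \<open>
  The ring is presented by generators and relations: the free commutative ring on all varieties is
  the monoid ring of the free commutative monoid of multisets of varieties. The product and unit
  relations turn every monomial into a single generator, so additively the quotient is the free
  abelian group on isomorphism classes modulo the scissor relations.
\<close>

type_synonym 'k free_var_ring = "'k variety multiset \<Rightarrow>\<^sub>0 int"

definition var_gen :: "'k::field variety \<Rightarrow> 'k free_var_ring" where
  "var_gen X = Poly_Mapping.single {#X#} 1"

definition K0_relations :: "'k::field free_var_ring set" where
  "K0_relations =
     {var_gen X - var_gen Y | X Y. kiso (Rep_variety X) (Rep_variety Y)} \<union>
     {var_gen X - (var_gen Z + var_gen U) | X Z U.
        \<exists>C. closedin (ktop (Rep_variety X)) C \<and>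
          kiso (Rep_variety Z) (induced (Rep_variety X) C) \<and>
          kiso (Rep_variety U) (induced (Rep_variety X) (points (Rep_variety X) - C))} \<union>
     {var_gen P - var_gen X * var_gen Y | P X Y.
        kiso (Rep_variety P) (kprod (Rep_variety X) (Rep_variety Y))} \<union>
     {var_gen P - 1 | P. kiso (Rep_variety P) (affine_space ({} :: nat set))}"

definition K0_equiv :: "'k::field free_var_ring \<Rightarrow> 'k free_var_ring \<Rightarrow> bool" where
  "K0_equiv a b \<longleftrightarrow> a - b \<in> ideal_generated K0_relations"

lemma equivp_K0_equiv: "equivp (K0_equiv :: 'k::field free_var_ring \<Rightarrow> _)"
proof (rule equivpI)
  show "reflp (K0_equiv :: 'k free_var_ring \<Rightarrow> _)"
    by (auto intro!: reflpI simp: K0_equiv_def ideal_generated_0)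
  show "symp (K0_equiv :: 'k free_var_ring \<Rightarrow> _)"
  proof (rule sympI)
    fix a b :: "'k free_var_ring"
    assume "K0_equiv a b"
    from ideal_generated_diff[OF ideal_generated_0 this[unfolded K0_equiv_def]]
    show "K0_equiv b a" by (simp add: K0_equiv_def)
  qed
  show "transp (K0_equiv :: 'k free_var_ring \<Rightarrow> _)"
  proof (rule transpI)
    fix a b c :: "'k free_var_ring"
    assume "K0_equiv a b" "K0_equiv b c"
    from ideal_generated_add[OF this[unfolded K0_equiv_def]]
    show "K0_equiv a c" by (simp add: K0_equiv_def)
  qed
qed

quotient_type (overloaded) 'k K0 = "'k::field free_var_ring" / K0_equiv
  by (rule equivp_K0_equiv)

text \<open>
  The classes \<open>comm_ring\<close> and \<open>comm_monoid_mult\<close> together give commutative unital rings;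
  \<open>comm_ring_1\<close> would moreover demand a proof of \<open>0 \<noteq> 1\<close>, which no definition here uses.
\<close>

instantiation K0 :: (field) "{comm_ring, one}"
begin

lift_definition zero_K0 :: "'a K0" is 0 .

lift_definition one_K0 :: "'a K0" is 1 .

lift_definition plus_K0 :: "'a K0 \<Rightarrow> 'a K0 \<Rightarrow> 'a K0" is "(+)"
proof -
  fix a b c d :: "'a free_var_ring"
  assume "K0_equiv a b" "K0_equiv c d"
  from ideal_generated_add[OF this[unfolded K0_equiv_def]]
  show "K0_equiv (a + c) (b + d)" by (simp add: K0_equiv_def algebra_simps)
qed

lift_definition uminus_K0 :: "'a K0 \<Rightarrow> 'a K0" is uminus
proof -
  fix a b :: "'a free_var_ring"
  assume "K0_equiv a b"
  from ideal_generated_diff[OF ideal_generated_0 this[unfolded K0_equiv_def]]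
  show "K0_equiv (- a) (- b)" by (simp add: K0_equiv_def)
qed

lift_definition minus_K0 :: "'a K0 \<Rightarrow> 'a K0 \<Rightarrow> 'a K0" is "(-)"
proof -
  fix a b c d :: "'a free_var_ring"
  assume "K0_equiv a b" "K0_equiv c d"
  from ideal_generated_diff[OF this[unfolded K0_equiv_def]]
  show "K0_equiv (a - c) (b - d)" by (simp add: K0_equiv_def algebra_simps)
qed

lift_definition times_K0 :: "'a K0 \<Rightarrow> 'a K0 \<Rightarrow> 'a K0" is "(*)"
proof -
  fix a b c d :: "'a free_var_ring"
  assume *: "K0_equiv a b" "K0_equiv c d"
  have "c * (a - b) + b * (c - d) \<in> ideal_generated K0_relations"
    using * unfolding K0_equiv_def by (intro ideal_generated_add ideal_generated_mult)
  moreover have "c * (a - b) + b * (c - d) = a * c - b * d"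
    by (simp add: algebra_simps)
  ultimately show "K0_equiv (a * c) (b * d)" by (simp add: K0_equiv_def)
qed

instance
  by intro_classes (transfer; simp add: algebra_simps K0_equiv_def ideal_generated_0)+

end

instance K0 :: (field) comm_monoid_mult
  by intro_classes (transfer; simp add: algebra_simps K0_equiv_def ideal_generated_0)+

text \<open>The class of a space in any point type; meaningful only for varieties.\<close>

definition K0_class :: "('p, 'k::field) kspace \<Rightarrow> 'k K0" where
  "K0_class X = abs_K0 (var_gen (SOME V. kiso X (Rep_variety V)))"

definition affine_line :: "(nat \<Rightarrow> 'k alg_closure, 'k::field) kspace" where
  "affine_line = affine_space {..<1}"

definition K0_L :: "'k::field K0" where
  "K0_L = K0_class affine_line"

definition K0_T :: "'k::field K0" where
  "K0_T = K0_class (induced affine_line {x. x 0 \<noteq> 0})"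

definition cong_mod_T :: "'k::field K0 \<Rightarrow> 'k K0 \<Rightarrow> bool" where
  "cong_mod_T a b \<longleftrightarrow> a - b \<in> ideal_generated {K0_T}"


section \<open>Matroids\<close>

record 'e matroid =
  ground :: "'e set"
  indep :: "'e set set"

definition matroid_rank :: "'e matroid \<Rightarrow> nat" where
  "matroid_rank M = Max (card ` indep M)"

definition matroid_basis :: "'e matroid \<Rightarrow> 'e set \<Rightarrow> bool" where
  "matroid_basis M B \<longleftrightarrow> B \<in> indep M \<and> (\<forall>I\<in>indep M. B \<subseteq> I \<longrightarrow> I = B)"

definition circuit :: "'e matroid \<Rightarrow> 'e set \<Rightarrow> bool" where
  "circuit M C \<longleftrightarrow> C \<subseteq> ground M \<and> C \<notin> indep M \<and> (\<forall>D. D \<subset> C \<longrightarrow> D \<in> indep M)"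

definition matroid_loop :: "'e matroid \<Rightarrow> 'e \<Rightarrow> bool" where
  "matroid_loop M e \<longleftrightarrow> circuit M {e}"

definition matroid_coloop :: "'e matroid \<Rightarrow> 'e \<Rightarrow> bool" where
  "matroid_coloop M e \<longleftrightarrow> e \<in> ground M \<and> (\<forall>B. matroid_basis M B \<longrightarrow> e \<in> B)"

definition matroid_parallel :: "'e matroid \<Rightarrow> 'e \<Rightarrow> 'e \<Rightarrow> bool" where
  "matroid_parallel M e f \<longleftrightarrow> e \<noteq> f \<and> circuit M {e, f}"

text \<open>
  A matroid is disconnected if it is the direct sum of its restrictions to two complementary
  non-empty subsets of the ground set.
\<close>

definition matroid_disconnected :: "'e matroid \<Rightarrow> bool" where
  "matroid_disconnected M \<longleftrightarrow>
     (\<exists>S. S \<noteq> {} \<and> S \<subset> ground M \<and>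
        (\<forall>I\<subseteq>ground M. I \<in> indep M \<longleftrightarrow> I \<inter> S \<in> indep M \<and> I - S \<in> indep M))"


section \<open>Configurations\<close>

definition fun_scale :: "'k::field \<Rightarrow> ('e \<Rightarrow> 'k) \<Rightarrow> 'e \<Rightarrow> 'k" where
  "fun_scale c w = (\<lambda>e. c * w e)"

global_interpretation fun_space: vector_space "fun_scale :: 'k::field \<Rightarrow> ('e \<Rightarrow> 'k) \<Rightarrow> 'e \<Rightarrow> 'k"
  by unfold_locales (auto simp: fun_scale_def algebra_simps)

text \<open>The ambient space \<open>'k\<^sup>E\<close> consists of the functions vanishing outside \<open>E\<close>.\<close>

definition configuration :: "'e set \<Rightarrow> ('e \<Rightarrow> 'k::field) set \<Rightarrow> bool" where
  "configuration E W \<longleftrightarrow> W \<subseteq> coord_space E \<and> fun_space.subspace W"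

text \<open>
  Independent sets index linearly independent families of coordinate functionals restricted to
  \<open>W\<close> (as families: equal functionals at different indices are dependent).
\<close>

definition config_matroid :: "'e set \<Rightarrow> ('e \<Rightarrow> 'k::field) set \<Rightarrow> 'e matroid" where
  "config_matroid E W = \<lparr>
     ground = E,
     indep = {I. I \<subseteq> E \<and>
       (\<forall>c :: 'e \<Rightarrow> 'k. (\<forall>w\<in>W. (\<Sum>e\<in>I. c e * w e) = 0) \<longrightarrow> (\<forall>e\<in>I. c e = 0))} \<rparr>"

definition config_delete :: "('e \<Rightarrow> 'k::field) set \<Rightarrow> 'e \<Rightarrow> ('e \<Rightarrow> 'k) set" where
  "config_delete W e = (\<lambda>w. w(e := 0)) ` W"

definition config_form ::
  "'e set \<Rightarrow> ('e \<Rightarrow> 'k::field) \<Rightarrow> ('e \<Rightarrow> 'k) \<Rightarrow> ('e, 'k) mpoly" where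
  "config_form E w w' = (\<Sum>e\<in>E. mp_const (w e * w' e) * mp_var e)"

definition basis_list :: "('e \<Rightarrow> 'k::field) set \<Rightarrow> ('e \<Rightarrow> 'k) list \<Rightarrow> bool" where
  "basis_list W bs \<longleftrightarrow>
     distinct bs \<and> fun_space.independent (set bs) \<and> fun_space.span (set bs) = W"

text \<open>Another choice of basis changes the polynomial by a non-zero constant factor.\<close>

definition config_polynomial :: "'e set \<Rightarrow> ('e \<Rightarrow> 'k::field) set \<Rightarrow> ('e, 'k) mpoly" where
  "config_polynomial E W = (
     let bs = (SOME bs. basis_list W bs)
     in det (mat (length bs) (length bs) (\<lambda>(i, j). config_form E (bs ! i) (bs ! j))))"

definition config_hypersurface ::
  "'e set \<Rightarrow> ('e \<Rightarrow> 'k::field) set \<Rightarrow> ('e \<Rightarrow> 'k alg_closure) set set" where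
  "config_hypersurface E W = proj_locus E (\<lambda>x. mp_eval (config_polynomial E W) x = 0)"

definition config_complement ::
  "'e set \<Rightarrow> ('e \<Rightarrow> 'k::field) set \<Rightarrow> (('e \<Rightarrow> 'k alg_closure) set, 'k) kspace" where
  "config_complement E W =
     induced (projective_space E)
       (points (projective_space E :: (_, 'k) kspace) - config_hypersurface E W)"


section \<open>Graphs\<close>

text \<open>Undirected multigraphs; an edge with a single end is a loop.\<close>

record ('v, 'e) multigraph =
  verts :: "'v set"
  edges :: "'e set"
  ends :: "'e \<Rightarrow> 'v set"

definition graph_loop :: "('v, 'e) multigraph \<Rightarrow> 'e \<Rightarrow> bool" where
  "graph_loop G e \<longleftrightarrow> e \<in> edges G \<and> card (ends G e) = 1"

definition multigraph :: "('v, 'e) multigraph \<Rightarrow> bool" where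
  "multigraph G \<longleftrightarrow>
     finite (verts G) \<and> finite (edges G) \<and>
     (\<forall>e\<in>edges G. ends G e \<subseteq> verts G \<and> card (ends G e) \<in> {1, 2}) \<and>
     (\<exists>e\<in>edges G. \<not> graph_loop G e)"

definition isolated_vertex :: "('v, 'e) multigraph \<Rightarrow> 'v \<Rightarrow> bool" where
  "isolated_vertex G v \<longleftrightarrow> v \<in> verts G \<and> (\<forall>e\<in>edges G. v \<notin> ends G e)"

definition adjacency :: "('v, 'e) multigraph \<Rightarrow> ('v \<times> 'v) set" where
  "adjacency G = {(u, v). \<exists>e\<in>edges G. ends G e = {u, v}}"

definition graph_disconnected :: "('v, 'e) multigraph \<Rightarrow> bool" where
  "graph_disconnected G \<longleftrightarrow> (\<exists>u\<in>verts G. \<exists>v\<in>verts G. (u, v) \<notin> (adjacency G)\<^sup>*)"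

definition delete_vertex :: "('v, 'e) multigraph \<Rightarrow> 'v \<Rightarrow> ('v, 'e) multigraph" where
  "delete_vertex G v =
     \<lparr> verts = verts G - {v}, edges = {e \<in> edges G. v \<notin> ends G e}, ends = ends G \<rparr>"

definition nexus :: "('v, 'e) multigraph \<Rightarrow> 'v \<Rightarrow> bool" where
  "nexus G v \<longleftrightarrow> v \<in> verts G \<and> graph_disconnected (delete_vertex G v)"

text \<open>An orientation is given by source and target maps.\<close>

definition orientation :: "('v, 'e) multigraph \<Rightarrow> ('e \<Rightarrow> 'v) \<Rightarrow> ('e \<Rightarrow> 'v) \<Rightarrow> bool" where
  "orientation G s t \<longleftrightarrow> (\<forall>e\<in>edges G. ends G e = {s e, t e})"

definition incidence_vector ::
  "('v, 'e) multigraph \<Rightarrow> ('e \<Rightarrow> 'v) \<Rightarrow> ('e \<Rightarrow> 'v) \<Rightarrow> 'v \<Rightarrow> 'e \<Rightarrow> 'k::field" where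
  "incidence_vector G s t v =
     (\<lambda>e. if e \<in> edges G \<and> s e \<noteq> t e
          then (if v = s e then - 1 else if v = t e then 1 else 0) else 0)"

definition graph_config ::
  "('v, 'e) multigraph \<Rightarrow> ('e \<Rightarrow> 'v) \<Rightarrow> ('e \<Rightarrow> 'v) \<Rightarrow> ('e \<Rightarrow> 'k::field) set" where
  "graph_config G s t = fun_space.span (incidence_vector G s t ` verts G)"

definition graph_complement ::
  "('v, 'e) multigraph \<Rightarrow> ('e \<Rightarrow> 'v) \<Rightarrow> ('e \<Rightarrow> 'v) \<Rightarrow> (('e \<Rightarrow> 'k alg_closure) set, 'k::field) kspace"
  where
  "graph_complement G s t = config_complement (edges G) (graph_config G s t)"

end

theory Submission
  imports Defs
begin

text \<open>
  The polynomial of a configuration does not vanish at \<open>x\<close> exactly if the diagonal form with entries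
  \<open>x\<close> is nondegenerate on the configuration, extended to the algebraic closure
  (\<open>mp_eval_config_polynomial_nonzero_iff\<close>). This turns matroid properties of \<open>e\<close> into properties of
  the hypersurface complement. If the coordinate \<open>e\<close> is a multiple of another coordinate on \<open>W\<close>, a
  linear change of coordinates removes \<open>x\<^sub>e\<close> from the polynomial (\<open>nondegenerate_parallel\<close>). If \<open>W\<close> is
  a direct sum of configurations on disjoint sets of elements, the complement is that of a product
  of polynomials in disjoint sets of variables (\<open>nondegenerate_direct_sum\<close>); for a coloop one factor
  is \<open>x\<^sub>e\<close>.

  In all cases it remains to compute the class of the complement of \<open>p q\<close> in projective space, where
  \<open>p\<close> is homogeneous of positive degree in variables \<open>E\<close> and \<open>q\<close> is homogeneous in disjoint variables
  \<open>F\<close>. Projecting to the coordinates in \<open>E\<close> fibres it over the complement of \<open>p\<close>, with fibre the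
  complement of \<open>q\<close> in affine space and trivial over each standard chart. Stratifying by coordinate
  hyperplanes gives the product formula \<open>K0_class_join\<close>. For \<open>q = 1\<close> or \<open>q = x\<^sub>e\<close> in one variable the
  fibre is the affine line or the torus, which settles loops, parallel elements and coloops. For two
  summands of positive rank the fibre is the affine cone over the second complement; being itself
  the complement of \<open>q x\<^sub>i\<close> for a new variable, its class is a multiple of the torus
  (\<open>K0_class_cone\<close>). A disconnected matroid splits \<open>W\<close> in this way by dual families
  (\<open>config_disconnected\<close>), and a component of a graph, possibly after removal of a nexus, splits the
  graph configuration directly (\<open>graph_cut_restrict_to\<close>).

  The classes are meaningful only for spaces isomorphic to varieties whose points are lists. The first
  half of the development therefore shows that closed subsets of principal open sets of projective
  space are varieties (\<open>is_variety_proj_piece\<close>, \<open>representable_proj_piece\<close>), and characterises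
  morphisms into affine space, projective space, subspaces and products by coordinate functions, so
  that isomorphisms can be given by formulas.
\<close>

section \<open>Evaluation of multivariate polynomials\<close>

text \<open>
  Summing over any finite superset of the support lets polynomials with different supports be
  compared term by term.
\<close>

lemma mp_eval_sum_superset:
  assumes "finite A" "Poly_Mapping.keys p \<subseteq> A"
  shows "mp_eval p x = (\<Sum>m\<in>A. to_ac (Poly_Mapping.lookup p m) *
           (\<Prod>i\<in>Poly_Mapping.keys m. x i ^ Poly_Mapping.lookup m i))"
  unfolding mp_eval_def
  by (rule sum.mono_neutral_left) (use assms in \<open>auto simp: in_keys_iff\<close>)

lemma mp_eval_add: "mp_eval (p + q) x = mp_eval p x + mp_eval q x"
proof -
  let ?A = "Poly_Mapping.keys p \<union> Poly_Mapping.keys q"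
  have "Poly_Mapping.keys (p + q) \<subseteq> ?A" by (rule keys_add)
  then show ?thesis
    using mp_eval_sum_superset[of ?A "p + q" x] mp_eval_sum_superset[of ?A p x]
      mp_eval_sum_superset[of ?A q x]
    by (simp add: lookup_add ring_distribs sum.distrib)
qed

lemma mp_eval_zero [simp]: "mp_eval 0 x = 0"
  by (simp add: mp_eval_def)

lemma mp_eval_single:
  "mp_eval (Poly_Mapping.single m c) x =
     to_ac c * (\<Prod>i\<in>Poly_Mapping.keys m. x i ^ Poly_Mapping.lookup m i)"
  by (cases "c = 0") (simp_all add: mp_eval_def)

lemma monomial_eval_add:
  fixes x :: "'i \<Rightarrow> 'a::comm_semiring_1"
  shows "(\<Prod>i\<in>Poly_Mapping.keys (m + n). x i ^ Poly_Mapping.lookup (m + n) i) =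
    (\<Prod>i\<in>Poly_Mapping.keys m. x i ^ Poly_Mapping.lookup m i) *
    (\<Prod>i\<in>Poly_Mapping.keys n. x i ^ Poly_Mapping.lookup n i)"
proof -
  let ?A = "Poly_Mapping.keys m \<union> Poly_Mapping.keys n"
  have ext: "(\<Prod>i\<in>Poly_Mapping.keys k. x i ^ Poly_Mapping.lookup k i) =
      (\<Prod>i\<in>?A. x i ^ Poly_Mapping.lookup k i)"
    if "Poly_Mapping.keys k \<subseteq> ?A" for k
    by (rule prod.mono_neutral_left) (use that in \<open>auto simp: in_keys_iff\<close>)
  show ?thesis
    using ext[of m] ext[of n] ext[of "m + n"] keys_add[of m n]
    by (simp add: lookup_add power_add prod.distrib)
qed

lemma poly_mapping_sum_single:
  "(p :: 'a \<Rightarrow>\<^sub>0 'b::comm_monoid_add) =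
     (\<Sum>m\<in>Poly_Mapping.keys p. Poly_Mapping.single m (Poly_Mapping.lookup p m))"
proof (rule poly_mapping_eqI)
  fix k
  show "Poly_Mapping.lookup p k =
      Poly_Mapping.lookup (\<Sum>m\<in>Poly_Mapping.keys p. Poly_Mapping.single m (Poly_Mapping.lookup p m)) k"
    by (auto simp: lookup_sum lookup_single when_def in_keys_iff sum.delta)
qed

lemma mp_eval_sum: "mp_eval (\<Sum>a\<in>A. f a) x = (\<Sum>a\<in>A. mp_eval (f a) x)"
  by (induction A rule: infinite_finite_induct) (auto simp: mp_eval_add)

lemma mp_eval_mult: "mp_eval (p * q) x = mp_eval p x * mp_eval q x"
proof -
  have "p * q = (\<Sum>m\<in>Poly_Mapping.keys p. \<Sum>n\<in>Poly_Mapping.keys q.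
      Poly_Mapping.single (m + n) (Poly_Mapping.lookup p m * Poly_Mapping.lookup q n))"
    by (subst (1) poly_mapping_sum_single[of p], subst (1) poly_mapping_sum_single[of q])
      (simp add: sum_product mult_single)
  then have "mp_eval (p * q) x = (\<Sum>m\<in>Poly_Mapping.keys p. \<Sum>n\<in>Poly_Mapping.keys q.
      (to_ac (Poly_Mapping.lookup p m) * (\<Prod>i\<in>Poly_Mapping.keys m. x i ^ Poly_Mapping.lookup m i)) *
      (to_ac (Poly_Mapping.lookup q n) * (\<Prod>i\<in>Poly_Mapping.keys n. x i ^ Poly_Mapping.lookup n i)))"
    by (simp add: mp_eval_sum mp_eval_single monomial_eval_add mult.assoc mult.left_commute)
  then show ?thesis
    by (simp add: mp_eval_def sum_product)
qed

lemma mp_eval_const [simp]: "mp_eval (mp_const c) x = to_ac c"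
  by (simp add: mp_const_def mp_eval_single)

lemma mp_eval_var [simp]: "mp_eval (mp_var i) x = x i"
  by (simp add: mp_var_def mp_eval_single)

lemma mp_eval_one [simp]: "mp_eval 1 x = 1"
  using mp_eval_const[of 1 x] by (simp add: mp_const_def)

lemma mp_eval_power: "mp_eval (p ^ n) x = mp_eval p x ^ n"
  by (induction n) (simp_all add: mp_eval_mult)

lemma mp_eval_hom: "comm_ring_hom (\<lambda>p. mp_eval p x)"
  by unfold_locales (simp_all add: mp_eval_add mp_eval_mult)

lemma mp_homogeneous_zero [simp]: "mp_homogeneous d 0"
  by (simp add: mp_homogeneous_def)

lemma mp_homogeneous_add:
  "mp_homogeneous d p \<Longrightarrow> mp_homogeneous d q \<Longrightarrow> mp_homogeneous d (p + q)"
  using keys_add[of p q] unfolding mp_homogeneous_def by blast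

lemma mp_homogeneous_uminus: "mp_homogeneous d p \<Longrightarrow> mp_homogeneous d (- p)"
  by (simp add: mp_homogeneous_def in_keys_iff)

lemma mp_homogeneous_sum:
  "(\<And>a. a \<in> A \<Longrightarrow> mp_homogeneous d (f a)) \<Longrightarrow> mp_homogeneous d (\<Sum>a\<in>A. f a)"
  by (induction A rule: infinite_finite_induct) (auto simp: mp_homogeneous_add)

lemma mp_homogeneous_const [simp]: "mp_homogeneous 0 (mp_const c)"
  by (simp add: mp_homogeneous_def mp_const_def)

lemma mp_homogeneous_one [simp]: "mp_homogeneous 0 1"
  using mp_homogeneous_const[of 1] by (simp add: mp_const_def)

lemma mp_homogeneous_var [simp]: "mp_homogeneous (Suc 0) (mp_var i)"
  by (simp add: mp_homogeneous_def mp_var_def)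

lemma monomial_degree_add:
  "(\<Sum>i\<in>Poly_Mapping.keys (m + n). Poly_Mapping.lookup (m + n) i) =
    (\<Sum>i\<in>Poly_Mapping.keys m. Poly_Mapping.lookup m i) +
    (\<Sum>i\<in>Poly_Mapping.keys n. Poly_Mapping.lookup (n :: 'i \<Rightarrow>\<^sub>0 nat) i)"
proof -
  let ?A = "Poly_Mapping.keys m \<union> Poly_Mapping.keys n"
  have ext: "(\<Sum>i\<in>Poly_Mapping.keys k. Poly_Mapping.lookup k i) =
      (\<Sum>i\<in>?A. Poly_Mapping.lookup k i)"
    if "Poly_Mapping.keys k \<subseteq> ?A" for k
    by (rule sum.mono_neutral_left) (use that in \<open>auto simp: in_keys_iff\<close>)
  show ?thesis
    using ext[of m] ext[of n] ext[of "m + n"] keys_add[of m n]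
    by (simp add: lookup_add sum.distrib)
qed

lemma mp_homogeneous_mult:
  assumes "mp_homogeneous d p" "mp_homogeneous d' q"
  shows "mp_homogeneous (d + d') (p * q)"
  unfolding mp_homogeneous_def
proof
  fix k assume "k \<in> Poly_Mapping.keys (p * q)"
  then obtain m n where "m \<in> Poly_Mapping.keys p" "n \<in> Poly_Mapping.keys q" "k = m + n"
    using keys_mult[of p q] by blast
  then show "(\<Sum>i\<in>Poly_Mapping.keys k. Poly_Mapping.lookup k i) = d + d'"
    using assms by (simp add: mp_homogeneous_def monomial_degree_add)
qed

lemma mp_homogeneous_power:
  "mp_homogeneous d p \<Longrightarrow> mp_homogeneous (n * d) (p ^ n)"
  by (induction n) (auto dest: mp_homogeneous_mult)

lemma mp_homogeneous_prod:
  "finite A \<Longrightarrow> (\<And>a. a \<in> A \<Longrightarrow> mp_homogeneous (Suc 0) (f a)) \<Longrightarrow>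
    mp_homogeneous (card A) (\<Prod>a\<in>A. f a)"
proof (induction A rule: finite_induct)
  case (insert x F)
  then show ?case using mp_homogeneous_mult[of "Suc 0" "f x" "card F" "prod f F"] by simp
qed simp

lemma mp_eval_scale:
  assumes "mp_homogeneous d p"
  shows "mp_eval p (\<lambda>i. c * x i) = c ^ d * mp_eval p x"
  unfolding mp_eval_def sum_distrib_left
proof (rule sum.cong)
  fix m assume "m \<in> Poly_Mapping.keys p"
  then have "(\<Sum>i\<in>Poly_Mapping.keys m. Poly_Mapping.lookup m i) = d"
    using assms by (simp add: mp_homogeneous_def)
  then have "(\<Prod>i\<in>Poly_Mapping.keys m. c ^ Poly_Mapping.lookup m i) = c ^ d"
    by (simp flip: power_sum)
  then show "to_ac (Poly_Mapping.lookup p m) *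
      (\<Prod>i\<in>Poly_Mapping.keys m. (c * x i) ^ Poly_Mapping.lookup m i) =
      c ^ d * (to_ac (Poly_Mapping.lookup p m) *
        (\<Prod>i\<in>Poly_Mapping.keys m. x i ^ Poly_Mapping.lookup m i))"
    by (simp add: power_mult_distrib prod.distrib mult.left_commute)
qed simp

section \<open>Spaces with a sheaf of local functions\<close>

text \<open>
  All spaces used here carry algebras of functions in which a section is invertible away from its
  closed zero set. This common property is what turns questions about morphisms into questions
  about coordinate functions, so it is established once for affine space, projective space,
  subspaces and products, and afterwards replaces their explicit descriptions.
\<close>

definition ringed :: "('p, 'k::field) kspace \<Rightarrow> bool" where
  "ringed X \<longleftrightarrow> function_sheaf X \<and>
     (\<forall>U. openin (ktop X) U \<longrightarrow>
        (\<forall>c. (\<lambda>_. to_ac c) \<in> regular X U) \<and>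
        (\<forall>f\<in>regular X U. \<forall>g\<in>regular X U.
           (\<lambda>x. f x + g x) \<in> regular X U \<and> (\<lambda>x. f x * g x) \<in> regular X U) \<and>
        (\<forall>f\<in>regular X U. openin (ktop X) {x\<in>U. f x \<noteq> 0} \<and>
           (\<lambda>x. inverse (f x)) \<in> regular X {x\<in>U. f x \<noteq> 0}))"

lemma ringed_sheaf: "ringed X \<Longrightarrow> function_sheaf X"
  by (simp add: ringed_def)

lemma regular_cong:
  assumes "function_sheaf X" "openin (ktop X) U" "f \<in> regular X U" "\<And>x. x \<in> U \<Longrightarrow> g x = f x"
  shows "g \<in> regular X U"
  by (rule assms(1)[unfolded function_sheaf_def, THEN conjunct1, rule_format, of U f g])
    (intro conjI assms ballI)

lemma regular_restrict:
  assumes "function_sheaf X" "openin (ktop X) U" "openin (ktop X) V" "V \<subseteq> U" "f \<in> regular X U"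
  shows "f \<in> regular X V"
  by (rule assms(1)[unfolded function_sheaf_def, THEN conjunct2, THEN conjunct1, rule_format, of U V f])
    (intro conjI assms)

lemma regular_glue:
  assumes "function_sheaf X" "openin (ktop X) U"
    "\<And>x. x \<in> U \<Longrightarrow> \<exists>V. openin (ktop X) V \<and> x \<in> V \<and> V \<subseteq> U \<and> f \<in> regular X V"
  shows "f \<in> regular X U"
  by (rule assms(1)[unfolded function_sheaf_def, THEN conjunct2, THEN conjunct2, rule_format, of U f])
    (intro conjI assms ballI)

text \<open>
  Gluing in the form used throughout: near each point the function only has to agree with some
  regular function defined on some neighbourhood, which need not lie inside the given open set.
\<close>

lemma regular_local:
  assumes X: "function_sheaf X" and U: "openin (ktop X) U"
    and loc: "\<And>x. x \<in> U \<Longrightarrow> \<exists>V g. openin (ktop X) V \<and> x \<in> V \<and> g \<in> regular X V \<and>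
      (\<forall>y\<in>U \<inter> V. f y = g y)"
  shows "f \<in> regular X U"
proof -
  have "\<exists>V. openin (ktop X) V \<and> x \<in> V \<and> V \<subseteq> U \<and> f \<in> regular X V" if x: "x \<in> U" for x
  proof -
    obtain V g where V: "openin (ktop X) V" "x \<in> V" "g \<in> regular X V" "\<forall>y\<in>U \<inter> V. f y = g y"
      using loc[OF x] by blast
    have o: "openin (ktop X) (U \<inter> V)" using U V(1) by blast
    have "g \<in> regular X (U \<inter> V)" using regular_restrict[OF X V(1) o] V(3) by blast
    then have "f \<in> regular X (U \<inter> V)" using regular_cong[OF X o] V(4) by blast
    then show ?thesis using o x V(2) by blast
  qed
  then show ?thesis using regular_glue[OF X U] by blast
qed

context
  fixes X :: "('p, 'k::field) kspace" and U :: "'p set"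
  assumes X: "ringed X" and U: "openin (ktop X) U"
begin

lemma regular_const: "(\<lambda>_. to_ac c) \<in> regular X U"
  using X U by (simp add: ringed_def)

lemma regular_add: "f \<in> regular X U \<Longrightarrow> g \<in> regular X U \<Longrightarrow> (\<lambda>x. f x + g x) \<in> regular X U"
  using X U by (simp add: ringed_def)

lemma regular_mult: "f \<in> regular X U \<Longrightarrow> g \<in> regular X U \<Longrightarrow> (\<lambda>x. f x * g x) \<in> regular X U"
  using X U by (simp add: ringed_def)

lemma regular_zero: "(\<lambda>_. 0) \<in> regular X U"
  using regular_const[of 0] by simp

lemma regular_one: "(\<lambda>_. 1) \<in> regular X U"
  using regular_const[of 1] by simp

lemma regular_diff:
  assumes "f \<in> regular X U" "g \<in> regular X U"
  shows "(\<lambda>x. f x - g x) \<in> regular X U"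
  using regular_add[OF assms(1) regular_mult[OF regular_const[of "-1"] assms(2)]] by simp

lemma regular_power: "f \<in> regular X U \<Longrightarrow> (\<lambda>x. f x ^ n) \<in> regular X U"
  by (induction n) (simp_all add: regular_one regular_mult)

lemma regular_sum:
  "(\<And>a. a \<in> A \<Longrightarrow> f a \<in> regular X U) \<Longrightarrow> (\<lambda>x. \<Sum>a\<in>A. f a x) \<in> regular X U"
  by (induction A rule: infinite_finite_induct) (simp_all add: regular_zero regular_add)

lemma regular_prod:
  "(\<And>a. a \<in> A \<Longrightarrow> f a \<in> regular X U) \<Longrightarrow> (\<lambda>x. \<Prod>a\<in>A. f a x) \<in> regular X U"
  by (induction A rule: infinite_finite_induct) (simp_all add: regular_one regular_mult)

lemma openin_nonvanishing: "f \<in> regular X U \<Longrightarrow> openin (ktop X) {x\<in>U. f x \<noteq> 0}"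
  using X U by (simp add: ringed_def)

lemma regular_inverse_nonvanishing:
  "f \<in> regular X U \<Longrightarrow> (\<lambda>x. inverse (f x)) \<in> regular X {x\<in>U. f x \<noteq> 0}"
  using X U by (simp add: ringed_def)

lemma regular_divide:
  assumes "f \<in> regular X U" "g \<in> regular X U" "\<And>x. x \<in> U \<Longrightarrow> g x \<noteq> 0"
  shows "(\<lambda>x. f x / g x) \<in> regular X U"
proof -
  have "{x\<in>U. g x \<noteq> 0} = U" using assms(3) by auto
  then have "(\<lambda>x. inverse (g x)) \<in> regular X U"
    using regular_inverse_nonvanishing[OF assms(2)] by simp
  from regular_mult[OF assms(1) this] show ?thesis by (simp add: divide_inverse)
qed

lemma regular_mp_eval:
  assumes "\<And>i. (\<lambda>x. g i x) \<in> regular X U"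
  shows "(\<lambda>x. mp_eval p (\<lambda>i. g i x)) \<in> regular X U"
  unfolding mp_eval_def
  by (intro regular_sum regular_mult regular_prod regular_power regular_const assms)

end

lemma ringed_closedin_zero:
  assumes X: "ringed X" and "f \<in> regular X (points X)"
  shows "closedin (ktop X) {x\<in>points X. f x = 0}"
proof -
  have "points X - {x\<in>points X. f x = 0} = {x\<in>points X. f x \<noteq> 0}" by auto
  then show ?thesis
    using openin_nonvanishing[OF X openin_topspace assms(2)] by (simp add: closedin_def)
qed

text \<open>
  Each structure sheaf below consists of the functions that locally belong to an explicit presheaf
  \<open>L\<close> of fractions. Locality passes every required property from \<open>L\<close> to the sheaf, because two
  sections at a point can be represented in \<open>L\<close> over a common neighbourhood.
\<close>

lemma ringed_from_local_functions:
  fixes X :: "('p, 'k::field) kspace"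
  assumes reg: "\<And>U. openin (ktop X) U \<Longrightarrow>
      regular X U = {f. \<forall>x\<in>U. \<exists>V. openin (ktop X) V \<and> x \<in> V \<and> V \<subseteq> U \<and> f \<in> L V}"
    and restr: "\<And>U V f. openin (ktop X) U \<Longrightarrow> openin (ktop X) V \<Longrightarrow> V \<subseteq> U \<Longrightarrow> f \<in> L U \<Longrightarrow> f \<in> L V"
    and cong: "\<And>U f g. openin (ktop X) U \<Longrightarrow> f \<in> L U \<Longrightarrow> (\<And>x. x \<in> U \<Longrightarrow> g x = f x) \<Longrightarrow> g \<in> L U"
    and const: "\<And>U c. openin (ktop X) U \<Longrightarrow> (\<lambda>_. to_ac c) \<in> L U"
    and add: "\<And>U f g. openin (ktop X) U \<Longrightarrow> f \<in> L U \<Longrightarrow> g \<in> L U \<Longrightarrow> (\<lambda>x. f x + g x) \<in> L U"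
    and mult: "\<And>U f g. openin (ktop X) U \<Longrightarrow> f \<in> L U \<Longrightarrow> g \<in> L U \<Longrightarrow> (\<lambda>x. f x * g x) \<in> L U"
    and opn: "\<And>U f. openin (ktop X) U \<Longrightarrow> f \<in> L U \<Longrightarrow> openin (ktop X) {x\<in>U. f x \<noteq> 0}"
    and inv: "\<And>U f. openin (ktop X) U \<Longrightarrow> f \<in> L U \<Longrightarrow> (\<lambda>x. inverse (f x)) \<in> L {x\<in>U. f x \<noteq> 0}"
  shows "ringed X"
proof -
  have D: "\<exists>V. openin (ktop X) V \<and> x \<in> V \<and> V \<subseteq> U \<and> f \<in> L V"
    if "openin (ktop X) U" "f \<in> regular X U" "x \<in> U" for U f x
    using that reg by blast
  have I: "f \<in> regular X U"
    if U: "openin (ktop X) U" and ex: "\<And>x. x \<in> U \<Longrightarrow> \<exists>V. openin (ktop X) V \<and> x \<in> V \<and> f \<in> L V"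
    for U f
  proof -
    have "\<exists>V. openin (ktop X) V \<and> x \<in> V \<and> V \<subseteq> U \<and> f \<in> L V" if x: "x \<in> U" for x
    proof -
      obtain V where V: "openin (ktop X) V" "x \<in> V" "f \<in> L V" using ex[OF x] by blast
      have o: "openin (ktop X) (U \<inter> V)" using V(1) U by blast
      show ?thesis
        by (rule exI[of _ "U \<inter> V"]) (use o V(2) x restr[OF V(1) o _ V(3)] in auto)
    qed
    then show ?thesis using reg[OF U] by blast
  qed
  have two: "\<exists>V. openin (ktop X) V \<and> x \<in> V \<and> V \<subseteq> U \<and> f \<in> L V \<and> g \<in> L V"
    if U: "openin (ktop X) U" "f \<in> regular X U" "g \<in> regular X U" "x \<in> U" for U f g x
  proof -
    obtain V where V: "openin (ktop X) V" "x \<in> V" "V \<subseteq> U" "f \<in> L V"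
      using D[OF U(1,2,4)] by blast
    obtain V' where V': "openin (ktop X) V'" "x \<in> V'" "V' \<subseteq> U" "g \<in> L V'"
      using D[OF U(1,3,4)] by blast
    have o: "openin (ktop X) (V \<inter> V')" using V V' by blast
    show ?thesis
      by (rule exI[of _ "V \<inter> V'"])
        (use o V V' restr[OF V(1) o _ V(4)] restr[OF V'(1) o _ V'(4)] in auto)
  qed
  have sheaf: "function_sheaf X"
    unfolding function_sheaf_def
  proof (intro conjI allI impI; elim conjE)
    fix U f g assume a: "openin (ktop X) U" "f \<in> regular X U" "\<forall>x\<in>U. g x = f x"
    show "g \<in> regular X U"
    proof (rule I[OF a(1)])
      fix x assume "x \<in> U"
      then obtain V where V: "openin (ktop X) V" "x \<in> V" "V \<subseteq> U" "f \<in> L V"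
        using D[OF a(1,2)] by blast
      have "g \<in> L V" by (rule cong[OF V(1,4)]) (use V(3) a(3) in blast)
      then show "\<exists>V. openin (ktop X) V \<and> x \<in> V \<and> g \<in> L V" using V(1,2) by blast
    qed
  next
    fix U V f assume a: "openin (ktop X) U" "openin (ktop X) V" "V \<subseteq> U" "f \<in> regular X U"
    show "f \<in> regular X V"
    proof (rule I[OF a(2)])
      fix x assume "x \<in> V"
      then have "x \<in> U" using a(3) by blast
      from D[OF a(1,4) this] show "\<exists>V. openin (ktop X) V \<and> x \<in> V \<and> f \<in> L V" by blast
    qed
  next
    fix U f assume a: "openin (ktop X) U"
      "\<forall>x\<in>U. \<exists>V. openin (ktop X) V \<and> x \<in> V \<and> V \<subseteq> U \<and> f \<in> regular X V"
    show "f \<in> regular X U"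
    proof (rule I[OF a(1)])
      fix x assume "x \<in> U"
      then obtain V where V: "openin (ktop X) V" "x \<in> V" "f \<in> regular X V" using a(2) by blast
      from D[OF V(1,3,2)] show "\<exists>V. openin (ktop X) V \<and> x \<in> V \<and> f \<in> L V" by blast
    qed
  qed
  show ?thesis
    unfolding ringed_def
  proof (intro conjI allI impI ballI)
    fix U assume U: "openin (ktop X) U"
    show "(\<lambda>_. to_ac c) \<in> regular X U" for c
      by (rule I[OF U]) (use const[OF U, of c] U in blast)
    show "(\<lambda>x. f x + g x) \<in> regular X U" if fg: "f \<in> regular X U" "g \<in> regular X U" for f g
    proof (rule I[OF U])
      fix x assume "x \<in> U"
      from two[OF U fg this] obtain V where V: "openin (ktop X) V" "x \<in> V" "f \<in> L V" "g \<in> L V"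
        by blast
      then show "\<exists>V. openin (ktop X) V \<and> x \<in> V \<and> (\<lambda>x. f x + g x) \<in> L V"
        using add[OF V(1,3,4)] by blast
    qed
    show "(\<lambda>x. f x * g x) \<in> regular X U" if fg: "f \<in> regular X U" "g \<in> regular X U" for f g
    proof (rule I[OF U])
      fix x assume "x \<in> U"
      from two[OF U fg this] obtain V where V: "openin (ktop X) V" "x \<in> V" "f \<in> L V" "g \<in> L V"
        by blast
      then show "\<exists>V. openin (ktop X) V \<and> x \<in> V \<and> (\<lambda>x. f x * g x) \<in> L V"
        using mult[OF V(1,3,4)] by blast
    qed
    fix f assume f: "f \<in> regular X U"
    show o: "openin (ktop X) {x\<in>U. f x \<noteq> 0}"
    proof (subst openin_subopen, intro ballI)
      fix x assume x: "x \<in> {x\<in>U. f x \<noteq> 0}"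
      then obtain V where V: "openin (ktop X) V" "x \<in> V" "V \<subseteq> U" "f \<in> L V"
        using D[OF U f] by blast
      show "\<exists>T. openin (ktop X) T \<and> x \<in> T \<and> T \<subseteq> {x\<in>U. f x \<noteq> 0}"
        by (rule exI[of _ "{x\<in>V. f x \<noteq> 0}"]) (use opn[OF V(1,4)] V x in auto)
    qed
    show "(\<lambda>x. inverse (f x)) \<in> regular X {x\<in>U. f x \<noteq> 0}"
    proof (rule I[OF o])
      fix x assume x: "x \<in> {x\<in>U. f x \<noteq> 0}"
      then obtain V where V: "openin (ktop X) V" "x \<in> V" "V \<subseteq> U" "f \<in> L V"
        using D[OF U f] by blast
      then show "\<exists>V. openin (ktop X) V \<and> x \<in> V \<and> (\<lambda>x. inverse (f x)) \<in> L V"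
        using inv[OF V(1,4)] opn[OF V(1,4)] x by blast
    qed
  qed (rule sheaf)
qed

section \<open>Morphisms and subspaces\<close>

lemma points_induced: "points (induced X S) = points X \<inter> S"
  by (simp add: induced_def)

lemma openin_induced: "openin (ktop (induced X S)) U \<longleftrightarrow> (\<exists>V. openin (ktop X) V \<and> U = V \<inter> S)"
  by (simp add: induced_def openin_subtopology)

text \<open>
  On a subspace, \<open>L\<close> consists of the restrictions of regular functions on surrounding open sets.
\<close>

lemma ringed_induced:
  assumes X: "ringed X"
  shows "ringed (induced X S)"
proof (rule ringed_from_local_functions)
  define L where "L V = {f. \<exists>V' g. openin (ktop X) V' \<and> V \<subseteq> V' \<and> g \<in> regular X V' \<and>
    (\<forall>y\<in>V. f y = g y)}" for V
  have LI: "f \<in> L V" if "openin (ktop X) V'" "V \<subseteq> V'" "g \<in> regular X V'" "\<And>y. y \<in> V \<Longrightarrow> f y = g y"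
    for f V V' g
    using that unfolding L_def by blast
  have LE: "\<exists>V' g. openin (ktop X) V' \<and> V \<subseteq> V' \<and> g \<in> regular X V' \<and> (\<forall>y\<in>V. f y = g y)"
    if "f \<in> L V" for f V
    using that unfolding L_def by blast
  have L2: "\<exists>V' f' g'. openin (ktop X) V' \<and> V \<subseteq> V' \<and> f' \<in> regular X V' \<and> g' \<in> regular X V' \<and>
      (\<forall>y\<in>V. f y = f' y \<and> g y = g' y)"
    if fg: "f \<in> L V" "g \<in> L V" for f g V
  proof -
    obtain A f' where A: "openin (ktop X) A" "V \<subseteq> A" "f' \<in> regular X A" "\<forall>y\<in>V. f y = f' y"
      using LE[OF fg(1)] by blast
    obtain B g' where B: "openin (ktop X) B" "V \<subseteq> B" "g' \<in> regular X B" "\<forall>y\<in>V. g y = g' y"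
      using LE[OF fg(2)] by blast
    have o: "openin (ktop X) (A \<inter> B)" using A(1) B(1) by blast
    show ?thesis
      by (rule exI[of _ "A \<inter> B"], rule exI[of _ f'], rule exI[of _ g'])
        (use o A B regular_restrict[OF ringed_sheaf[OF X] A(1) o _ A(3)]
          regular_restrict[OF ringed_sheaf[OF X] B(1) o _ B(3)] in auto)
  qed
  fix U assume U: "openin (ktop (induced X S)) U"
  then obtain U0 where U0: "openin (ktop X) U0" "U = U0 \<inter> S" by (auto simp: openin_induced)
  show "regular (induced X S) U =
      {f. \<forall>x\<in>U. \<exists>V. openin (ktop (induced X S)) V \<and> x \<in> V \<and> V \<subseteq> U \<and> f \<in> L V}" (is "_ = ?R")
  proof (intro equalityI subsetI)
    fix f assume "f \<in> regular (induced X S) U"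
    then have f: "\<forall>x\<in>U. \<exists>V g. openin (ktop X) V \<and> x \<in> V \<and> g \<in> regular X V \<and> (\<forall>y\<in>U \<inter> V. f y = g y)"
      by (simp add: induced_def)
    have "\<exists>V. openin (ktop (induced X S)) V \<and> x \<in> V \<and> V \<subseteq> U \<and> f \<in> L V" if x: "x \<in> U" for x
    proof -
      obtain V g where V: "openin (ktop X) V" "x \<in> V" "g \<in> regular X V" "\<forall>y\<in>U \<inter> V. f y = g y"
        using f x by blast
      have "openin (ktop (induced X S)) (U \<inter> V)"
        unfolding openin_induced using U0 V(1) by (intro exI[of _ "U0 \<inter> V"]) auto
      moreover have "f \<in> L (U \<inter> V)" by (rule LI[OF V(1) _ V(3)]) (use V(4) in auto)
      ultimately show ?thesis using x V(2) by blast
    qed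
    then show "f \<in> ?R" by blast
  next
    fix f assume f: "f \<in> ?R"
    have "\<exists>V g. openin (ktop X) V \<and> x \<in> V \<and> g \<in> regular X V \<and> (\<forall>y\<in>U \<inter> V. f y = g y)"
      if x: "x \<in> U" for x
    proof -
      obtain V where V: "openin (ktop (induced X S)) V" "x \<in> V" "V \<subseteq> U" "f \<in> L V"
        using f x by blast
      obtain V0 where V0: "openin (ktop X) V0" "V = V0 \<inter> S" using V(1) by (auto simp: openin_induced)
      obtain V' g where V': "openin (ktop X) V'" "V \<subseteq> V'" "g \<in> regular X V'" "\<forall>y\<in>V. f y = g y"
        using LE[OF V(4)] by blast
      have o: "openin (ktop X) (V0 \<inter> V')" using V0(1) V'(1) by blast
      have "g \<in> regular X (V0 \<inter> V')"
        by (rule regular_restrict[OF ringed_sheaf[OF X] V'(1) o _ V'(3)]) simp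
      then show ?thesis using o V(2) V' V0 U0
        by (intro exI[of _ "V0 \<inter> V'"] exI[of _ g]) auto
    qed
    then show "f \<in> regular (induced X S) U" by (simp add: induced_def)
  qed
  show "f \<in> L V" if "openin (ktop (induced X S)) V" "V \<subseteq> U" and f: "f \<in> L U" for V f
  proof -
    obtain V' g where "openin (ktop X) V'" "U \<subseteq> V'" "g \<in> regular X V'" "\<forall>y\<in>U. f y = g y"
      using LE[OF f] by blast
    then show ?thesis using LI[of V' V g f] \<open>V \<subseteq> U\<close> by blast
  qed
  show "g \<in> L U" if f: "f \<in> L U" and eq: "\<And>x. x \<in> U \<Longrightarrow> g x = f x" for f g
  proof -
    obtain V' h where V': "openin (ktop X) V'" "U \<subseteq> V'" "h \<in> regular X V'" "\<forall>y\<in>U. f y = h y"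
      using LE[OF f] by blast
    show ?thesis by (rule LI[OF V'(1-3)]) (use V'(4) eq in simp)
  qed
  show "(\<lambda>_. to_ac c) \<in> L U" for c
    by (rule LI[OF U0(1) _ regular_const[OF X U0(1)]]) (use U0(2) in auto)
  show "(\<lambda>x. f x + g x) \<in> L U" "(\<lambda>x. f x * g x) \<in> L U" if fg: "f \<in> L U" "g \<in> L U" for f g
  proof -
    obtain V' f' g' where V': "openin (ktop X) V'" "U \<subseteq> V'" "f' \<in> regular X V'" "g' \<in> regular X V'"
      "\<forall>y\<in>U. f y = f' y \<and> g y = g' y"
      using L2[OF fg] by blast
    show "(\<lambda>x. f x + g x) \<in> L U"
      by (rule LI[OF V'(1,2) regular_add[OF X V'(1,3,4)]]) (use V'(5) in simp)
    show "(\<lambda>x. f x * g x) \<in> L U"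
      by (rule LI[OF V'(1,2) regular_mult[OF X V'(1,3,4)]]) (use V'(5) in simp)
  qed
  fix f assume f: "f \<in> L U"
  obtain V' g where V': "openin (ktop X) V'" "U \<subseteq> V'" "g \<in> regular X V'" "\<forall>y\<in>U. f y = g y"
    using LE[OF f] by blast
  show "openin (ktop (induced X S)) {x\<in>U. f x \<noteq> 0}"
    unfolding openin_induced
    by (rule exI[of _ "U0 \<inter> {x\<in>V'. g x \<noteq> 0}"])
      (use U0 V' openin_nonvanishing[OF X V'(1,3)] in \<open>auto intro: openin_Int\<close>)
  show "(\<lambda>x. inverse (f x)) \<in> L {x\<in>U. f x \<noteq> 0}"
    by (rule LI[OF openin_nonvanishing[OF X V'(1,3)] _ regular_inverse_nonvanishing[OF X V'(1,3)]])
      (use V' in auto)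
qed

context
  fixes X :: "('p, 'k::field) kspace" and Y :: "('q, 'k) kspace" and \<phi>
  assumes \<phi>: "kmorphism X Y \<phi>"
begin

lemma kmorphism_point: "x \<in> points X \<Longrightarrow> \<phi> x \<in> points Y"
  using \<phi> by (auto simp: kmorphism_def continuous_map_def)

lemma kmorphism_openin: "openin (ktop Y) U \<Longrightarrow> openin (ktop X) {x \<in> points X. \<phi> x \<in> U}"
  using \<phi> by (auto simp: kmorphism_def continuous_map_def)

lemma kmorphism_closedin: "closedin (ktop Y) C \<Longrightarrow> closedin (ktop X) {x \<in> points X. \<phi> x \<in> C}"
  using \<phi> closedin_continuous_map_preimage by (auto simp: kmorphism_def)

lemma kmorphism_regular:
  "openin (ktop Y) U \<Longrightarrow> f \<in> regular Y U \<Longrightarrow> (\<lambda>x. f (\<phi> x)) \<in> regular X {x \<in> points X. \<phi> x \<in> U}"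
  using \<phi> by (auto simp: kmorphism_def comp_def)

lemma kmorphism_regular_on:
  assumes X: "function_sheaf X" and "openin (ktop Y) U" "f \<in> regular Y U"
    and "openin (ktop X) V" "\<And>x. x \<in> V \<Longrightarrow> \<phi> x \<in> U"
  shows "(\<lambda>x. f (\<phi> x)) \<in> regular X V"
  by (rule regular_restrict[OF X kmorphism_openin[OF assms(2)] assms(4) _ kmorphism_regular[OF assms(2,3)]])
    (use assms(4,5) openin_subset in fast)

end

text \<open>
  Pull-backs of regular functions have to be recognised only locally on the source, and only at
  points whose image lies in the domain of the function.
\<close>

lemma kmorphismI:
  assumes X: "function_sheaf X" and cont: "continuous_map (ktop X) (ktop Y) \<phi>"
    and reg: "\<And>U f x. openin (ktop Y) U \<Longrightarrow> f \<in> regular Y U \<Longrightarrow> x \<in> points X \<Longrightarrow> \<phi> x \<in> U \<Longrightarrow>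
      \<exists>V g. openin (ktop X) V \<and> x \<in> V \<and> g \<in> regular X V \<and> (\<forall>y\<in>V. \<phi> y \<in> U \<longrightarrow> f (\<phi> y) = g y)"
  shows "kmorphism X Y \<phi>"
  unfolding kmorphism_def
proof (intro conjI allI impI; (elim conjE)?)
  fix U f assume U: "openin (ktop Y) U" and f: "f \<in> regular Y U"
  show "f \<circ> \<phi> \<in> regular X {x \<in> points X. \<phi> x \<in> U}"
  proof (rule regular_local[OF X])
    show "openin (ktop X) {x \<in> points X. \<phi> x \<in> U}"
      using cont U by (auto simp: continuous_map_def)
    fix x assume x: "x \<in> {x \<in> points X. \<phi> x \<in> U}"
    obtain V g where "openin (ktop X) V" "x \<in> V" "g \<in> regular X V"
      "\<forall>y\<in>V. \<phi> y \<in> U \<longrightarrow> f (\<phi> y) = g y"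
      using reg[OF U f, of x] x by blast
    then show "\<exists>V g. openin (ktop X) V \<and> x \<in> V \<and> g \<in> regular X V \<and>
        (\<forall>y\<in>{x \<in> points X. \<phi> x \<in> U} \<inter> V. (f \<circ> \<phi>) y = g y)"
      by (intro exI[of _ V] exI[of _ g]) auto
  qed
qed (rule cont)

lemma kmorphism_comp:
  assumes "kmorphism X Y \<phi>" "kmorphism Y Z \<psi>"
  shows "kmorphism X Z (\<lambda>x. \<psi> (\<phi> x))"
  unfolding kmorphism_def
proof (intro conjI allI impI; (elim conjE)?)
  show "continuous_map (ktop X) (ktop Z) (\<lambda>x. \<psi> (\<phi> x))"
    using continuous_map_compose[of "ktop X" "ktop Y" \<phi> "ktop Z" \<psi>] assms
    by (simp add: kmorphism_def comp_def)
  fix U f assume U: "openin (ktop Z) U" "f \<in> regular Z U"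
  have "{x \<in> points X. \<psi> (\<phi> x) \<in> U} = {x \<in> points X. \<phi> x \<in> {y \<in> points Y. \<psi> y \<in> U}}"
    using kmorphism_point[OF assms(1)] by auto
  then show "f \<circ> (\<lambda>x. \<psi> (\<phi> x)) \<in> regular X {x \<in> points X. \<psi> (\<phi> x) \<in> U}"
    using kmorphism_regular[OF assms(1) kmorphism_openin[OF assms(2) U(1)]
        kmorphism_regular[OF assms(2) U]]
    by (simp add: comp_def)
qed

lemma kmorphism_id: "kmorphism X X (\<lambda>x. x)"
proof -
  have "{x \<in> points X. x \<in> U} = U" if "openin (ktop X) U" for U
    using openin_subset[OF that] by auto
  then show ?thesis
    unfolding kmorphism_def by (simp add: comp_def)
qed

lemma kmorphism_inclusion: "kmorphism (induced X S) X (\<lambda>x. x)"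
  unfolding kmorphism_def
proof (intro conjI allI impI; (elim conjE)?)
  show "continuous_map (ktop (induced X S)) (ktop X) (\<lambda>x. x)"
    using continuous_map_from_subtopology[OF continuous_map_id[unfolded id_def], of "ktop X" S] 
    by (simp add: induced_def)
  fix U f assume "openin (ktop X) U" "f \<in> regular X U"
  then show "f \<circ> (\<lambda>x. x) \<in> regular (induced X S) {x \<in> points (induced X S). x \<in> U}"
    by (simp add: induced_def comp_def) blast
qed

text \<open>
  The universal property of a subspace, from which together with the inclusion all isomorphisms
  between subspaces are obtained.
\<close>

lemma kmorphism_corestrict:
  assumes X: "function_sheaf X" and \<phi>: "kmorphism X Y \<phi>"
    and S: "\<And>x. x \<in> points X \<Longrightarrow> \<phi> x \<in> S"
  shows "kmorphism X (induced Y S) \<phi>"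
proof (rule kmorphismI[OF X])
  show "continuous_map (ktop X) (ktop (induced Y S)) \<phi>"
    using \<phi> S by (auto simp: kmorphism_def induced_def continuous_map_in_subtopology)
  fix U f x assume a: "openin (ktop (induced Y S)) U" "f \<in> regular (induced Y S) U" "x \<in> points X" "\<phi> x \<in> U"
  from a(2) have "\<forall>x\<in>U. \<exists>V g. openin (ktop Y) V \<and> x \<in> V \<and> g \<in> regular Y V \<and> (\<forall>y\<in>U \<inter> V. f y = g y)"
    by (simp add: induced_def)
  then obtain V g where V: "openin (ktop Y) V" "\<phi> x \<in> V" "g \<in> regular Y V" "\<forall>y\<in>U \<inter> V. f y = g y"
    using a(4) by blast
  show "\<exists>V g. openin (ktop X) V \<and> x \<in> V \<and> g \<in> regular X V \<and> (\<forall>y\<in>V. \<phi> y \<in> U \<longrightarrow> f (\<phi> y) = g y)"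
    by (rule exI[of _ "{x \<in> points X. \<phi> x \<in> V}"], rule exI[of _ "\<lambda>x. g (\<phi> x)"])
      (use a V kmorphism_openin[OF \<phi> V(1)] kmorphism_regular[OF \<phi> V(1,3)] in auto)
qed

lemma kmorphism_restrict: "kmorphism X Y \<phi> \<Longrightarrow> kmorphism (induced X S) Y \<phi>"
  by (rule kmorphism_comp[OF kmorphism_inclusion])

lemma kmorphism_induced:
  assumes "ringed X" "kmorphism X Y \<phi>" "\<And>x. x \<in> points X \<Longrightarrow> x \<in> S \<Longrightarrow> \<phi> x \<in> T"
  shows "kmorphism (induced X S) (induced Y T) \<phi>"
  by (rule kmorphism_corestrict[OF ringed_sheaf[OF ringed_induced[OF assms(1)]] kmorphism_restrict[OF assms(2)]])
    (use assms(3) in \<open>auto simp: points_induced\<close>)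

lemma kisoI:
  assumes "kmorphism X Y \<phi>" "kmorphism Y X \<chi>" "\<And>x. x \<in> points X \<Longrightarrow> \<chi> (\<phi> x) = x"
    "\<And>y. y \<in> points Y \<Longrightarrow> \<phi> (\<chi> y) = y"
  shows "kiso X Y"
  using assms unfolding kiso_def by blast

lemma kiso_sym: "kiso X Y \<Longrightarrow> kiso Y X"
  unfolding kiso_def by blast

lemma kiso_trans:
  assumes "kiso X Y" "kiso Y Z"
  shows "kiso X Z"
proof -
  obtain \<phi> \<chi> where 1: "kmorphism X Y \<phi>" "kmorphism Y X \<chi>" "\<forall>x\<in>points X. \<chi> (\<phi> x) = x"
    "\<forall>y\<in>points Y. \<phi> (\<chi> y) = y"
    using assms(1) unfolding kiso_def by blast
  obtain \<phi>' \<chi>' where 2: "kmorphism Y Z \<phi>'" "kmorphism Z Y \<chi>'" "\<forall>x\<in>points Y. \<chi>' (\<phi>' x) = x"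
    "\<forall>y\<in>points Z. \<phi>' (\<chi>' y) = y"
    using assms(2) unfolding kiso_def by blast
  show ?thesis
    by (rule kisoI[OF kmorphism_comp[OF 1(1) 2(1)] kmorphism_comp[OF 2(2) 1(2)]])
      (use 1 2 kmorphism_point[OF 1(1)] kmorphism_point[OF 2(2)] in auto)
qed

lemma kiso_induced:
  assumes X: "ringed X" and Y: "ringed Y"
    and \<phi>: "kmorphism X Y \<phi>" "kmorphism Y X \<chi>" "\<And>x. x \<in> points X \<Longrightarrow> \<chi> (\<phi> x) = x"
    "\<And>y. y \<in> points Y \<Longrightarrow> \<phi> (\<chi> y) = y"
    and ST: "\<And>x. x \<in> points X \<Longrightarrow> x \<in> S \<longleftrightarrow> \<phi> x \<in> T"
  shows "kiso (induced X S) (induced Y T)"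
proof (rule kisoI)
  show "kmorphism (induced X S) (induced Y T) \<phi>"
    by (rule kmorphism_induced[OF X \<phi>(1)]) (use ST in simp)
  show "kmorphism (induced Y T) (induced X S) \<chi>"
    by (rule kmorphism_induced[OF Y \<phi>(2)]) (use ST \<phi>(4) kmorphism_point[OF \<phi>(2)] in simp)
qed (use \<phi>(3,4) in \<open>auto simp: points_induced\<close>)

text \<open>
  The two structures agree on open sets but may differ as records, since the functions assigned to
  non-open sets are arbitrary; hence an isomorphism and not an equation.
\<close>

lemma kiso_induced_induced:
  assumes "ringed X"
  shows "kiso (induced (induced X S) T) (induced X (S \<inter> T))"
proof (rule kisoI)
  show "kmorphism (induced (induced X S) T) (induced X (S \<inter> T)) (\<lambda>x. x)"
    by (rule kmorphism_corestrict[OF ringed_sheaf[OF ringed_induced[OF ringed_induced[OF assms]]]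
          kmorphism_restrict[OF kmorphism_inclusion]])
      (auto simp: points_induced)
  show "kmorphism (induced X (S \<inter> T)) (induced (induced X S) T) (\<lambda>x. x)"
    by (intro kmorphism_corestrict ringed_sheaf ringed_induced assms kmorphism_inclusion)
      (auto simp: points_induced)
qed (auto simp: points_induced)

lemma kiso_induced_cong:
  assumes "ringed X" "points X \<inter> S = points X \<inter> T"
  shows "kiso (induced X S) (induced X T)"
  by (rule kiso_induced[OF assms(1,1) kmorphism_id kmorphism_id]) (use assms(2) in auto)

lemma kiso_induced_points: "ringed X \<Longrightarrow> kiso (induced X (points X)) X"
  by (rule kisoI[OF kmorphism_inclusion
        kmorphism_corestrict[OF _ kmorphism_id]])
    (auto simp: ringed_sheaf)

section \<open>Affine space\<close>

lemma openin_affine_space_basic: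
  "openin (ktop (affine_space I :: (_, 'k::field) kspace))
     {x \<in> coord_space I. mp_eval (p :: ('i, 'k) mpoly) x \<noteq> 0}"
  by (auto simp: affine_space_def Let_def intro!: topology_generated_by_Basis)

lemma points_affine_space [simp]:
  "points (affine_space I :: ('i \<Rightarrow> _, 'k::field) kspace) = coord_space I"
proof -
  have "(1 :: ('i, 'k) mpoly) \<in> UNIV" "{x \<in> coord_space I. mp_eval (1 :: ('i, 'k) mpoly) x \<noteq> 0} = coord_space I"
    by auto
  then have "coord_space I \<subseteq> \<Union> (range (\<lambda>p :: ('i, 'k) mpoly. {x \<in> coord_space I. mp_eval p x \<noteq> 0}))"
    by blast
  then show ?thesis
    by (auto simp: affine_space_def Let_def)
qed

lemma regular_affine_space:
  "regular (affine_space I :: (_, 'k::field) kspace) U =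
    {f. \<forall>x\<in>U. \<exists>V. openin (ktop (affine_space I :: (_, 'k) kspace)) V \<and> x \<in> V \<and> V \<subseteq> U \<and>
      f \<in> {f. \<exists>(p :: ('i, 'k) mpoly) q. \<forall>y\<in>V. mp_eval q y \<noteq> 0 \<and> f y = mp_eval p y / mp_eval q y}}"
  unfolding affine_space_def Let_def by simp

lemma ringed_affine_space: "ringed (affine_space I :: ('i \<Rightarrow> _, 'k::field) kspace)"
proof (rule ringed_from_local_functions[OF regular_affine_space])
  let ?X = "affine_space I :: ('i \<Rightarrow> _, 'k::field) kspace"
  fix U :: "('i \<Rightarrow> 'k alg_closure) set" assume U: "openin (ktop ?X) U"
  let ?L = "{f. \<exists>(p :: ('i, 'k) mpoly) q. \<forall>y\<in>U. mp_eval q y \<noteq> 0 \<and> f y = mp_eval p y / mp_eval q y}"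
  show "(\<lambda>_. to_ac c) \<in> ?L" for c
    by (rule CollectI, rule exI[of _ "mp_const c"], rule exI[of _ 1]) simp
  show "(\<lambda>x. f x + g x) \<in> ?L" "(\<lambda>x. f x * g x) \<in> ?L" if fg: "f \<in> ?L" "g \<in> ?L" for f g
  proof -
    obtain p q :: "('i, 'k) mpoly" where f: "\<forall>y\<in>U. mp_eval q y \<noteq> 0 \<and> f y = mp_eval p y / mp_eval q y"
      using fg by blast
    obtain p' q' :: "('i, 'k) mpoly" where g: "\<forall>y\<in>U. mp_eval q' y \<noteq> 0 \<and> g y = mp_eval p' y / mp_eval q' y"
      using fg by blast
    show "(\<lambda>x. f x + g x) \<in> ?L"
      by (rule CollectI, rule exI[of _ "p * q' + p' * q"], rule exI[of _ "q * q'"])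
        (use f g in \<open>auto simp: mp_eval_add mp_eval_mult add_frac_eq\<close>)
    show "(\<lambda>x. f x * g x) \<in> ?L"
      by (rule CollectI, rule exI[of _ "p * p'"], rule exI[of _ "q * q'"])
        (use f g in \<open>auto simp: mp_eval_mult\<close>)
  qed
  fix f assume "f \<in> ?L"
  then obtain p q :: "('i, 'k) mpoly" where f: "\<forall>y\<in>U. mp_eval q y \<noteq> 0 \<and> f y = mp_eval p y / mp_eval q y"
    by blast
  have "{x \<in> U. f x \<noteq> 0} = U \<inter> {x \<in> coord_space I. mp_eval p x \<noteq> 0}"
    using f openin_subset[OF U] by auto
  then show "openin (ktop ?X) {x \<in> U. f x \<noteq> 0}"
    using openin_Int[OF U openin_affine_space_basic] by simp
  show "(\<lambda>x. inverse (f x)) \<in>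
      {f'. \<exists>(p :: ('i, 'k) mpoly) q. \<forall>y\<in>{x\<in>U. f x \<noteq> 0}. mp_eval q y \<noteq> 0 \<and> f' y = mp_eval p y / mp_eval q y}"
    by (rule CollectI, rule exI[of _ q], rule exI[of _ p]) (use f in auto)
next
  fix U V and f :: "_ \<Rightarrow> 'k alg_closure"
  show "V \<subseteq> U \<Longrightarrow>
    f \<in> {f. \<exists>(p :: ('i, 'k) mpoly) q. \<forall>y\<in>U. mp_eval q y \<noteq> 0 \<and> f y = mp_eval p y / mp_eval q y} \<Longrightarrow>
    f \<in> {f. \<exists>(p :: ('i, 'k) mpoly) q. \<forall>y\<in>V. mp_eval q y \<noteq> 0 \<and> f y = mp_eval p y / mp_eval q y}"
    by blast
next
  fix U and f g :: "_ \<Rightarrow> 'k alg_closure"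
  show "f \<in> {f. \<exists>(p :: ('i, 'k) mpoly) q. \<forall>y\<in>U. mp_eval q y \<noteq> 0 \<and> f y = mp_eval p y / mp_eval q y} \<Longrightarrow>
    (\<And>x. x \<in> U \<Longrightarrow> g x = f x) \<Longrightarrow>
    g \<in> {f. \<exists>(p :: ('i, 'k) mpoly) q. \<forall>y\<in>U. mp_eval q y \<noteq> 0 \<and> f y = mp_eval p y / mp_eval q y}"
    by auto
qed

lemma regular_coordinate:
  "(\<lambda>x. x i) \<in> regular (affine_space I :: (_, 'k::field) kspace) (coord_space I)"
  unfolding regular_affine_space
proof (intro CollectI ballI exI[of _ "coord_space I"] conjI)
  show "openin (ktop (affine_space I :: (_, 'k) kspace)) (coord_space I)"
    using openin_topspace[of "ktop (affine_space I :: (_, 'k) kspace)"] by simp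
  show "\<exists>(p :: (_, 'k) mpoly) q. \<forall>y\<in>coord_space I. mp_eval q y \<noteq> 0 \<and> y i = mp_eval p y / mp_eval q y"
    by (rule exI[of _ "mp_var i"], rule exI[of _ 1]) simp
qed auto

text \<open>
  A polynomial expression in regular functions is regular, and so is a quotient of two such
  expressions where the denominator does not vanish. Hence continuity and the pull-back condition
  both follow from regularity of the coordinates.
\<close>

lemma kmorphism_to_affine_space:
  fixes X :: "('p, 'k::field) kspace"
  assumes X: "ringed X" and coord: "\<And>x. x \<in> points X \<Longrightarrow> \<phi> x \<in> coord_space I"
    and reg: "\<And>i. i \<in> I \<Longrightarrow> (\<lambda>x. \<phi> x i) \<in> regular X (points X)"
  shows "kmorphism X (affine_space I) \<phi>"
proof -
  have reg': "(\<lambda>x. \<phi> x i) \<in> regular X (points X)" for i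
  proof (cases "i \<in> I")
    case False
    show ?thesis
      by (rule regular_cong[OF ringed_sheaf[OF X] openin_topspace regular_zero[OF X openin_topspace]])
        (use coord False in \<open>auto simp: coord_space_def\<close>)
  qed (rule reg)
  have ev: "(\<lambda>x. mp_eval p (\<phi> x)) \<in> regular X (points X)" for p
    using regular_mp_eval[OF X openin_topspace reg', where p=p] by simp
  show ?thesis
  proof (rule kmorphismI[OF ringed_sheaf[OF X]])
    show c: "continuous_map (ktop X) (ktop (affine_space I)) \<phi>"
      unfolding affine_space_def Let_def simps
    proof (simp only: kspace.simps, rule continuous_on_generated_topo)
      fix U assume "U \<in> range (\<lambda>p :: (_, 'k) mpoly. {x \<in> coord_space I. mp_eval p x \<noteq> 0})"
      then obtain p :: "(_, 'k) mpoly" where "U = {x \<in> coord_space I. mp_eval p x \<noteq> 0}" by blast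
      then have "\<phi> -` U \<inter> points X = {x \<in> points X. mp_eval p (\<phi> x) \<noteq> 0}" using coord by auto
      then show "openin (ktop X) (\<phi> -` U \<inter> points X)"
        using openin_nonvanishing[OF X openin_topspace ev] by simp
    next
      show "\<phi> ` points X \<subseteq> \<Union> (range (\<lambda>p :: (_, 'k) mpoly. {x \<in> coord_space I. mp_eval p x \<noteq> 0}))"
      proof
        fix y assume "y \<in> \<phi> ` points X"
        then have "y \<in> {x \<in> coord_space I. mp_eval (1 :: (_, 'k) mpoly) x \<noteq> 0}" using coord by auto
        then show "y \<in> \<Union> (range (\<lambda>p :: (_, 'k) mpoly. {x \<in> coord_space I. mp_eval p x \<noteq> 0}))" by blast
      qed
    qed
    fix U f x
    assume a: "openin (ktop (affine_space I)) U" "f \<in> regular (affine_space I) U" "x \<in> points X" "\<phi> x \<in> U"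
    obtain V and p q :: "(_, 'k) mpoly" where V: "openin (ktop (affine_space I :: (_, 'k) kspace)) V"
      "\<phi> x \<in> V" "V \<subseteq> U" "\<forall>y\<in>V. mp_eval q y \<noteq> 0 \<and> f y = mp_eval p y / mp_eval q y"
      using a(2,4) unfolding regular_affine_space by blast
    have o: "openin (ktop X) {x \<in> points X. \<phi> x \<in> V}"
      using c V(1) by (auto simp: continuous_map_def)
    have r: "(\<lambda>x. mp_eval p (\<phi> x)) \<in> regular X {x \<in> points X. \<phi> x \<in> V}" for p
      by (rule regular_restrict[OF ringed_sheaf[OF X] openin_topspace o _ ev]) auto
    show "\<exists>V g. openin (ktop X) V \<and> x \<in> V \<and> g \<in> regular X V \<and> (\<forall>y\<in>V. \<phi> y \<in> U \<longrightarrow> f (\<phi> y) = g y)"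
      by (rule exI[of _ "{x \<in> points X. \<phi> x \<in> V}"], rule exI[of _ "\<lambda>x. mp_eval p (\<phi> x) / mp_eval q (\<phi> x)"])
        (use o a V in \<open>auto intro!: regular_divide[OF X o r r]\<close>)
  qed
qed

section \<open>Projective space\<close>

lemma line_scale:
  assumes "c \<noteq> 0"
  shows "line (\<lambda>i. c * x i) = line x"
proof -
  have "(\<lambda>i. a * (c * x i)) \<in> range (\<lambda>c i. c * x i)" for a
    by (rule range_eqI[of _ _ "a * c"]) (simp add: mult.assoc)
  moreover have "(\<lambda>i. a * x i) \<in> range (\<lambda>a i. a * (c * x i))" for a
    by (rule range_eqI[of _ _ "a / c"]) (use assms in simp)
  ultimately show ?thesis unfolding line_def by blast
qed

lemma line_eqD:
  assumes "line x = line y" "x \<noteq> 0"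
  obtains c where "c \<noteq> 0" "x = (\<lambda>i. c * y i)"
proof -
  have "x \<in> line x" unfolding line_def by (rule range_eqI[of _ _ 1]) simp
  then obtain c where c: "x = (\<lambda>i. c * y i)" using assms(1) by (auto simp: line_def)
  with assms(2) have "c \<noteq> 0" by (auto simp: fun_eq_iff)
  with c that show ?thesis by blast
qed

text \<open>
  A chosen representative vector of a line. Statements that are invariant under scaling may be
  checked on it, and quotients of homogeneous polynomials of equal degree do not depend on it.
\<close>

definition homog_coords :: "'i set \<Rightarrow> ('i \<Rightarrow> 'a::field) set \<Rightarrow> 'i \<Rightarrow> 'a" where
  "homog_coords E l = (SOME x. x \<in> coord_space E \<and> x \<noteq> 0 \<and> line x = l)"

definition proj_open :: "'i set \<Rightarrow> ('i, 'k::field) mpoly \<Rightarrow> ('i \<Rightarrow> 'k alg_closure) set set" where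
  "proj_open E p = proj_locus E (\<lambda>x. mp_eval p x \<noteq> 0)"

lemma homog_coords:
  assumes "l \<in> proj_locus E P"
  shows "homog_coords E l \<in> coord_space E" "homog_coords E l \<noteq> 0" "line (homog_coords E l) = l"
proof -
  have "\<exists>x. x \<in> coord_space E \<and> x \<noteq> 0 \<and> line x = l" using assms by (auto simp: proj_locus_def)
  from someI_ex[OF this] show "homog_coords E l \<in> coord_space E" "homog_coords E l \<noteq> 0"
    "line (homog_coords E l) = l"
    by (simp_all add: homog_coords_def)
qed

lemma homog_coords_line:
  assumes "x \<in> coord_space E" "x \<noteq> 0"
  obtains c where "c \<noteq> 0" "homog_coords E (line x) = (\<lambda>i. c * x i)"
proof -
  have l: "line x \<in> proj_locus E (\<lambda>_. True)" using assms by (auto simp: proj_locus_def)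
  show ?thesis
    by (rule line_eqD[OF homog_coords(3)[OF l] homog_coords(2)[OF l]]) (rule that)
qed

lemma points_projective_space:
  "points (projective_space E :: (_, 'k::field) kspace) = proj_locus E (\<lambda>_. True)"
proof -
  have "proj_locus E (\<lambda>_. True) = proj_locus E (\<lambda>x. mp_eval (1 :: (_, 'k) mpoly) x \<noteq> 0)" by simp
  moreover have "\<dots> \<in> {proj_locus E (\<lambda>x. mp_eval p x \<noteq> 0) | (p :: (_, 'k) mpoly) d. mp_homogeneous d p}"
    by (rule CollectI, rule exI[of _ 1], rule exI[of _ 0]) simp
  ultimately have "proj_locus E (\<lambda>_. True) \<subseteq>
      \<Union> {proj_locus E (\<lambda>x. mp_eval p x \<noteq> 0) | (p :: (_, 'k) mpoly) d. mp_homogeneous d p}"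
    by auto
  moreover have "\<Union> {proj_locus E (\<lambda>x. mp_eval p x \<noteq> 0) | (p :: (_, 'k) mpoly) d. mp_homogeneous d p}
      \<subseteq> proj_locus E (\<lambda>_. True)"
    by (auto simp: proj_locus_def)
  ultimately show ?thesis
    by (simp add: projective_space_def Let_def)
qed

lemma homog_coords_point:
  assumes "l \<in> points (projective_space E :: (_, 'k::field) kspace)"
  shows "homog_coords E l \<in> coord_space E" "homog_coords E l \<noteq> 0" "line (homog_coords E l) = l"
  using homog_coords[of l E "\<lambda>_. True"] assms by (simp_all add: points_projective_space)

lemma line_in_points [intro]:
  "x \<in> coord_space E \<Longrightarrow> x \<noteq> 0 \<Longrightarrow> line x \<in> points (projective_space E :: (_, 'k::field) kspace)"
  by (auto simp: points_projective_space proj_locus_def)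

lemma proj_locus_iff:
  assumes "\<And>c x. c \<noteq> 0 \<Longrightarrow> P (\<lambda>i. c * x i) \<longleftrightarrow> P x"
  shows "l \<in> proj_locus E P \<longleftrightarrow>
    l \<in> points (projective_space E :: (_, 'k::field) kspace) \<and> P (homog_coords E l)"
proof
  assume "l \<in> proj_locus E P"
  then obtain x where x: "l = line x" "x \<in> coord_space E" "x \<noteq> 0" "P x"
    by (auto simp: proj_locus_def)
  obtain c where "c \<noteq> 0" "homog_coords E l = (\<lambda>i. c * x i)"
    using homog_coords_line[OF x(2,3)] x(1) by metis
  with x assms show "l \<in> points (projective_space E :: (_, 'k) kspace) \<and> P (homog_coords E l)" by auto
next
  assume a: "l \<in> points (projective_space E :: (_, 'k) kspace) \<and> P (homog_coords E l)"
  then show "l \<in> proj_locus E P"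
    using homog_coords_point[of l E] unfolding proj_locus_def by blast
qed

lemma line_in_proj_locus_iff:
  assumes P: "\<And>c x. c \<noteq> 0 \<Longrightarrow> P (\<lambda>i. c * x i) \<longleftrightarrow> P x" and x: "x \<in> coord_space E" "x \<noteq> 0"
  shows "line x \<in> proj_locus E P \<longleftrightarrow> P x"
proof
  assume "line x \<in> proj_locus E P"
  then obtain y where y: "line x = line y" "P y" by (auto simp: proj_locus_def)
  obtain c where "c \<noteq> 0" "x = (\<lambda>i. c * y i)" using line_eqD[OF y(1) x(2)] by blast
  then show "P x" using P y(2) by simp
qed (use x in \<open>auto simp: proj_locus_def\<close>)

lemma proj_open_iff:
  assumes "mp_homogeneous d p"
  shows "l \<in> proj_open E p \<longleftrightarrow> l \<in> points (projective_space E :: (_, 'k::field) kspace) \<and>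
    mp_eval (p :: (_, 'k) mpoly) (homog_coords E l) \<noteq> 0"
  unfolding proj_open_def by (rule proj_locus_iff) (simp add: mp_eval_scale[OF assms])

lemma line_in_proj_open_iff:
  assumes "mp_homogeneous d p" and "x \<in> coord_space E" "x \<noteq> 0"
  shows "line x \<in> proj_open E p \<longleftrightarrow> mp_eval p x \<noteq> 0"
  unfolding proj_open_def
  by (rule line_in_proj_locus_iff[OF _ assms(2,3)]) (simp add: mp_eval_scale[OF assms(1)])

lemma openin_proj_open:
  "mp_homogeneous d p \<Longrightarrow> openin (ktop (projective_space E :: (_, 'k::field) kspace)) (proj_open E p)"
  by (auto simp: projective_space_def Let_def proj_open_def intro!: topology_generated_by_Basis)

lemma homogeneous_ratio_line:
  assumes "mp_homogeneous d p" "mp_homogeneous d q" "x \<in> coord_space E" "x \<noteq> 0"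
  shows "mp_eval p (homog_coords E (line x)) / mp_eval q (homog_coords E (line x)) =
    mp_eval p x / mp_eval q x"
proof -
  obtain c where "c \<noteq> 0" "homog_coords E (line x) = (\<lambda>i. c * x i)"
    using homog_coords_line[OF assms(3,4)] by metis
  then show ?thesis by (simp add: mp_eval_scale[OF assms(1)] mp_eval_scale[OF assms(2)])
qed

text \<open>
  The presheaf of quotients of homogeneous polynomials of equal degree, evaluated at chosen
  representatives. Expressing it through points makes its closure properties pointwise identities.
\<close>

definition homogeneous_ratios ::
  "'i set \<Rightarrow> ('i \<Rightarrow> 'k alg_closure) set set \<Rightarrow> (('i \<Rightarrow> 'k::field alg_closure) set \<Rightarrow> 'k alg_closure) set" where
  "homogeneous_ratios E V = {f. \<exists>d (p :: ('i, 'k) mpoly) q. mp_homogeneous d p \<and> mp_homogeneous d q \<and>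
     (\<forall>l\<in>V. mp_eval q (homog_coords E l) \<noteq> 0 \<and>
        f l = mp_eval p (homog_coords E l) / mp_eval q (homog_coords E l))}"

lemma homogeneous_ratios_iff:
  assumes V: "V \<subseteq> points (projective_space E :: (_, 'k::field) kspace)"
  shows "f \<in> homogeneous_ratios E V \<longleftrightarrow> (\<exists>d (p :: ('i, 'k) mpoly) q. mp_homogeneous d p \<and>
    mp_homogeneous d q \<and> (\<forall>x\<in>coord_space E. x \<noteq> 0 \<and> line x \<in> V \<longrightarrow>
                mp_eval q x \<noteq> 0 \<and> f (line x) = mp_eval p x / mp_eval q x))"
    (is "_ \<longleftrightarrow> (\<exists>d p q. _ \<and> _ \<and> ?P p q)")
proof -
  let ?Q = "\<lambda>(p :: ('i, 'k) mpoly) q. \<forall>l\<in>V. mp_eval q (homog_coords E l) \<noteq> 0 \<and>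
        f l = mp_eval p (homog_coords E l) / mp_eval q (homog_coords E l)"
  have "?Q p q \<longleftrightarrow> ?P p q" if h: "mp_homogeneous d p" "mp_homogeneous d q" for d p q
  proof
    assume Q: "?Q p q"
    show "?P p q"
    proof (intro ballI impI; elim conjE)
      fix x :: "'i \<Rightarrow> 'k alg_closure" assume x: "x \<in> coord_space E" "x \<noteq> 0" "line x \<in> V"
      have "mp_eval q x \<noteq> 0"
        using Q x V line_in_proj_open_iff[OF h(2) x(1,2)] proj_open_iff[OF h(2), of "line x" E] by auto
      then show "mp_eval q x \<noteq> 0 \<and> f (line x) = mp_eval p x / mp_eval q x"
        using Q x homogeneous_ratio_line[OF h x(1,2)] by auto
    qed
  next
    assume P: "?P p q"
    show "?Q p q"
    proof
      fix l assume l: "l \<in> V"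
      then have "l \<in> points (projective_space E :: (_, 'k) kspace)" using V by blast
      from homog_coords_point[OF this] P l
      show "mp_eval q (homog_coords E l) \<noteq> 0 \<and>
        f l = mp_eval p (homog_coords E l) / mp_eval q (homog_coords E l)" by metis
    qed
  qed
  then show ?thesis unfolding homogeneous_ratios_def by blast
qed

lemma regular_projective_space:
  fixes E :: "'i set"
  shows "regular (projective_space E :: (_, 'k::field) kspace) U =
    {f. \<forall>l\<in>U. \<exists>V. openin (ktop (projective_space E :: (_, 'k) kspace)) V \<and> l \<in> V \<and> V \<subseteq> U \<and>
      f \<in> homogeneous_ratios E V}" (is "_ = ?R")
  unfolding set_eq_iff
proof
  fix f :: "('i \<Rightarrow> 'k alg_closure) set \<Rightarrow> 'k alg_closure"
  let ?X = "projective_space E :: (('i \<Rightarrow> 'k alg_closure) set, 'k) kspace"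
  have "f \<in> regular ?X U \<longleftrightarrow> (\<forall>l\<in>U. \<exists>V. openin (ktop ?X) V \<and> l \<in> V \<and> V \<subseteq> U \<and>
      (\<exists>d (p :: (_, 'k) mpoly) q. mp_homogeneous d p \<and>
    mp_homogeneous d q \<and> (\<forall>x\<in>coord_space E. x \<noteq> 0 \<and> line x \<in> V \<longrightarrow>
                mp_eval q x \<noteq> 0 \<and> f (line x) = mp_eval p x / mp_eval q x)))"
    unfolding projective_space_def Let_def by simp
  also have "\<dots> \<longleftrightarrow> f \<in> ?R"
    unfolding mem_Collect_eq
    by (intro ball_cong[OF refl] ex_cong1 conj_cong refl, rule homogeneous_ratios_iff[symmetric],
        rule openin_subset)
  finally show "f \<in> regular ?X U \<longleftrightarrow> f \<in> ?R" .
qed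

lemma ringed_projective_space: "ringed (projective_space E :: (('i \<Rightarrow> _) set, 'k::field) kspace)"
proof (rule ringed_from_local_functions[OF regular_projective_space])
  let ?X = "projective_space E :: (('i \<Rightarrow> _) set, 'k) kspace"
  have HI: "f \<in> homogeneous_ratios E V" if "mp_homogeneous d p" "mp_homogeneous d q"
    "\<And>l. l \<in> V \<Longrightarrow> mp_eval q (homog_coords E l) \<noteq> 0 \<and>
        f l = mp_eval p (homog_coords E l) / mp_eval q (homog_coords E l)"
    for f V d and p q :: "('i, 'k) mpoly"
    using that unfolding homogeneous_ratios_def by blast
  have HE: "\<exists>d (p :: ('i, 'k) mpoly) q. mp_homogeneous d p \<and> mp_homogeneous d q \<and>
     (\<forall>l\<in>V. mp_eval q (homog_coords E l) \<noteq> 0 \<and>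
        f l = mp_eval p (homog_coords E l) / mp_eval q (homog_coords E l))"
    if "f \<in> homogeneous_ratios E V" for f :: "_ \<Rightarrow> 'k alg_closure" and V
    using that unfolding homogeneous_ratios_def by blast
  fix U :: "('i \<Rightarrow> 'k alg_closure) set set" assume U: "openin (ktop ?X) U"
  let ?L = "homogeneous_ratios E U"
  show "(\<lambda>_. to_ac c) \<in> ?L" for c
    by (rule HI[of 0 "mp_const c" 1]) simp_all
  show "(\<lambda>x. f x + g x) \<in> ?L" "(\<lambda>x. f x * g x) \<in> ?L" if fg: "f \<in> ?L" "g \<in> ?L" for f g
  proof -
    obtain d and p q :: "('i, 'k) mpoly" where f: "mp_homogeneous d p" "mp_homogeneous d q"
      "\<forall>l\<in>U. mp_eval q (homog_coords E l) \<noteq> 0 \<and>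
        f l = mp_eval p (homog_coords E l) / mp_eval q (homog_coords E l)"
      using HE[OF fg(1)] by blast
    obtain d' and p' q' :: "('i, 'k) mpoly" where g: "mp_homogeneous d' p'" "mp_homogeneous d' q'"
      "\<forall>l\<in>U. mp_eval q' (homog_coords E l) \<noteq> 0 \<and>
        g l = mp_eval p' (homog_coords E l) / mp_eval q' (homog_coords E l)"
      using HE[OF fg(2)] by blast
    note m = mp_homogeneous_mult[OF f(1) g(1)] mp_homogeneous_mult[OF f(1) g(2)]
      mp_homogeneous_mult[OF f(2) g(1)] mp_homogeneous_mult[OF f(2) g(2)]
    show "(\<lambda>x. f x + g x) \<in> ?L"
      by (rule HI[of "d + d'" "p * q' + q * p'" "q * q'"])
        (use m f(3) g(3) in \<open>auto simp: mp_eval_add mp_eval_mult add_frac_eq mp_homogeneous_add mult.commute\<close>)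
    show "(\<lambda>x. f x * g x) \<in> ?L"
      by (rule HI[OF m(1,4)]) (use f(3) g(3) in \<open>auto simp: mp_eval_mult\<close>)
  qed
  fix f assume "f \<in> ?L"
  then obtain d and p q :: "('i, 'k) mpoly" where f: "mp_homogeneous d p" "mp_homogeneous d q"
      "\<forall>l\<in>U. mp_eval q (homog_coords E l) \<noteq> 0 \<and>
        f l = mp_eval p (homog_coords E l) / mp_eval q (homog_coords E l)"
    using HE by blast
  have "{x \<in> U. f x \<noteq> 0} = U \<inter> proj_open E p"
    using f openin_subset[OF U] by (auto simp: proj_open_iff[OF f(1)])
  then show "openin (ktop ?X) {x \<in> U. f x \<noteq> 0}"
    using openin_Int[OF U openin_proj_open[OF f(1)]] by simp
  show "(\<lambda>x. inverse (f x)) \<in> homogeneous_ratios E {x \<in> U. f x \<noteq> 0}"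
    by (rule HI[OF f(2,1)]) (use f(3) in auto)
next
  fix U V and f :: "_ \<Rightarrow> 'k alg_closure"
  show "V \<subseteq> U \<Longrightarrow> f \<in> homogeneous_ratios E U \<Longrightarrow> f \<in> homogeneous_ratios E V"
    unfolding homogeneous_ratios_def by blast
next
  fix U and f g :: "_ \<Rightarrow> 'k alg_closure"
  assume "f \<in> homogeneous_ratios E U" and eq: "\<And>x. x \<in> U \<Longrightarrow> g x = f x"
  then obtain d and p q :: "('i, 'k) mpoly" where f: "mp_homogeneous d p" "mp_homogeneous d q"
      "\<forall>l\<in>U. mp_eval q (homog_coords E l) \<noteq> 0 \<and>
        f l = mp_eval p (homog_coords E l) / mp_eval q (homog_coords E l)"
    unfolding homogeneous_ratios_def by blast
  then show "g \<in> homogeneous_ratios E U"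
    unfolding homogeneous_ratios_def
    by (intro CollectI exI[of _ d] exI[of _ p] exI[of _ q]) (use eq in auto)
qed

lemma regular_homogeneous_ratio:
  assumes "mp_homogeneous d p" "mp_homogeneous d q"
  shows "(\<lambda>l. mp_eval p (homog_coords E l) / mp_eval q (homog_coords E l)) \<in>
    regular (projective_space E :: (_, 'k::field) kspace) (proj_open E q)"
  unfolding regular_projective_space
proof (intro CollectI ballI exI[of _ "proj_open E q"] conjI)
  show "(\<lambda>l. mp_eval p (homog_coords E l) / mp_eval q (homog_coords E l)) \<in>
      homogeneous_ratios E (proj_open E q)"
    unfolding homogeneous_ratios_def
    by (rule CollectI, rule exI[of _ d], rule exI[of _ p], rule exI[of _ q])
      (use assms in \<open>auto simp: proj_open_iff[OF assms(2)]\<close>)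
qed (use assms openin_proj_open in auto)

text \<open>
  A map into projective space is a morphism as soon as it lifts locally to a nowhere vanishing
  vector of regular functions: homogeneous polynomials in these functions are regular, and the
  locus where such a polynomial does not vanish is independent of the lift.
\<close>

lemma kmorphism_to_projective_space:
  fixes X :: "('p, 'k::field) kspace"
  assumes X: "ringed X"
    and loc: "\<And>x. x \<in> points X \<Longrightarrow> \<exists>U g. openin (ktop X) U \<and> x \<in> U \<and>
      (\<forall>i. (\<lambda>y. g y i) \<in> regular X U) \<and>
      (\<forall>y\<in>U. g y \<in> coord_space E \<and> g y \<noteq> 0 \<and> \<phi> y = line (g y))"
  shows "kmorphism X (projective_space E) \<phi>"
proof (rule kmorphismI[OF ringed_sheaf[OF X]])
  have pt: "\<phi> x \<in> points (projective_space E :: (_, 'k) kspace)" if x: "x \<in> points X" for x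
  proof -
    obtain U g where "x \<in> U" "\<forall>y\<in>U. g y \<in> coord_space E \<and> g y \<noteq> 0 \<and> \<phi> y = line (g y)"
      using loc[OF x] by blast
    then have "g x \<in> coord_space E" "g x \<noteq> 0" "\<phi> x = line (g x)" by blast+
    then show ?thesis using line_in_points[of "g x" E] by simp
  qed
  show c: "continuous_map (ktop X) (ktop (projective_space E)) \<phi>"
    unfolding projective_space_def Let_def
  proof (simp only: kspace.simps, rule continuous_on_generated_topo)
    fix U assume "U \<in> {proj_locus E (\<lambda>x. mp_eval p x \<noteq> 0) | (p :: (_, 'k) mpoly) d. mp_homogeneous d p}"
    then obtain p :: "(_, 'k) mpoly" and d where p: "mp_homogeneous d p" and U: "U = proj_open E p"
      by (auto simp: proj_open_def)
    show "openin (ktop X) (\<phi> -` U \<inter> points X)"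
    proof (subst openin_subopen, intro ballI)
      fix x assume x: "x \<in> \<phi> -` U \<inter> points X"
      then obtain V g where V: "openin (ktop X) V" "x \<in> V" "\<forall>i. (\<lambda>y. g y i) \<in> regular X V"
        "\<forall>y\<in>V. g y \<in> coord_space E \<and> g y \<noteq> 0 \<and> \<phi> y = line (g y)"
        using loc[of x] by blast
      have "(\<lambda>y. mp_eval p (\<lambda>i. g y i)) \<in> regular X V"
        by (rule regular_mp_eval[OF X V(1)]) (use V(3) in simp)
      from openin_nonvanishing[OF X V(1) this]
      have "openin (ktop X) {y \<in> V. mp_eval p (g y) \<noteq> 0}" by simp
      moreover have "\<phi> y \<in> U \<longleftrightarrow> mp_eval p (g y) \<noteq> 0" if "y \<in> V" for y
        using line_in_proj_open_iff[OF p] V(4) that U by auto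
      ultimately show "\<exists>T. openin (ktop X) T \<and> x \<in> T \<and> T \<subseteq> \<phi> -` U \<inter> points X"
        by (intro exI[of _ "{y \<in> V. mp_eval p (g y) \<noteq> 0}"]) (use x V openin_subset[OF V(1)] in auto)
    qed
  next
    have "topspace (ktop (projective_space E :: (_, 'k) kspace)) =
        \<Union> {proj_locus E (\<lambda>x. mp_eval p x \<noteq> 0) | (p :: (_, 'k) mpoly) d. mp_homogeneous d p}"
      by (simp add: projective_space_def Let_def)
    then show "\<phi> ` points X \<subseteq>
        \<Union> {proj_locus E (\<lambda>x. mp_eval p x \<noteq> 0) | (p :: (_, 'k) mpoly) d. mp_homogeneous d p}"
      using pt by blast
  qed
  fix U f x
  assume a: "openin (ktop (projective_space E)) U" "f \<in> regular (projective_space E) U" "x \<in> points X" "\<phi> x \<in> U"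
  obtain W where W: "openin (ktop (projective_space E :: (_, 'k) kspace)) W" "\<phi> x \<in> W" "W \<subseteq> U"
    "f \<in> homogeneous_ratios E W"
    using a(2,4) unfolding regular_projective_space by blast
  then obtain d and p q :: "(_, 'k) mpoly" where pq: "mp_homogeneous d p" "mp_homogeneous d q"
    "\<forall>x\<in>coord_space E. x \<noteq> 0 \<and> line x \<in> W \<longrightarrow> mp_eval q x \<noteq> 0 \<and> f (line x) = mp_eval p x / mp_eval q x"
    using homogeneous_ratios_iff[OF openin_subset[OF W(1)]] by blast
  obtain V g where V: "openin (ktop X) V" "x \<in> V" "\<forall>i. (\<lambda>y. g y i) \<in> regular X V"
    "\<forall>y\<in>V. g y \<in> coord_space E \<and> g y \<noteq> 0 \<and> \<phi> y = line (g y)"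
    using loc[OF a(3)] by blast
  let ?V = "V \<inter> {y \<in> points X. \<phi> y \<in> W}"
  have o: "openin (ktop X) ?V"
    using V(1) c W(1) by (auto simp: continuous_map_def)
  have "(\<lambda>y. mp_eval p (\<lambda>i. g y i)) \<in> regular X V" for p
    by (rule regular_mp_eval[OF X V(1)]) (use V(3) in simp)
  then have r: "(\<lambda>y. mp_eval p (\<lambda>i. g y i)) \<in> regular X ?V" for p
    by (rule regular_restrict[OF ringed_sheaf[OF X] V(1) o, rotated]) auto
  show "\<exists>V g. openin (ktop X) V \<and> x \<in> V \<and> g \<in> regular X V \<and> (\<forall>y\<in>V. \<phi> y \<in> U \<longrightarrow> f (\<phi> y) = g y)"
  proof (intro exI conjI)
    show "(\<lambda>y. mp_eval p (\<lambda>i. g y i) / mp_eval q (\<lambda>i. g y i)) \<in> regular X ?V"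
      by (rule regular_divide[OF X o r r]) (use V(4) pq(3) in auto)
    show "\<forall>y\<in>?V. \<phi> y \<in> U \<longrightarrow> f (\<phi> y) = mp_eval p (g y) / mp_eval q (g y)"
      using V(4) pq(3) by auto
  qed (use o a V W in auto)
qed

section \<open>Products and separatedness\<close>

text \<open>
  Arbitrary finite index sets are convenient because sums and products of tensor functions are
  naturally indexed by disjoint sums and cartesian products of index sets.
\<close>

lemma tensor_functionsI:
  assumes A: "finite A" and "\<And>a. a \<in> A \<Longrightarrow> g a \<in> regular X U" "\<And>a. a \<in> A \<Longrightarrow> h a \<in> regular Y V"
  shows "(\<lambda>z. \<Sum>a\<in>A. g a (fst z) * h a (snd z)) \<in> tensor_functions X Y U V"
proof -
  obtain b where b: "bij_betw b {..<card A} A"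
    using ex_bij_betw_nat_finite[OF A] by (auto simp: lessThan_atLeast0)
  have "(\<lambda>z. \<Sum>a\<in>A. g a (fst z) * h a (snd z)) =
      (\<lambda>z. \<Sum>i<card A. g (b i) (fst z) * h (b i) (snd z))"
    by (rule ext) (rule sum.reindex_bij_betw[OF b, symmetric])
  moreover have "b i \<in> A" if "i < card A" for i using b that by (auto simp: bij_betw_def)
  ultimately show ?thesis
    unfolding tensor_functions_def
    by (intro CollectI exI[of _ "card A"] exI[of _ "\<lambda>i. g (b i)"] exI[of _ "\<lambda>i. h (b i)"])
      (simp add: assms(2,3))
qed

lemma tensor_functionsD:
  assumes "t \<in> tensor_functions X Y U V"
  shows "\<exists>(n :: nat) g h. t = (\<lambda>z. \<Sum>i<n. g i (fst z) * h i (snd z)) \<and>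
    (\<forall>i<n. g i \<in> regular X U) \<and> (\<forall>i<n. h i \<in> regular Y V)"
proof -
  have "\<exists>(n :: nat) g h. t = (\<lambda>z. \<Sum>i<n. g i (fst z) * h i (snd z)) \<and>
      (\<forall>i<n. g i \<in> regular X U \<and> h i \<in> regular Y V)"
    using assms by (simp only: tensor_functions_def mem_Collect_eq)
  then show ?thesis by (elim exE conjE) (intro exI conjI, assumption, simp_all)
qed

lemma tensor_functions_simple:
  "g \<in> regular X U \<Longrightarrow> h \<in> regular Y V \<Longrightarrow> (\<lambda>z. g (fst z) * h (snd z)) \<in> tensor_functions X Y U V"
  using tensor_functionsI[of "{()}" "\<lambda>_. g" X U "\<lambda>_. h" Y V] by simp

lemma tensor_functions_add:
  assumes "s \<in> tensor_functions X Y U V" "t \<in> tensor_functions X Y U V"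
  shows "(\<lambda>z. s z + t z) \<in> tensor_functions X Y U V"
proof -
  obtain n :: nat and g h where s: "s = (\<lambda>z. \<Sum>i<n. g i (fst z) * h i (snd z))"
    "\<forall>i<n. g i \<in> regular X U" "\<forall>i<n. h i \<in> regular Y V"
    using tensor_functionsD[OF assms(1)] by blast
  obtain m :: nat and g' h' where t: "t = (\<lambda>z. \<Sum>i<m. g' i (fst z) * h' i (snd z))"
    "\<forall>i<m. g' i \<in> regular X U" "\<forall>i<m. h' i \<in> regular Y V"
    using tensor_functionsD[OF assms(2)] by blast
  have "(\<lambda>z. \<Sum>a\<in>{..<n} <+> {..<m}. case_sum g g' a (fst z) * case_sum h h' a (snd z))
      \<in> tensor_functions X Y U V"
    by (rule tensor_functionsI) (use s t in auto)
  then show ?thesis by (simp add: sum.Plus s(1) t(1) comp_def)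
qed

lemma tensor_functions_mult:
  assumes X: "ringed X" "openin (ktop X) U" and Y: "ringed Y" "openin (ktop Y) V"
    and "s \<in> tensor_functions X Y U V" "t \<in> tensor_functions X Y U V"
  shows "(\<lambda>z. s z * t z) \<in> tensor_functions X Y U V"
proof -
  obtain n :: nat and g h where s: "s = (\<lambda>z. \<Sum>i<n. g i (fst z) * h i (snd z))"
    "\<forall>i<n. g i \<in> regular X U" "\<forall>i<n. h i \<in> regular Y V"
    using tensor_functionsD[OF assms(5)] by blast
  obtain m :: nat and g' h' where t: "t = (\<lambda>z. \<Sum>i<m. g' i (fst z) * h' i (snd z))"
    "\<forall>i<m. g' i \<in> regular X U" "\<forall>i<m. h' i \<in> regular Y V"
    using tensor_functionsD[OF assms(6)] by blast
  have "(\<lambda>z. \<Sum>a\<in>{..<n} \<times> {..<m}. (\<lambda>x. g (fst a) x * g' (snd a) x) (fst z) *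
       (\<lambda>y. h (fst a) y * h' (snd a) y) (snd z)) \<in> tensor_functions X Y U V"
    by (rule tensor_functionsI) (use s t in \<open>auto intro!: regular_mult X Y\<close>)
  moreover have "s z * t z = (\<Sum>a\<in>{..<n} \<times> {..<m}. (\<lambda>x. g (fst a) x * g' (snd a) x) (fst z) *
       (\<lambda>y. h (fst a) y * h' (snd a) y) (snd z))" for z
    unfolding s(1) t(1) sum_product sum.cartesian_product
    by (rule sum.cong) (auto simp: mult_ac)
  ultimately show ?thesis by simp
qed

lemma tensor_functions_restrict:
  assumes "t \<in> tensor_functions X Y U V"
    and X: "function_sheaf X" "openin (ktop X) U" "openin (ktop X) U'" "U' \<subseteq> U"
    and Y: "function_sheaf Y" "openin (ktop Y) V" "openin (ktop Y) V'" "V' \<subseteq> V"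
  shows "t \<in> tensor_functions X Y U' V'"
proof -
  obtain n :: nat and g h where t: "t = (\<lambda>z. \<Sum>i<n. g i (fst z) * h i (snd z))"
    "\<forall>i<n. g i \<in> regular X U" "\<forall>i<n. h i \<in> regular Y V"
    using tensor_functionsD[OF assms(1)] by blast
  show ?thesis
    unfolding t(1)
    by (rule tensor_functionsI) (use t regular_restrict[OF X] regular_restrict[OF Y] in auto)
qed

lemma openin_kprod_basic:
  "openin (ktop X) U \<Longrightarrow> openin (ktop Y) V \<Longrightarrow> t \<in> tensor_functions X Y U V \<Longrightarrow>
    openin (ktop (kprod X Y)) {z \<in> U \<times> V. t z \<noteq> 0}"
  unfolding kprod_def Let_def kspace.simps
  by (rule topology_generated_by_Basis) blast

lemma tensor_functions_one:
  assumes "ringed X" "ringed Y" "openin (ktop X) U" "openin (ktop Y) V"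
  shows "(\<lambda>_. 1) \<in> tensor_functions X Y U V"
  using tensor_functions_simple[OF regular_one[OF assms(1,3)] regular_one[OF assms(2,4)]] by simp

lemma openin_kprod_Times:
  assumes "ringed X" "ringed Y" "openin (ktop X) U" "openin (ktop Y) V"
  shows "openin (ktop (kprod X Y)) (U \<times> V)"
  using openin_kprod_basic[OF assms(3,4) tensor_functions_one[OF assms]] by simp

lemma points_kprod:
  assumes "ringed X" "ringed Y"
  shows "points (kprod X Y) = points X \<times> points Y"
proof
  show "points X \<times> points Y \<subseteq> points (kprod X Y)"
    by (rule openin_subset[OF openin_kprod_Times[OF assms openin_topspace openin_topspace]])
  have "\<Union> {{z \<in> U \<times> V. t z \<noteq> 0} | U V t.
      openin (ktop X) U \<and> openin (ktop Y) V \<and> t \<in> tensor_functions X Y U V} \<subseteq> points X \<times> points Y"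
  proof
    fix z assume "z \<in> \<Union> {{z \<in> U \<times> V. t z \<noteq> 0} | U V t.
      openin (ktop X) U \<and> openin (ktop Y) V \<and> t \<in> tensor_functions X Y U V}"
    then obtain U V where "z \<in> U \<times> V" "openin (ktop X) U" "openin (ktop Y) V" by blast
    then show "z \<in> points X \<times> points Y"
      using openin_subset[of "ktop X" U] openin_subset[of "ktop Y" V] by auto
  qed
  then show "points (kprod X Y) \<subseteq> points X \<times> points Y"
    by (simp add: kprod_def Let_def)
qed

definition tensor_ratios where
  "tensor_ratios X Y N = {f. \<exists>U V s t. openin (ktop X) U \<and> openin (ktop Y) V \<and> N \<subseteq> U \<times> V \<and>
             s \<in> tensor_functions X Y U V \<and> t \<in> tensor_functions X Y U V \<and>
             (\<forall>w\<in>N. t w \<noteq> 0 \<and> f w = s w / t w)}"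

lemma tensor_ratiosI:
  "openin (ktop X) U \<Longrightarrow> openin (ktop Y) V \<Longrightarrow> N \<subseteq> U \<times> V \<Longrightarrow>
    s \<in> tensor_functions X Y U V \<Longrightarrow> t \<in> tensor_functions X Y U V \<Longrightarrow>
    (\<And>w. w \<in> N \<Longrightarrow> t w \<noteq> 0 \<and> f w = s w / t w) \<Longrightarrow> f \<in> tensor_ratios X Y N"
  unfolding tensor_ratios_def by blast

lemma tensor_ratiosE:
  assumes "f \<in> tensor_ratios X Y N"
  obtains U V s t where "openin (ktop X) U" "openin (ktop Y) V" "N \<subseteq> U \<times> V"
             "s \<in> tensor_functions X Y U V" "t \<in> tensor_functions X Y U V"
             "\<forall>w\<in>N. t w \<noteq> 0 \<and> f w = s w / t w"
  using assms unfolding tensor_ratios_def by blast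

lemma regular_kprod:
  "regular (kprod X Y) D = {f. \<forall>z\<in>D. \<exists>N. openin (ktop (kprod X Y)) N \<and> z \<in> N \<and> N \<subseteq> D \<and>
     f \<in> tensor_ratios X Y N}"
  unfolding kprod_def Let_def tensor_ratios_def by simp

lemma ringed_kprod:
  assumes X: "ringed X" and Y: "ringed Y"
  shows "ringed (kprod X Y)"
proof (rule ringed_from_local_functions[OF regular_kprod])
  have two: "\<exists>U V s t s' t'. openin (ktop X) U \<and> openin (ktop Y) V \<and> N \<subseteq> U \<times> V \<and>
      s \<in> tensor_functions X Y U V \<and> t \<in> tensor_functions X Y U V \<and>
      s' \<in> tensor_functions X Y U V \<and> t' \<in> tensor_functions X Y U V \<and>
      (\<forall>w\<in>N. t w \<noteq> 0 \<and> f w = s w / t w \<and> t' w \<noteq> 0 \<and> g w = s' w / t' w)"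
    if fg: "f \<in> tensor_ratios X Y N" "g \<in> tensor_ratios X Y N" for f g N
  proof -
    obtain U V s t where f: "openin (ktop X) U" "openin (ktop Y) V" "N \<subseteq> U \<times> V"
             "s \<in> tensor_functions X Y U V" "t \<in> tensor_functions X Y U V"
             "\<forall>w\<in>N. t w \<noteq> 0 \<and> f w = s w / t w"
      by (rule tensor_ratiosE[OF fg(1)]) (rule that)
    obtain U' V' s' t' where g: "openin (ktop X) U'" "openin (ktop Y) V'" "N \<subseteq> U' \<times> V'"
             "s' \<in> tensor_functions X Y U' V'" "t' \<in> tensor_functions X Y U' V'"
             "\<forall>w\<in>N. t' w \<noteq> 0 \<and> g w = s' w / t' w"
      by (rule tensor_ratiosE[OF fg(2)]) (rule that)
    have o: "openin (ktop X) (U \<inter> U')" "openin (ktop Y) (V \<inter> V')" using f g by auto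
    note r = tensor_functions_restrict[OF _ ringed_sheaf[OF X] _ o(1) _ ringed_sheaf[OF Y] _ o(2)]
    show ?thesis
      by (rule exI[of _ "U \<inter> U'"], rule exI[of _ "V \<inter> V'"], rule exI[of _ s], rule exI[of _ t],
          rule exI[of _ s'], rule exI[of _ t'])
        (use o f(3,6) g(3,6) r[OF f(4) f(1) _ f(2)] r[OF f(5) f(1) _ f(2)]
          r[OF g(4) g(1) _ g(2)] r[OF g(5) g(1) _ g(2)] in auto)
  qed
  fix N assume N: "openin (ktop (kprod X Y)) N"
  note top = openin_topspace[of "ktop X"] openin_topspace[of "ktop Y"]
  have Nsub: "N \<subseteq> points X \<times> points Y" using openin_subset[OF N] points_kprod[OF X Y] by simp
  show "(\<lambda>_. to_ac c) \<in> tensor_ratios X Y N" for c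
    using tensor_ratiosI[OF top Nsub tensor_functions_simple[OF regular_const[OF X top(1), of c]
          regular_one[OF Y top(2)]] tensor_functions_one[OF X Y top], of "\<lambda>_. to_ac c"]
    by simp
  show "(\<lambda>x. f x + g x) \<in> tensor_ratios X Y N" "(\<lambda>x. f x * g x) \<in> tensor_ratios X Y N"
    if fg: "f \<in> tensor_ratios X Y N" "g \<in> tensor_ratios X Y N" for f g
  proof -
    obtain U V s t s' t' where a: "openin (ktop X) U" "openin (ktop Y) V" "N \<subseteq> U \<times> V"
      "s \<in> tensor_functions X Y U V" "t \<in> tensor_functions X Y U V"
      "s' \<in> tensor_functions X Y U V" "t' \<in> tensor_functions X Y U V"
      "\<forall>w\<in>N. t w \<noteq> 0 \<and> f w = s w / t w \<and> t' w \<noteq> 0 \<and> g w = s' w / t' w"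
      using two[OF fg] by blast
    note m = tensor_functions_mult[OF X a(1) Y a(2)]
    show "(\<lambda>x. f x + g x) \<in> tensor_ratios X Y N"
      by (rule tensor_ratiosI[OF a(1-3) tensor_functions_add[OF m[OF a(4,7)] m[OF a(6,5)]] m[OF a(5,7)]])
        (use a(8) in \<open>auto simp: add_frac_eq\<close>)
    show "(\<lambda>x. f x * g x) \<in> tensor_ratios X Y N"
      by (rule tensor_ratiosI[OF a(1-3) m[OF a(4,6)] m[OF a(5,7)]]) (use a(8) in auto)
  qed
  fix f assume "f \<in> tensor_ratios X Y N"
  then obtain U V s t where a: "openin (ktop X) U" "openin (ktop Y) V" "N \<subseteq> U \<times> V"
             "s \<in> tensor_functions X Y U V" "t \<in> tensor_functions X Y U V"
             "\<forall>w\<in>N. t w \<noteq> 0 \<and> f w = s w / t w"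
    by (rule tensor_ratiosE) (rule that)
  have "{x \<in> N. f x \<noteq> 0} = N \<inter> {z \<in> U \<times> V. s z \<noteq> 0}" using a(3,6) by auto
  then show "openin (ktop (kprod X Y)) {x \<in> N. f x \<noteq> 0}"
    using openin_Int[OF N openin_kprod_basic[OF a(1,2,4)]] by simp
  show "(\<lambda>x. inverse (f x)) \<in> tensor_ratios X Y {x \<in> N. f x \<noteq> 0}"
    by (rule tensor_ratiosI[OF a(1,2) _ a(5,4)]) (use a(3,6) in auto)
next
  fix U V f
  assume "V \<subseteq> U" "f \<in> tensor_ratios X Y U"
  then show "f \<in> tensor_ratios X Y V"
    unfolding tensor_ratios_def by blast
next
  fix U f g
  assume f: "f \<in> tensor_ratios X Y U" and eq: "\<And>x. x \<in> U \<Longrightarrow> g x = f x"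
  show "g \<in> tensor_ratios X Y U"
    by (rule tensor_ratiosE[OF f], rule tensor_ratiosI, assumption+) (use eq in auto)
qed

lemma regular_kprod_tensor:
  assumes X: "ringed X" and Y: "ringed Y"
    and a: "openin (ktop X) U" "openin (ktop Y) V" "t \<in> tensor_functions X Y U V"
  shows "t \<in> regular (kprod X Y) (U \<times> V)"
  unfolding regular_kprod
proof (intro CollectI ballI exI[of _ "U \<times> V"] conjI)
  show "t \<in> tensor_ratios X Y (U \<times> V)"
    by (rule tensor_ratiosI[OF a(1,2) _ a(3) tensor_functions_one[OF X Y a(1,2)]]) auto
qed (use openin_kprod_Times[OF X Y a(1,2)] in auto)

lemma kmorphism_fst:
  assumes X: "ringed X" and Y: "ringed Y"
  shows "kmorphism (kprod X Y) X fst"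
proof -
  have eq: "{z \<in> points (kprod X Y). fst z \<in> U} = U \<times> points Y" if "openin (ktop X) U" for U
    using openin_subset[OF that] by (auto simp: points_kprod[OF X Y])
  have "f \<circ> fst \<in> regular (kprod X Y) (U \<times> points Y)" if "openin (ktop X) U" "f \<in> regular X U" for U f
    using regular_kprod_tensor[OF X Y that(1) openin_topspace
        tensor_functions_simple[OF that(2) regular_one[OF Y openin_topspace]]]
    by (simp add: comp_def)
  then show ?thesis
    unfolding kmorphism_def continuous_map_def
    using openin_kprod_Times[OF X Y _ openin_topspace] by (auto simp: eq) (auto simp: points_kprod[OF X Y])
qed

lemma kmorphism_snd:
  assumes X: "ringed X" and Y: "ringed Y"
  shows "kmorphism (kprod X Y) Y snd"
proof -
  have eq: "{z \<in> points (kprod X Y). snd z \<in> U} = points X \<times> U" if "openin (ktop Y) U" for U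
    using openin_subset[OF that] by (auto simp: points_kprod[OF X Y])
  have "f \<circ> snd \<in> regular (kprod X Y) (points X \<times> U)" if "openin (ktop Y) U" "f \<in> regular Y U" for U f
    using regular_kprod_tensor[OF X Y openin_topspace that(1)
        tensor_functions_simple[OF regular_one[OF X openin_topspace] that(2)]]
    by (simp add: comp_def)
  then show ?thesis
    unfolding kmorphism_def continuous_map_def
    using openin_kprod_Times[OF X Y openin_topspace] by (auto simp: eq) (auto simp: points_kprod[OF X Y])
qed

lemma regular_tensor_pullback:
  assumes Z: "ringed Z" and \<phi>: "kmorphism Z X \<phi>" and \<psi>: "kmorphism Z Y \<psi>"
    and U: "openin (ktop X) U" and V: "openin (ktop Y) V" and t: "t \<in> tensor_functions X Y U V"
  defines "D \<equiv> {z \<in> points Z. \<phi> z \<in> U \<and> \<psi> z \<in> V}"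
  shows "openin (ktop Z) D" "(\<lambda>z. t (\<phi> z, \<psi> z)) \<in> regular Z D"
proof -
  have "D = {z \<in> points Z. \<phi> z \<in> U} \<inter> {z \<in> points Z. \<psi> z \<in> V}" by (auto simp: D_def)
  then show D: "openin (ktop Z) D"
    using kmorphism_openin[OF \<phi> U] kmorphism_openin[OF \<psi> V] by auto
  obtain n :: nat and g h where t': "t = (\<lambda>z. \<Sum>i<n. g i (fst z) * h i (snd z))"
    "\<forall>i<n. g i \<in> regular X U" "\<forall>i<n. h i \<in> regular Y V"
    using tensor_functionsD[OF t] by blast
  show "(\<lambda>z. t (\<phi> z, \<psi> z)) \<in> regular Z D"
    unfolding t'(1) fst_conv snd_conv
    by (intro regular_sum regular_mult Z D kmorphism_regular_on[OF \<phi> ringed_sheaf[OF Z] U]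
        kmorphism_regular_on[OF \<psi> ringed_sheaf[OF Z] V])
      (auto simp: D_def t')
qed

text \<open>
  The universal property of the product: a tensor function pulls back to a sum of products of
  regular functions, and the product structure is generated by such functions.
\<close>

lemma kmorphism_pair:
  assumes X: "ringed X" and Y: "ringed Y" and Z: "ringed Z"
    and \<phi>: "kmorphism Z X \<phi>" and \<psi>: "kmorphism Z Y \<psi>"
  shows "kmorphism Z (kprod X Y) (\<lambda>z. (\<phi> z, \<psi> z))"
proof (rule kmorphismI[OF ringed_sheaf[OF Z]])
  show c: "continuous_map (ktop Z) (ktop (kprod X Y)) (\<lambda>z. (\<phi> z, \<psi> z))"
    unfolding kprod_def Let_def
  proof (simp only: kspace.simps, rule continuous_on_generated_topo)
    fix N assume "N \<in> {{z \<in> U \<times> V. t z \<noteq> 0} | U V t.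
      openin (ktop X) U \<and> openin (ktop Y) V \<and> t \<in> tensor_functions X Y U V}"
    then obtain U V t where N: "N = {z \<in> U \<times> V. t z \<noteq> 0}" "openin (ktop X) U" "openin (ktop Y) V"
      "t \<in> tensor_functions X Y U V" by blast
    from openin_nonvanishing[OF Z regular_tensor_pullback[OF Z \<phi> \<psi> N(2-4)]]
    have "openin (ktop Z) {z \<in> {z \<in> points Z. \<phi> z \<in> U \<and> \<psi> z \<in> V}. t (\<phi> z, \<psi> z) \<noteq> 0}" .
    moreover have "(\<lambda>z. (\<phi> z, \<psi> z)) -` N \<inter> points Z =
        {z \<in> {z \<in> points Z. \<phi> z \<in> U \<and> \<psi> z \<in> V}. t (\<phi> z, \<psi> z) \<noteq> 0}"
      unfolding N(1) by auto
    ultimately show "openin (ktop Z) ((\<lambda>z. (\<phi> z, \<psi> z)) -` N \<inter> points Z)" by simp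
  next
    have "points (kprod X Y) = \<Union> {{z \<in> U \<times> V. t z \<noteq> 0} | U V t.
      openin (ktop X) U \<and> openin (ktop Y) V \<and> t \<in> tensor_functions X Y U V}"
      by (simp add: kprod_def Let_def)
    moreover have "(\<lambda>z. (\<phi> z, \<psi> z)) ` points Z \<subseteq> points (kprod X Y)"
      using points_kprod[OF X Y] kmorphism_point[OF \<phi>] kmorphism_point[OF \<psi>] by auto
    ultimately show "(\<lambda>z. (\<phi> z, \<psi> z)) ` points Z \<subseteq> \<Union> {{z \<in> U \<times> V. t z \<noteq> 0} | U V t.
      openin (ktop X) U \<and> openin (ktop Y) V \<and> t \<in> tensor_functions X Y U V}"
      by simp
  qed
  fix D f x
  assume a: "openin (ktop (kprod X Y)) D" "f \<in> regular (kprod X Y) D" "x \<in> points Z" "(\<phi> x, \<psi> x) \<in> D"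
  then obtain N where N: "openin (ktop (kprod X Y)) N" "(\<phi> x, \<psi> x) \<in> N" "N \<subseteq> D" "f \<in> tensor_ratios X Y N"
    unfolding regular_kprod by blast
  obtain U V s t where f: "openin (ktop X) U" "openin (ktop Y) V" "N \<subseteq> U \<times> V"
             "s \<in> tensor_functions X Y U V" "t \<in> tensor_functions X Y U V"
             "\<forall>w\<in>N. t w \<noteq> 0 \<and> f w = s w / t w"
    by (rule tensor_ratiosE[OF N(4)]) (rule that)
  let ?W = "{z \<in> points Z. (\<phi> z, \<psi> z) \<in> N}"
  have o: "openin (ktop Z) ?W" using c N(1) by (auto simp: continuous_map_def)
  note r = regular_restrict[OF ringed_sheaf[OF Z] regular_tensor_pullback(1)[OF Z \<phi> \<psi> f(1,2)] o _
      regular_tensor_pullback(2)[OF Z \<phi> \<psi> f(1,2)]]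
  show "\<exists>V g. openin (ktop Z) V \<and> x \<in> V \<and> g \<in> regular Z V \<and>
      (\<forall>y\<in>V. (\<phi> y, \<psi> y) \<in> D \<longrightarrow> f (\<phi> y, \<psi> y) = g y)"
  proof (intro exI conjI)
    show "(\<lambda>z. s (\<phi> z, \<psi> z) / t (\<phi> z, \<psi> z)) \<in> regular Z ?W"
      by (intro regular_divide Z o r[OF f(4) _ f(4)] r[OF f(5) _ f(5)]) (use f in auto)
  qed (use o a N f(6) in auto)
qed

text \<open>
  A tensor function that vanishes on the diagonal but not at \<open>(x, y)\<close> provides a neighbourhood of
  \<open>(x, y)\<close> disjoint from the diagonal.
\<close>

lemma separatedI:
  assumes X: "ringed X"
    and sep: "\<And>x y. x \<in> points X \<Longrightarrow> y \<in> points X \<Longrightarrow> x \<noteq> y \<Longrightarrow>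
      \<exists>U V t. openin (ktop X) U \<and> openin (ktop X) V \<and> x \<in> U \<and> y \<in> V \<and>
        t \<in> tensor_functions X X U V \<and> t (x, y) \<noteq> 0 \<and> (\<forall>z\<in>U \<inter> V. t (z, z) = 0)"
  shows "separated X"
proof -
  have "openin (ktop (kprod X X)) (points X \<times> points X - {(x, x) | x. x \<in> points X})"
  proof (subst openin_subopen, intro ballI)
    fix z assume z: "z \<in> points X \<times> points X - {(x, x) | x. x \<in> points X}"
    then obtain U V t where a: "openin (ktop X) U" "openin (ktop X) V" "fst z \<in> U" "snd z \<in> V"
        "t \<in> tensor_functions X X U V" "t z \<noteq> 0" "\<forall>z\<in>U \<inter> V. t (z, z) = 0"
      using sep[of "fst z" "snd z"] by fastforce
    then show "\<exists>T. openin (ktop (kprod X X)) T \<and> z \<in> T \<and>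
        T \<subseteq> points X \<times> points X - {(x, x) | x. x \<in> points X}"
      by (intro exI[of _ "{z \<in> U \<times> V. t z \<noteq> 0}"])
        (use openin_kprod_basic[OF a(1,2,5)] openin_subset[OF a(1)] openin_subset[OF a(2)] in
          \<open>auto simp: mem_Times_iff\<close>)
  qed
  then show ?thesis
    unfolding separated_def closedin_def points_kprod[OF X X] by auto
qed

text \<open>
  The diagonal is the preimage of the diagonal under the square of an injective morphism. This
  covers subspaces as well as relabelled copies.
\<close>

lemma separated_injective:
  assumes X: "ringed X" and Y: "ringed Y" and sep: "separated Y" and \<phi>: "kmorphism X Y \<phi>"
    and inj: "inj_on \<phi> (points X)"
  shows "separated X"
proof -
  have m: "kmorphism (kprod X X) (kprod Y Y) (\<lambda>z. (\<phi> (fst z), \<phi> (snd z)))"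
    by (intro kmorphism_pair Y ringed_kprod X kmorphism_comp[OF kmorphism_fst \<phi>]
        kmorphism_comp[OF kmorphism_snd \<phi>])
  have "{z \<in> points (kprod X X). (\<phi> (fst z), \<phi> (snd z)) \<in> {(y, y) | y. y \<in> points Y}} =
      {(x, x) | x. x \<in> points X}"
    using kmorphism_point[OF \<phi>] inj by (auto simp: points_kprod[OF X X] dest: inj_onD)
  then show ?thesis
    using kmorphism_closedin[OF m sep[unfolded separated_def]] by (simp add: separated_def)
qed

lemma nonzero_coordinate:
  assumes "x \<in> coord_space E" "x \<noteq> 0"
  obtains i where "i \<in> E" "x i \<noteq> 0"
  using assms by (auto simp: coord_space_def fun_eq_iff)

lemma regular_coordinate_ratio:
  "(\<lambda>l. homog_coords E l j / homog_coords E l i) \<in>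
    regular (projective_space E :: (_, 'k::field) kspace) (proj_open E (mp_var i))"
  using regular_homogeneous_ratio[OF mp_homogeneous_var[of j] mp_homogeneous_var[of i], of E] by simp

text \<open>
  Two lines in a common chart differ in some ratio of coordinates. If no chart contains both,
  choose \<open>i\<close> and \<open>j\<close> with \<open>x\<^sub>i\<close> nonzero only on the first and \<open>x\<^sub>j\<close> nonzero only on the second line:
  then \<open>1 - (x\<^sub>j / x\<^sub>i)(l) (x\<^sub>i / x\<^sub>j)(m)\<close> equals \<open>1\<close> at this pair and vanishes on the diagonal.
\<close>

lemma separated_projective_space: "separated (projective_space E :: (('i \<Rightarrow> _) set, 'k::field) kspace)"
proof (rule separatedI[OF ringed_projective_space])
  let ?X = "projective_space E :: (('i \<Rightarrow> _) set, 'k) kspace"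
  fix l m assume lm: "l \<in> points ?X" "m \<in> points ?X" "l \<noteq> m"
  let ?x = "homog_coords E l" and ?y = "homog_coords E m"
  let ?D = "\<lambda>i. proj_open E (mp_var i) :: ('i \<Rightarrow> 'k alg_closure) set set"
  have D: "l \<in> ?D i \<longleftrightarrow> l \<in> points ?X \<and> homog_coords E l i \<noteq> 0" for l i
    using proj_open_iff[OF mp_homogeneous_var, of l E i] by simp
  have o: "openin (ktop ?X) (?D i)" for i using openin_proj_open[OF mp_homogeneous_var] .
  note x = homog_coords_point[OF lm(1)] and y = homog_coords_point[OF lm(2)]
  show "\<exists>U V t. openin (ktop ?X) U \<and> openin (ktop ?X) V \<and> l \<in> U \<and> m \<in> V \<and>
        t \<in> tensor_functions ?X ?X U V \<and> t (l, m) \<noteq> 0 \<and> (\<forall>z\<in>U \<inter> V. t (z, z) = 0)"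
  proof (cases "\<exists>i. ?x i \<noteq> 0 \<and> ?y i \<noteq> 0")
    case True
    then obtain i where i: "?x i \<noteq> 0" "?y i \<noteq> 0" by blast
    have "\<exists>j. ?x j / ?x i \<noteq> ?y j / ?y i"
    proof (rule ccontr)
      assume "\<nexists>j. ?x j / ?x i \<noteq> ?y j / ?y i"
      then have e: "?x j / ?x i = ?y j / ?y i" for j by blast
      have "?x = (\<lambda>j. (?x i / ?y i) * ?y j)"
      proof
        fix j show "?x j = (?x i / ?y i) * ?y j" using e[of j] i by (simp add: field_simps)
      qed
      then have "line ?x = line ?y" using line_scale[of "?x i / ?y i" ?y] i by simp
      then show False using x y lm by simp
    qed
    then obtain j where j: "?x j / ?x i \<noteq> ?y j / ?y i" by blast
    let ?r = "\<lambda>l. homog_coords E l j / homog_coords E l i"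
    have "(\<lambda>z. ?r (fst z) * 1 + -1 * ?r (snd z)) \<in> tensor_functions ?X ?X (?D i) (?D i)"
      using tensor_functions_add[OF
          tensor_functions_simple[OF regular_coordinate_ratio[of E j i]
            regular_one[OF ringed_projective_space o[of i]]]
          tensor_functions_simple[OF regular_const[OF ringed_projective_space o[of i], of "-1"]
            regular_coordinate_ratio[of E j i]]]
      by simp
    then show ?thesis
      by (intro exI[of _ "?D i"] exI[of _ "\<lambda>z. ?r (fst z) * 1 + -1 * ?r (snd z)"])
        (use o i j lm in \<open>auto simp: D\<close>)
  next
    case False
    obtain i where i: "?x i \<noteq> 0" using nonzero_coordinate[OF x(1,2)] by blast
    obtain j where j: "?y j \<noteq> 0" using nonzero_coordinate[OF y(1,2)] by blast
    have ij: "?x j = 0" "?y i = 0" using False i j by blast+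
    let ?r = "\<lambda>l. homog_coords E l j / homog_coords E l i"
    let ?s = "\<lambda>l. homog_coords E l i / homog_coords E l j"
    have "(\<lambda>z. 1 * 1 + (-1 * ?r (fst z)) * ?s (snd z)) \<in> tensor_functions ?X ?X (?D i) (?D j)"
      using tensor_functions_add[OF
          tensor_functions_simple[OF regular_one[OF ringed_projective_space o[of i]]
            regular_one[OF ringed_projective_space o[of j]]]
          tensor_functions_simple[OF regular_mult[OF ringed_projective_space o[of i]
              regular_const[OF ringed_projective_space o[of i], of "-1"] regular_coordinate_ratio[of E j i]]
            regular_coordinate_ratio[of E i j]]]
      by simp
    then show ?thesis
      by (intro exI[of _ "?D i"] exI[of _ "?D j"] exI[of _ "\<lambda>z. 1 * 1 + (-1 * ?r (fst z)) * ?s (snd z)"])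
        (use o i j ij lm in \<open>auto simp: D\<close>)
  qed
qed

section \<open>Quasi-projective pieces are varieties\<close>

lemma affine_variety_kiso:
  fixes Y :: "('p, 'k::field) kspace"
  assumes "kiso X Y" "affine_variety Y"
  shows "affine_variety X"
proof -
  obtain n Z where "closedin (ktop (affine_space {..<n :: nat} :: (_, 'k) kspace)) Z"
    "kiso Y (induced (affine_space {..<n} :: (_, 'k) kspace) Z)"
    using assms(2) unfolding affine_variety_def by blast
  then show ?thesis
    unfolding affine_variety_def using kiso_trans[OF assms(1)] by blast
qed

lemma regular_induced_restrict:
  assumes X: "ringed X" and U: "openin (ktop X) U" "f \<in> regular X U" and S: "S \<subseteq> U"
  shows "f \<in> regular (induced X S) (points (induced X S))"
  using kmorphism_regular_on[OF kmorphism_inclusion ringed_sheaf[OF ringed_induced[OF X]] U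
      openin_topspace, of S] S
  by (auto simp: points_induced)

text \<open>
  In the chart \<open>x\<^sub>i \<noteq> 0\<close> the ratios \<open>x\<^sub>j / x\<^sub>i\<close> are affine coordinates, and one further coordinate
  \<open>x\<^sub>i\<^sup>d / \<psi>\<close> records that \<open>\<psi>\<close> does not vanish (the device of Rabinowitsch). The image is closed:
  it is cut out by \<open>z\<^sub>i = 1\<close> and \<open>z\<^sub>n \<psi>(z) = 1\<close> together with the preimage of the closed set \<open>C\<close>
  under the morphism to projective space.
\<close>

lemma affine_variety_chart:
  fixes \<psi> :: "('i, 'k::field) mpoly"
  assumes E: "finite E" and i: "i \<in> E" and \<psi>: "mp_homogeneous d \<psi>"
    and C: "closedin (ktop (projective_space E :: (_, 'k) kspace)) C"
  shows "affine_variety (induced (projective_space E :: (_, 'k) kspace)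
      (C \<inter> proj_open E \<psi> \<inter> proj_open E (mp_var i)))"
proof -
  define n where "n = card E"
  obtain b where b: "bij_betw b {..<n} E"
    using ex_bij_betw_nat_finite[OF E] by (auto simp: n_def lessThan_atLeast0)
  define b' where "b' = inv_into {..<n} b"
  have b1: "b k \<in> E" "b' (b k) = k" if "k < n" for k
    using b that by (auto simp: b'_def bij_betw_def)
  have b2: "b' e < n" "b (b' e) = e" if "e \<in> E" for e
    using b that f_inv_into_f[of e b "{..<n}"] inv_into_into[of e b "{..<n}"]
    by (auto simp: b'_def bij_betw_def)
  let ?P = "projective_space E :: (('i \<Rightarrow> 'k alg_closure) set, 'k) kspace"
  let ?A = "affine_space {..<Suc n} :: (nat \<Rightarrow> 'k alg_closure, 'k) kspace"
  let ?S = "C \<inter> proj_open E \<psi> \<inter> proj_open E (mp_var i)"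
  note rP = ringed_projective_space[of E] and rA = ringed_affine_space[of "{..<Suc n}"]
  define x where "x l = homog_coords E l" for l :: "('i \<Rightarrow> 'k alg_closure) set"
  \<comment> \<open>Entries below \<open>n\<close> are the ratios of coordinates; entry \<open>n\<close> inverts \<open>\<psi>\<close>, scaled to degree zero.\<close>
  define g where "g z = (\<lambda>e. if e \<in> E then z (b' e) else 0)" for z :: "nat \<Rightarrow> 'k alg_closure"
  define \<phi> where "\<phi> l = (\<lambda>k. if k < n then x l (b k) / x l i else
      if k = n then x l i ^ d / mp_eval \<psi> (x l) else 0)" for l
  define Z where "Z = {z \<in> coord_space {..<Suc n}. z (b' i) = 1 \<and> z n * mp_eval \<psi> (g z) = 1 \<and>
      line (g z) \<in> C}"
  have CP: "C \<subseteq> points ?P" using closedin_subset[OF C] .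
  have gE: "g z \<in> coord_space E" for z by (auto simp: g_def coord_space_def)
  have g0: "g z \<noteq> 0" if "z (b' i) = 1" for z
  proof
    assume "g z = 0"
    then have "g z i = 0" by simp
    with that i show False by (simp add: g_def)
  qed
  have S_x: "x l \<in> coord_space E" "x l \<noteq> 0" "line (x l) = l" "x l i \<noteq> 0" "mp_eval \<psi> (x l) \<noteq> 0" "l \<in> C"
    if "l \<in> ?S" for l
    using that homog_coords_point[of l E] CP proj_open_iff[OF \<psi>, of l E]
      proj_open_iff[OF mp_homogeneous_var, of l E i]
    by (auto simp: x_def)
  have greg: "(\<lambda>z. g z e) \<in> regular ?A (points ?A)" for e
    using regular_coordinate[of "b' e" "{..<Suc n}"] regular_zero[OF rA openin_topspace]
    by (cases "e \<in> E") (simp_all add: g_def)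
  have evreg: "(\<lambda>z. mp_eval \<psi> (g z)) \<in> regular ?A (points ?A)"
    using regular_mp_eval[OF rA openin_topspace greg] by simp
  have zreg: "(\<lambda>z. z k) \<in> regular ?A (points ?A)" for k
    using regular_coordinate[of k "{..<Suc n}"] by simp
  have chi: "kmorphism (induced ?A T) ?P (\<lambda>z. line (g z))" if T: "\<And>z. z \<in> T \<Longrightarrow> z (b' i) = 1" for T
  proof (rule kmorphism_to_projective_space[OF ringed_induced[OF rA]])
    fix z assume z: "z \<in> points (induced ?A T)"
    have "(\<lambda>z. g z e) \<in> regular (induced ?A T) (points (induced ?A T))" for e
      using kmorphism_regular_on[OF kmorphism_inclusion ringed_sheaf[OF ringed_induced[OF rA]]
          openin_topspace greg openin_topspace]
      by (simp add: points_induced)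
    then show "\<exists>U h. openin (ktop (induced ?A T)) U \<and> z \<in> U \<and>
      (\<forall>i. (\<lambda>y. h y i) \<in> regular (induced ?A T) U) \<and>
      (\<forall>y\<in>U. h y \<in> coord_space E \<and> h y \<noteq> 0 \<and> line (g y) = line (h y))"
      by (intro exI[of _ "points (induced ?A T)"] exI[of _ g])
        (use z gE g0 T openin_topspace[of "ktop (induced ?A T)"] in \<open>auto simp: points_induced\<close>)
  qed
  have Zclosed: "closedin (ktop ?A) Z"
  proof -
    define H where "H = {z \<in> points ?A. z (b' i) - 1 = 0}"
    have H: "closedin (ktop ?A) H"
      unfolding H_def
      by (rule ringed_closedin_zero[OF rA regular_diff[OF rA openin_topspace zreg regular_one[OF rA openin_topspace]]])
    have H': "closedin (ktop ?A) {z \<in> points ?A. z n * mp_eval \<psi> (g z) - 1 = 0}"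
      by (rule ringed_closedin_zero[OF rA regular_diff[OF rA openin_topspace
              regular_mult[OF rA openin_topspace zreg evreg] regular_one[OF rA openin_topspace]]])
    have "closedin (ktop (induced ?A H)) {z \<in> points (induced ?A H). line (g z) \<in> C}"
      by (rule kmorphism_closedin[OF chi C]) (simp add: H_def)
    then have "closedin (ktop ?A) {z \<in> points (induced ?A H). line (g z) \<in> C}"
      using closedin_trans_full[OF _ H] by (simp add: induced_def)
    moreover have "Z = {z \<in> points (induced ?A H). line (g z) \<in> C} \<inter>
        {z \<in> points ?A. z n * mp_eval \<psi> (g z) - 1 = 0}"
      unfolding Z_def H_def points_induced by auto
    ultimately show ?thesis using H' by auto
  qed
  have "kiso (induced ?P ?S) (induced ?A Z)"
  proof (rule kisoI)
    have pS: "points (induced ?P ?S) = ?S" using CP by (auto simp: points_induced)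
    have gx: "g (\<phi> l) = (\<lambda>e. (1 / x l i) * x l e)" if "l \<in> ?S" for l
      using S_x(1)[OF that] by (auto simp: g_def \<phi>_def b2 coord_space_def)
    show "kmorphism (induced ?P ?S) (induced ?A Z) \<phi>"
    proof (rule kmorphism_corestrict[OF ringed_sheaf[OF ringed_induced[OF rP]]
          kmorphism_to_affine_space[OF ringed_induced[OF rP]]])
      show "\<phi> l \<in> coord_space {..<Suc n}" for l by (auto simp: \<phi>_def coord_space_def)
      show "(\<lambda>l. \<phi> l k) \<in> regular (induced ?P ?S) (points (induced ?P ?S))" for k
      proof -
        consider "k < n" | "k = n" | "k > n" by linarith
        then show ?thesis
        proof cases
          case 1
          have "(\<lambda>l. x l (b k) / x l i) \<in> regular (induced ?P ?S) (points (induced ?P ?S))"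
            using regular_induced_restrict[OF rP openin_proj_open[OF mp_homogeneous_var]
                regular_coordinate_ratio, of ?S] by (auto simp: x_def)
          then show ?thesis using 1 by (simp add: \<phi>_def)
        next
          case 2
          have "mp_homogeneous d (mp_var i ^ d :: (_, 'k) mpoly)"
            using mp_homogeneous_power[OF mp_homogeneous_var, of d i] by simp
          then have "(\<lambda>l. x l i ^ d / mp_eval \<psi> (x l)) \<in> regular (induced ?P ?S) (points (induced ?P ?S))"
            using regular_induced_restrict[OF rP openin_proj_open[OF \<psi>]
                regular_homogeneous_ratio[OF _ \<psi>], of "mp_var i ^ d" ?S] by (auto simp: x_def mp_eval_power)
          then show ?thesis using 2 by (simp add: \<phi>_def)
        next
          case 3
          then show ?thesis
            using regular_zero[OF ringed_induced[OF rP] openin_topspace] by (simp add: \<phi>_def)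
        qed
      qed
      fix l assume "l \<in> points (induced ?P ?S)"
      then have l: "l \<in> ?S" using pS by simp
      have "line (g (\<phi> l)) = l"
        unfolding gx[OF l] using line_scale[of "1 / x l i" "x l"] S_x[OF l] by simp
      moreover have "\<phi> l (b' i) = 1" using S_x(4)[OF l] by (simp add: \<phi>_def b2[OF i])
      moreover have "\<phi> l n * mp_eval \<psi> (g (\<phi> l)) = 1"
        unfolding gx[OF l] mp_eval_scale[OF \<psi>] using S_x(4,5)[OF l] by (simp add: \<phi>_def power_divide)
      ultimately show "\<phi> l \<in> Z"
        using S_x(6)[OF l] by (auto simp: Z_def \<phi>_def coord_space_def)
    qed
    show "kmorphism (induced ?A Z) (induced ?P ?S) (\<lambda>z. line (g z))"
    proof (rule kmorphism_corestrict[OF ringed_sheaf[OF ringed_induced[OF rA]] chi])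
      fix z assume "z \<in> points (induced ?A Z)"
      then have z: "z \<in> Z" by (simp add: points_induced)
      then have "g z i = 1" "mp_eval \<psi> (g z) \<noteq> 0" using i by (auto simp: Z_def g_def)
      moreover have "g z \<noteq> 0" using g0 z by (simp add: Z_def)
      ultimately show "line (g z) \<in> ?S"
        using z line_in_proj_open_iff[OF \<psi> gE, of z] line_in_proj_open_iff[OF mp_homogeneous_var gE, of z i]
        by (auto simp: Z_def)
    qed (simp add: Z_def)
    show "line (g (\<phi> l)) = l" if "l \<in> points (induced ?P ?S)" for l
    proof -
      have l: "l \<in> ?S" using pS that by simp
      show ?thesis
        unfolding gx[OF l] using line_scale[of "1 / x l i" "x l"] S_x[OF l] by simp
    qed
    show "\<phi> (line (g z)) = z" if "z \<in> points (induced ?A Z)" for z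
    proof -
      have z: "z \<in> Z" using that by (simp add: points_induced)
      then have "g z \<noteq> 0" using g0 by (simp add: Z_def)
      then obtain c where c: "c \<noteq> 0" "x (line (g z)) = (\<lambda>e. c * g z e)"
        using homog_coords_line[OF gE] unfolding x_def by metis
      have gi: "g z i = 1" using z i by (simp add: Z_def g_def)
      have "mp_eval \<psi> (g z) \<noteq> 0" "z n * mp_eval \<psi> (g z) = 1" using z by (auto simp: Z_def)
      then have zn: "1 / mp_eval \<psi> (g z) = z n" by (simp add: field_simps)
      show ?thesis
      proof
        fix k
        consider "k < n" | "k = n" | "k > n" by linarith
        then show "\<phi> (line (g z)) k = z k"
        proof cases
          case 1
          then have "g z (b k) = z k" using b1[OF 1] by (simp add: g_def)
          then show ?thesis using 1 c gi by (simp add: \<phi>_def)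
        next
          case 2
          then show ?thesis
            using c(1) gi zn by (simp add: \<phi>_def c(2) mp_eval_scale[OF \<psi>])
        next
          case 3
          then show ?thesis using z by (auto simp: \<phi>_def Z_def coord_space_def)
        qed
      qed
    qed
  qed
  then show ?thesis
    unfolding affine_variety_def using Zclosed by blast
qed

text \<open>
  The standard charts give a finite affine cover, and separatedness is inherited from projective
  space.
\<close>

lemma is_variety_proj_piece:
  fixes \<psi> :: "('i, 'k::field) mpoly"
  assumes E: "finite E" and \<psi>: "mp_homogeneous d \<psi>"
    and C: "closedin (ktop (projective_space E :: (_, 'k) kspace)) C"
  shows "is_variety (induced (projective_space E :: (_, 'k) kspace) (C \<inter> proj_open E \<psi>))"
proof -
  let ?P = "projective_space E :: (('i \<Rightarrow> 'k alg_closure) set, 'k) kspace"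
  let ?S = "C \<inter> proj_open E \<psi>"
  let ?D = "\<lambda>i. proj_open E (mp_var i) :: ('i \<Rightarrow> 'k alg_closure) set set"
  note rP = ringed_projective_space[of E]
  have CP: "C \<subseteq> points ?P" using closedin_subset[OF C] .
  show ?thesis
    unfolding is_variety_def
  proof (intro conjI exI[of _ "(\<lambda>i. ?S \<inter> ?D i) ` E"])
    show "function_sheaf (induced ?P ?S)" by (rule ringed_sheaf[OF ringed_induced[OF rP]])
    show "separated (induced ?P ?S)"
      by (rule separated_injective[OF ringed_induced[OF rP] rP separated_projective_space kmorphism_inclusion])
        simp
    show "finite ((\<lambda>i. ?S \<inter> ?D i) ` E)" using E by simp
    have "\<exists>i\<in>E. l \<in> ?D i" if l: "l \<in> points ?P" for l
    proof -
      obtain i where "i \<in> E" "homog_coords E l i \<noteq> 0"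
        by (rule nonzero_coordinate[OF homog_coords_point(1,2)[OF l]])
      then show ?thesis using proj_open_iff[OF mp_homogeneous_var, of l E i] l by auto
    qed
    then have cover: "points ?P \<subseteq> (\<Union>i\<in>E. ?D i)" by blast
    have "points (induced ?P ?S) = ?S" using CP by (simp only: points_induced) blast
    moreover have "(\<Union>i\<in>E. ?S \<inter> ?D i) = ?S" using cover CP by blast
    ultimately show "\<Union> ((\<lambda>i. ?S \<inter> ?D i) ` E) = points (induced ?P ?S)" by simp
    show "\<forall>U\<in>(\<lambda>i. ?S \<inter> ?D i) ` E. openin (ktop (induced ?P ?S)) U \<and>
        affine_variety (induced (induced ?P ?S) U)"
    proof (intro ballI conjI; elim imageE; simp only:)
      fix i assume i: "i \<in> E"
      show "openin (ktop (induced ?P ?S)) (?S \<inter> ?D i)"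
        unfolding openin_induced
        by (rule exI[of _ "?D i"]) (use openin_proj_open[OF mp_homogeneous_var] in auto)
      have "?S \<inter> (?S \<inter> ?D i) = ?S \<inter> ?D i" by blast
      then show "affine_variety (induced (induced ?P ?S) (?S \<inter> ?D i))"
        using affine_variety_kiso[OF kiso_induced_induced[OF rP, of ?S "?S \<inter> ?D i"]]
          affine_variety_chart[OF E i \<psi> C] by simp
    qed
  qed
qed

text \<open>
  Spaces whose class in the Grothendieck ring is meaningful. Asking for a representative that is
  itself \<open>ringed\<close> allows closed and open pieces to be transported to it.
\<close>

definition representable :: "('p, 'k::field) kspace \<Rightarrow> bool" where
  "representable X \<longleftrightarrow> (\<exists>V. kiso X (Rep_variety V) \<and> ringed (Rep_variety V))"

text \<open>
  Transport of structure along an injection of the points, needed to pass to points that are lists.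
\<close>

definition relabel :: "('p \<Rightarrow> 'q) \<Rightarrow> ('p, 'k::field) kspace \<Rightarrow> ('q, 'k) kspace" where
  "relabel f X = \<lparr> ktop = pullback_topology (f ` points X) (inv_into (points X) f) (ktop X),
     regular = (\<lambda>U. {h. (\<lambda>x. h (f x)) \<in> regular X {x \<in> points X. f x \<in> U}}) \<rparr>"

context
  fixes X :: "('p, 'k::field) kspace" and f :: "'p \<Rightarrow> 'q"
  assumes X: "ringed X" and inj: "inj_on f (points X)"
begin

lemma points_relabel: "points (relabel f X) = f ` points X"
  using inj by (auto simp: relabel_def topspace_pullback_topology)

lemma openin_relabel:
  "openin (ktop (relabel f X)) U \<longleftrightarrow> U \<subseteq> f ` points X \<and> openin (ktop X) {x \<in> points X. f x \<in> U}"
proof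
  assume "openin (ktop (relabel f X)) U"
  then obtain V where V: "openin (ktop X) V" "U = inv_into (points X) f -` V \<inter> f ` points X"
    by (auto simp: relabel_def openin_pullback_topology)
  have "f x \<in> U \<longleftrightarrow> x \<in> V" if "x \<in> points X" for x
    using that inj V(2) by simp
  then have "{x \<in> points X. f x \<in> U} = V" using openin_subset[OF V(1)] by blast
  with V show "U \<subseteq> f ` points X \<and> openin (ktop X) {x \<in> points X. f x \<in> U}" by simp
next
  assume a: "U \<subseteq> f ` points X \<and> openin (ktop X) {x \<in> points X. f x \<in> U}"
  then have "U = inv_into (points X) f -` {x \<in> points X. f x \<in> U} \<inter> f ` points X"
    using inj by (auto simp: f_inv_into_f)
  with a show "openin (ktop (relabel f X)) U"
    by (auto simp: relabel_def openin_pullback_topology)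
qed

lemma regular_relabel:
  "h \<in> regular (relabel f X) U \<longleftrightarrow> (\<lambda>x. h (f x)) \<in> regular X {x \<in> points X. f x \<in> U}"
  by (simp add: relabel_def)

lemma ringed_relabel: "ringed (relabel f X)"
  unfolding ringed_def
proof (intro conjI allI impI ballI)
  note shX = ringed_sheaf[OF X]
  have o: "openin (ktop X) {x \<in> points X. f x \<in> U}" if "openin (ktop (relabel f X)) U" for U
    using that openin_relabel by blast
  have sub: "U \<subseteq> f ` points X" if "openin (ktop (relabel f X)) U" for U
    using that openin_relabel by blast
  show "function_sheaf (relabel f X)"
    unfolding function_sheaf_def
  proof (intro conjI allI impI; elim conjE)
    fix U h h' assume a: "openin (ktop (relabel f X)) U" "h \<in> regular (relabel f X) U" "\<forall>x\<in>U. h' x = h x"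
    show "h' \<in> regular (relabel f X) U"
      unfolding regular_relabel
      by (rule regular_cong[OF shX o[OF a(1)] a(2)[unfolded regular_relabel]]) (use a(3) in auto)
  next
    fix U V h assume a: "openin (ktop (relabel f X)) U" "openin (ktop (relabel f X)) V" "V \<subseteq> U"
      "h \<in> regular (relabel f X) U"
    show "h \<in> regular (relabel f X) V"
      unfolding regular_relabel
      by (rule regular_restrict[OF shX o[OF a(1)] o[OF a(2)] _ a(4)[unfolded regular_relabel]])
        (use a(3) in auto)
  next
    fix U h assume a: "openin (ktop (relabel f X)) U"
      "\<forall>x\<in>U. \<exists>V. openin (ktop (relabel f X)) V \<and> x \<in> V \<and> V \<subseteq> U \<and> h \<in> regular (relabel f X) V"
    show "h \<in> regular (relabel f X) U"
      unfolding regular_relabel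
    proof (rule regular_glue[OF shX o[OF a(1)]])
      fix x assume x: "x \<in> {x \<in> points X. f x \<in> U}"
      then obtain V where V: "openin (ktop (relabel f X)) V" "f x \<in> V" "V \<subseteq> U" "h \<in> regular (relabel f X) V"
        using a(2) by blast
      show "\<exists>V. openin (ktop X) V \<and> x \<in> V \<and> V \<subseteq> {x \<in> points X. f x \<in> U} \<and> (\<lambda>x. h (f x)) \<in> regular X V"
        by (rule exI[of _ "{x \<in> points X. f x \<in> V}"]) (use x V o[OF V(1)] in \<open>auto simp: regular_relabel\<close>)
    qed
  qed
  fix U assume U: "openin (ktop (relabel f X)) U"
  show "(\<lambda>_. to_ac c) \<in> regular (relabel f X) U" for c
    unfolding regular_relabel by (rule regular_const[OF X o[OF U]])
  show "(\<lambda>x. h x + h' x) \<in> regular (relabel f X) U" "(\<lambda>x. h x * h' x) \<in> regular (relabel f X) U"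
    if "h \<in> regular (relabel f X) U" "h' \<in> regular (relabel f X) U" for h h'
    using that unfolding regular_relabel
    by (auto intro: regular_add[OF X o[OF U]] regular_mult[OF X o[OF U]])
  fix h assume h: "h \<in> regular (relabel f X) U"
  have eq: "{x \<in> points X. f x \<in> {y \<in> U. h y \<noteq> 0}} = {x \<in> {x \<in> points X. f x \<in> U}. h (f x) \<noteq> 0}"
    by auto
  show "openin (ktop (relabel f X)) {x \<in> U. h x \<noteq> 0}"
    unfolding openin_relabel eq
    using openin_nonvanishing[OF X o[OF U] h[unfolded regular_relabel]] sub[OF U] by auto
  show "(\<lambda>x. inverse (h x)) \<in> regular (relabel f X) {x \<in> U. h x \<noteq> 0}"
    unfolding regular_relabel eq
    by (rule regular_inverse_nonvanishing[OF X o[OF U] h[unfolded regular_relabel]])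
qed

lemma kmorphism_relabel: "kmorphism X (relabel f X) f"
  unfolding kmorphism_def continuous_map_def
  by (auto simp: points_relabel openin_relabel regular_relabel comp_def)

lemma kmorphism_unlabel: "kmorphism (relabel f X) X (inv_into (points X) f)"
  unfolding kmorphism_def continuous_map_def
proof (intro conjI allI impI; (elim conjE)?)
  show "inv_into (points X) f \<in> points (relabel f X) \<rightarrow> points X"
    by (auto simp: points_relabel intro: inv_into_into)
  fix U assume U: "openin (ktop X) U"
  have eq: "{x \<in> points X. f x \<in> {y \<in> points (relabel f X). inv_into (points X) f y \<in> U}} = U"
  proof -
    have "f x \<in> {y \<in> points (relabel f X). inv_into (points X) f y \<in> U} \<longleftrightarrow> x \<in> U"
      if "x \<in> points X" for x
      using that inj by (simp add: points_relabel)
    then show ?thesis using openin_subset[OF U] by blast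
  qed
  show "openin (ktop (relabel f X)) {y \<in> points (relabel f X). inv_into (points X) f y \<in> U}"
    unfolding openin_relabel eq using U by (auto simp: points_relabel)
  fix h assume h: "h \<in> regular X U"
  show "h \<circ> inv_into (points X) f \<in> regular (relabel f X) {y \<in> points (relabel f X). inv_into (points X) f y \<in> U}"
    unfolding regular_relabel eq
    by (rule regular_cong[OF ringed_sheaf[OF X] U h]) (use openin_subset[OF U] inj in auto)
qed

lemma kiso_relabel: "kiso X (relabel f X)"
  by (rule kisoI[OF kmorphism_relabel kmorphism_unlabel]) (use inj in \<open>auto simp: points_relabel\<close>)

lemma is_variety_relabel:
  assumes V: "is_variety X"
  shows "is_variety (relabel f X)"
proof -
  obtain \<U> where U: "finite \<U>" "\<Union>\<U> = points X"
      "\<And>U. U \<in> \<U> \<Longrightarrow> openin (ktop X) U \<and> affine_variety (induced X U)" and sep: "separated X"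
    using V unfolding is_variety_def by blast
  show ?thesis
    unfolding is_variety_def
  proof (intro conjI exI[of _ "(`) f ` \<U>"])
    show "function_sheaf (relabel f X)" by (rule ringed_sheaf[OF ringed_relabel])
    show "separated (relabel f X)"
      by (rule separated_injective[OF ringed_relabel X sep kmorphism_unlabel])
        (auto simp: points_relabel inj_on_inv_into)
    show "finite ((`) f ` \<U>)" using U(1) by simp
    show "\<Union> ((`) f ` \<U>) = points (relabel f X)" using U(2) by (auto simp: points_relabel)
    show "\<forall>U\<in>(`) f ` \<U>. openin (ktop (relabel f X)) U \<and> affine_variety (induced (relabel f X) U)"
    proof (intro ballI; elim imageE; simp only:)
      fix U assume "U \<in> \<U>"
      note Uo = U(3)[OF this]
      have Up: "U \<subseteq> points X" using Uo openin_subset by blast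
      have mem: "x \<in> points X \<Longrightarrow> x \<in> U \<longleftrightarrow> f x \<in> f ` U" for x
        using Up inj by (metis imageE imageI inj_onD subsetD)
      have "{x \<in> points X. f x \<in> f ` U} = U" using Up mem by blast
      then have "openin (ktop (relabel f X)) (f ` U)"
        unfolding openin_relabel using Uo Up by auto
      moreover have "kiso (induced X U) (induced (relabel f X) (f ` U))"
        by (rule kiso_induced[OF X ringed_relabel kmorphism_relabel kmorphism_unlabel])
          (use inj mem in \<open>auto simp: points_relabel\<close>)
      ultimately show "openin (ktop (relabel f X)) (f ` U) \<and> affine_variety (induced (relabel f X) (f ` U))"
        using affine_variety_kiso[OF kiso_sym] Uo by blast
    qed
  qed
qed

end

text \<open>
  A line is determined by the list of coordinates of its chosen representative, so the points can be
  relabelled by lists.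
\<close>

lemma representable_proj_piece:
  fixes \<psi> :: "('i, 'k::field) mpoly"
  assumes E: "finite E" and \<psi>: "mp_homogeneous d \<psi>"
    and C: "closedin (ktop (projective_space E :: (_, 'k) kspace)) C"
  shows "representable (induced (projective_space E :: (_, 'k) kspace) (C \<inter> proj_open E \<psi>))"
    (is "representable ?X")
proof -
  obtain es where es: "set es = E" using finite_list[OF E] by blast
  define f where "f l = map (homog_coords E l) es" for l :: "('i \<Rightarrow> 'k alg_closure) set"
  have r: "ringed ?X" by (rule ringed_induced[OF ringed_projective_space])
  have inj: "inj_on f (points ?X)"
  proof (rule inj_onI)
    fix l m assume lm: "l \<in> points ?X" "m \<in> points ?X" "f l = f m"
    then have "l \<in> points (projective_space E :: (_, 'k) kspace)"
      "m \<in> points (projective_space E :: (_, 'k) kspace)"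
      by (simp_all add: points_induced)
    note l = homog_coords_point[OF this(1)] and m = homog_coords_point[OF this(2)]
    have "homog_coords E l e = homog_coords E m e" for e
      using lm(3) l(1) m(1) es by (cases "e \<in> E") (auto simp: f_def coord_space_def)
    then have "homog_coords E l = homog_coords E m" by (rule ext)
    then have "line (homog_coords E l) = line (homog_coords E m)" by (rule arg_cong)
    from trans[OF trans[OF l(3)[symmetric] this] m(3)] show "l = m" .
  qed
  have "is_variety (relabel f ?X)"
    by (rule is_variety_relabel[OF r inj is_variety_proj_piece[OF E \<psi> C]])
  then have "Rep_variety (Abs_variety (relabel f ?X)) = relabel f ?X"
    by (simp add: Abs_variety_inverse)
  then show ?thesis
    unfolding representable_def
    using kiso_relabel[OF r inj] ringed_relabel[OF r inj] by metis
qed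

lemma representable_kiso: "kiso X Y \<Longrightarrow> representable Y \<Longrightarrow> representable X"
  unfolding representable_def using kiso_trans by blast

section \<open>Computing in the Grothendieck ring\<close>

lemma K0_eqI: "a - b \<in> K0_relations \<Longrightarrow> abs_K0 a = abs_K0 b"
  by (simp add: K0.abs_eq_iff K0_equiv_def ideal_generated_base)

lemma K0_class_variety:
  assumes "kiso X (Rep_variety V)"
  shows "K0_class X = abs_K0 (var_gen V)"
proof -
  let ?W = "SOME V. kiso X (Rep_variety V)"
  have "kiso X (Rep_variety ?W)" by (rule someI[of _ V]) (rule assms)
  then have "kiso (Rep_variety ?W) (Rep_variety V)" by (rule kiso_trans[OF kiso_sym assms])
  then have "var_gen ?W - var_gen V \<in> K0_relations" unfolding K0_relations_def by blast
  then show ?thesis unfolding K0_class_def by (rule K0_eqI)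
qed

text \<open>
  Isomorphic spaces are represented by the same varieties, so even the choices in the definition of
  the class coincide.
\<close>

lemma K0_class_kiso:
  assumes "kiso X Y"
  shows "K0_class X = K0_class Y"
proof -
  have "(\<lambda>V. kiso X (Rep_variety V)) = (\<lambda>V. kiso Y (Rep_variety V))"
    by (rule ext) (rule iffI[OF kiso_trans[OF kiso_sym[OF assms]] kiso_trans[OF assms]])
  then show ?thesis unfolding K0_class_def by simp
qed

lemma K0_class_scissor:
  assumes X: "ringed X" and C: "closedin (ktop X) C" and rX: "representable X"
    and rC: "representable (induced X C)" and rU: "representable (induced X (points X - C))"
  shows "K0_class X = K0_class (induced X C) + K0_class (induced X (points X - C))"
proof -
  obtain V where V: "kiso X (Rep_variety V)" "ringed (Rep_variety V)" using rX representable_def by blast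
  obtain Z where Z: "kiso (induced X C) (Rep_variety Z)" using rC representable_def by blast
  obtain U where U: "kiso (induced X (points X - C)) (Rep_variety U)" using rU representable_def by blast
  obtain \<phi> \<chi> where \<phi>: "kmorphism X (Rep_variety V) \<phi>" "kmorphism (Rep_variety V) X \<chi>"
    "\<forall>x\<in>points X. \<chi> (\<phi> x) = x" "\<forall>y\<in>points (Rep_variety V). \<phi> (\<chi> y) = y"
    using V(1) unfolding kiso_def by blast
  note iso = kiso_induced[OF X V(2) \<phi>(1,2) bspec[OF \<phi>(3)] bspec[OF \<phi>(4)]]
  let ?C = "{y \<in> points (Rep_variety V). \<chi> y \<in> C}"
  have C': "closedin (ktop (Rep_variety V)) ?C" by (rule kmorphism_closedin[OF \<phi>(2) C])
  have kC: "kiso (induced X C) (induced (Rep_variety V) ?C)"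
    by (rule iso) (use \<phi> kmorphism_point[OF \<phi>(1)] in auto)
  have kU: "kiso (induced X (points X - C)) (induced (Rep_variety V) (points (Rep_variety V) - ?C))"
    by (rule iso) (use \<phi> kmorphism_point[OF \<phi>(1)] in auto)
  note kiso_trans[OF kiso_sym[OF Z] kC] kiso_trans[OF kiso_sym[OF U] kU]
  with C' have "var_gen V - (var_gen Z + var_gen U) \<in> K0_relations"
    unfolding K0_relations_def by blast
  then have "abs_K0 (var_gen V) = abs_K0 (var_gen Z + var_gen U)" by (rule K0_eqI)
  then show ?thesis
    by (simp add: K0_class_variety[OF V(1)] K0_class_variety[OF Z] K0_class_variety[OF U]
        plus_K0.abs_eq)
qed

lemma kprod_kiso:
  assumes "ringed X" "ringed Y" "ringed X'" "ringed Y'" "kiso X X'" "kiso Y Y'"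
  shows "kiso (kprod X Y) (kprod X' Y')"
proof -
  obtain \<phi> \<chi> where 1: "kmorphism X X' \<phi>" "kmorphism X' X \<chi>" "\<forall>x\<in>points X. \<chi> (\<phi> x) = x"
    "\<forall>y\<in>points X'. \<phi> (\<chi> y) = y"
    using assms(5) unfolding kiso_def by blast
  obtain \<phi>' \<chi>' where 2: "kmorphism Y Y' \<phi>'" "kmorphism Y' Y \<chi>'" "\<forall>x\<in>points Y. \<chi>' (\<phi>' x) = x"
    "\<forall>y\<in>points Y'. \<phi>' (\<chi>' y) = y"
    using assms(6) unfolding kiso_def by blast
  show ?thesis
  proof (rule kisoI)
    show "kmorphism (kprod X Y) (kprod X' Y') (\<lambda>z. (\<phi> (fst z), \<phi>' (snd z)))"
      by (intro kmorphism_pair assms ringed_kprod kmorphism_comp[OF kmorphism_fst 1(1)]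
          kmorphism_comp[OF kmorphism_snd 2(1)])
    show "kmorphism (kprod X' Y') (kprod X Y) (\<lambda>z. (\<chi> (fst z), \<chi>' (snd z)))"
      by (intro kmorphism_pair assms ringed_kprod kmorphism_comp[OF kmorphism_fst 1(2)]
          kmorphism_comp[OF kmorphism_snd 2(2)])
  qed (use 1 2 in \<open>auto simp: points_kprod assms\<close>)
qed

lemma K0_class_product:
  assumes X: "ringed X" "representable X" and Y: "ringed Y" "representable Y"
    and P: "kiso P (kprod X Y)" "representable P"
  shows "K0_class P = K0_class X * K0_class Y"
proof -
  obtain V where V: "kiso X (Rep_variety V)" "ringed (Rep_variety V)" using X representable_def by blast
  obtain W where W: "kiso Y (Rep_variety W)" "ringed (Rep_variety W)" using Y representable_def by blast
  obtain Q where Q: "kiso P (Rep_variety Q)" using P representable_def by blast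
  have "kiso (Rep_variety Q) (kprod (Rep_variety V) (Rep_variety W))"
    using kiso_trans[OF kiso_sym[OF Q] kiso_trans[OF P(1) kprod_kiso[OF X(1) Y(1) V(2) W(2) V(1) W(1)]]] .
  then have "var_gen Q - var_gen V * var_gen W \<in> K0_relations"
    unfolding K0_relations_def by blast
  then have "abs_K0 (var_gen Q) = abs_K0 (var_gen V * var_gen W)" by (rule K0_eqI)
  then show ?thesis
    by (simp add: K0_class_variety[OF V(1)] K0_class_variety[OF W(1)] K0_class_variety[OF Q]
        times_K0.abs_eq)
qed

lemma K0_class_point:
  assumes "kiso X (affine_space ({} :: nat set))" "representable X"
  shows "K0_class X = 1"
proof -
  obtain V where V: "kiso X (Rep_variety V)" using assms representable_def by blast
  have "kiso (Rep_variety V) (affine_space ({} :: nat set))"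
    by (rule kiso_trans[OF kiso_sym[OF V] assms(1)])
  then have "var_gen V - 1 \<in> K0_relations" unfolding K0_relations_def by blast
  then have "abs_K0 (var_gen V) = abs_K0 1" by (rule K0_eqI)
  then show ?thesis by (simp add: K0_class_variety[OF V] one_K0.abs_eq)
qed

text \<open>
  Cutting the empty space along its empty closed subset yields \<open>a = a + a\<close>.
\<close>

lemma K0_class_empty:
  assumes X: "ringed X" "representable X" "points X = {}"
  shows "K0_class X = 0"
proof -
  have i: "kiso (induced X S) X" for S
    by (rule kiso_trans[OF kiso_induced_cong[OF X(1), of S "points X"] kiso_induced_points[OF X(1)]])
      (simp add: X(3))
  have "K0_class X = K0_class (induced X {}) + K0_class (induced X (points X - {}))"
    by (rule K0_class_scissor[OF X(1) closedin_empty X(2)]) (use i representable_kiso X(2) in blast)+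
  then have "K0_class X = K0_class X + K0_class X"
    by (simp only: K0_class_kiso[OF i])
  then show ?thesis by (metis add_cancel_right_left)
qed

section \<open>Stratifying complements of projective hypersurfaces\<close>

definition stratum :: "'i set \<Rightarrow> 'i set \<Rightarrow> ('i, 'k::field) mpoly \<Rightarrow> ('i \<Rightarrow> 'k alg_closure) set set" where
  "stratum E A p = proj_locus E (\<lambda>x. (\<forall>j\<in>A. x j = 0) \<and> mp_eval p x \<noteq> 0)"

abbreviation proj_complement ::
    "'i set \<Rightarrow> ('i, 'k::field) mpoly \<Rightarrow> (('i \<Rightarrow> 'k alg_closure) set, 'k) kspace" where
  "proj_complement E p \<equiv> induced (projective_space E) (stratum E {} p)"

abbreviation affine_complement ::
    "'i set \<Rightarrow> ('i, 'k::field) mpoly \<Rightarrow> ('i \<Rightarrow> 'k alg_closure, 'k) kspace" where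
  "affine_complement E p \<equiv> induced (affine_space E) {y. mp_eval p y \<noteq> 0}"

lemma ringed_stratum: "ringed (induced (projective_space E) (stratum E A p))"
  by (rule ringed_induced[OF ringed_projective_space])

lemma ringed_affine_complement: "ringed (affine_complement E p)"
  by (rule ringed_induced[OF ringed_affine_space])

context
  fixes p :: "('i, 'k::field) mpoly" and d :: nat
  assumes p: "mp_homogeneous d p"
begin

lemma stratum_iff:
  "l \<in> stratum E A p \<longleftrightarrow> l \<in> points (projective_space E :: (_, 'k) kspace) \<and>
    (\<forall>j\<in>A. homog_coords E l j = 0) \<and> mp_eval p (homog_coords E l) \<noteq> 0"
  unfolding stratum_def by (rule proj_locus_iff) (simp add: mp_eval_scale[OF p])

lemma line_in_stratum_iff:
  "x \<in> coord_space E \<Longrightarrow> x \<noteq> 0 \<Longrightarrow>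
    line x \<in> stratum E A p \<longleftrightarrow> (\<forall>j\<in>A. x j = 0) \<and> mp_eval p x \<noteq> 0"
  unfolding stratum_def by (rule line_in_proj_locus_iff) (simp_all add: mp_eval_scale[OF p])

lemma points_stratum: "points (induced (projective_space E :: (_, 'k) kspace) (stratum E A p)) = stratum E A p"
  using stratum_iff[of _ E A] by (auto simp: points_induced)

end

lemma closedin_vanishing:
  "closedin (ktop (projective_space E :: (_, 'k::field) kspace))
    {l \<in> points (projective_space E :: (_, 'k) kspace). \<forall>j\<in>A. homog_coords E l j = 0}"
proof -
  let ?P = "projective_space E :: (_, 'k) kspace"
  have "points ?P - {l \<in> points ?P. \<forall>j\<in>A. homog_coords E l j = 0} =
      (\<Union>j\<in>A. proj_open E (mp_var j))"
    using proj_open_iff[OF mp_homogeneous_var, where E=E] by auto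
  moreover have "openin (ktop ?P) (\<Union>j\<in>A. proj_open E (mp_var j))"
    by (intro openin_Union) (auto intro: openin_proj_open[OF mp_homogeneous_var])
  ultimately show ?thesis by (auto simp: closedin_def)
qed

lemma representable_stratum:
  assumes E: "finite E" and p: "mp_homogeneous d (p :: ('i, 'k::field) mpoly)"
  shows "representable (induced (projective_space E) (stratum E A p))"
proof -
  have "stratum E A p = {l \<in> points (projective_space E :: (_, 'k) kspace). \<forall>j\<in>A. homog_coords E l j = 0}
      \<inter> proj_open E p"
    using stratum_iff[OF p, of _ E A] proj_open_iff[OF p, of _ E] by auto
  then show ?thesis using representable_proj_piece[OF E p closedin_vanishing] by simp
qed

text \<open>
  The scissor relation for the coordinate hyperplane \<open>x\<^sub>i = 0\<close>. Its complement in a stratum is again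
  a stratum, with \<open>p\<close> replaced by \<open>p x\<^sub>i\<close>.
\<close>

lemma K0_stratum_split:
  assumes E: "finite E" and p: "mp_homogeneous d (p :: ('i, 'k::field) mpoly)"
  shows "K0_class (induced (projective_space E) (stratum E A p)) =
    K0_class (induced (projective_space E) (stratum E (insert i A) p)) +
    K0_class (induced (projective_space E) (stratum E A (p * mp_var i)))"
proof -
  let ?P = "projective_space E :: (_, 'k) kspace"
  let ?X = "induced ?P (stratum E A p)"
  let ?C = "{l \<in> points ?P. \<forall>j\<in>{i}. homog_coords E l j = 0}"
  note pi = mp_homogeneous_mult[OF p mp_homogeneous_var]
  note iff = stratum_iff[OF p, of _ E] stratum_iff[OF pi, of _ E] mp_eval_mult
  have XC: "closedin (ktop ?X) (points ?X \<inter> ?C)"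
    using closedin_vanishing[of E "{i}", where 'k='k]
    by (auto simp: induced_def closedin_subtopology)
  have 1: "kiso (induced ?X (points ?X \<inter> ?C)) (induced ?P (stratum E (insert i A) p))"
    by (rule kiso_trans[OF kiso_induced_induced[OF ringed_projective_space]
          kiso_induced_cong[OF ringed_projective_space]])
      (auto simp: points_stratum[OF p] iff)
  have 2: "kiso (induced ?X (points ?X - (points ?X \<inter> ?C))) (induced ?P (stratum E A (p * mp_var i)))"
    by (rule kiso_trans[OF kiso_induced_induced[OF ringed_projective_space]
          kiso_induced_cong[OF ringed_projective_space]])
      (auto simp: points_stratum[OF p] iff)
  show ?thesis
    using K0_class_scissor[OF ringed_stratum XC representable_stratum[OF E p]
        representable_kiso[OF 1 representable_stratum[OF E p]]
        representable_kiso[OF 2 representable_stratum[OF E pi]]]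
    by (simp only: K0_class_kiso[OF 1] K0_class_kiso[OF 2])
qed

lemma regular_stratum_ratio:
  assumes "\<And>l. l \<in> S \<Longrightarrow> l \<in> points (projective_space E :: (_, 'k::field) kspace) \<and> homog_coords E l i \<noteq> 0"
  shows "(\<lambda>l. homog_coords E l j / homog_coords E l i) \<in>
    regular (induced (projective_space E :: (_, 'k) kspace) S)
      (points (induced (projective_space E :: (_, 'k) kspace) S))"
  by (rule regular_induced_restrict[OF ringed_projective_space openin_proj_open[OF mp_homogeneous_var]
        regular_coordinate_ratio])
    (use assms in \<open>auto simp: proj_open_iff[OF mp_homogeneous_var]\<close>)

lemma kmorphism_to_projective_space_global:
  assumes X: "ringed X" and reg: "\<And>i. (\<lambda>y. g y i) \<in> regular X (points X)"
    and g: "\<And>y. y \<in> points X \<Longrightarrow> g y \<in> coord_space E \<and> g y \<noteq> 0"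
  shows "kmorphism X (projective_space E) (\<lambda>y. line (g y))"
  by (rule kmorphism_to_projective_space[OF X], rule exI[of _ "points X"], rule exI[of _ g])
    (use reg g in auto)

text \<open>
  That only the variables in \<open>E\<close> matter is expressed through values, which is all that the geometry
  sees and is immediate for determinants of forms over \<open>E\<close>.
\<close>

definition depends_on :: "'i set \<Rightarrow> ('i, 'k::field) mpoly \<Rightarrow> bool" where
  "depends_on E p \<longleftrightarrow> (\<forall>x y. (\<forall>i\<in>E. x i = y i) \<longrightarrow> mp_eval p x = mp_eval p y)"

lemma depends_onD: "depends_on E p \<Longrightarrow> (\<And>i. i \<in> E \<Longrightarrow> x i = y i) \<Longrightarrow> mp_eval p x = mp_eval p y"
  unfolding depends_on_def by blast

text \<open>
  Dehomogenising at a new variable \<open>x\<^sub>i\<close> identifies the affine cone over a hypersurface complement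
  with a projective hypersurface complement.
\<close>

lemma affine_complement_cone:
  fixes p :: "('i, 'k::field) mpoly"
  assumes i: "i \<notin> E" and p: "mp_homogeneous d p" "depends_on E p"
  shows "kiso (affine_complement E p) (proj_complement (insert i E) (p * mp_var i))"
proof -
  let ?P = "projective_space (insert i E) :: (_, 'k) kspace" and ?A = "affine_space E :: (_, 'k) kspace"
  let ?X = "affine_complement E p" and ?Y = "proj_complement (insert i E) (p * mp_var i)"
  note pi = mp_homogeneous_mult[OF p(1) mp_homogeneous_var, of i]
  define x where "x l = homog_coords (insert i E) l" for l :: "('i \<Rightarrow> 'k alg_closure) set"
  define \<phi> where "\<phi> y = y(i := 1)" for y :: "'i \<Rightarrow> 'k alg_closure"
  define \<chi> where "\<chi> l = (\<lambda>j. if j \<in> E then x l j / x l i else 0)" for l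
  have pX: "points ?X = {y \<in> coord_space E. mp_eval p y \<noteq> 0}" by (auto simp: points_induced)
  have pY: "points ?Y = stratum (insert i E) {} (p * mp_var i)" by (rule points_stratum[OF pi])
  have Yl: "x l \<in> coord_space (insert i E)" "x l \<noteq> 0" "line (x l) = l" "x l i \<noteq> 0" "mp_eval p (x l) \<noteq> 0"
      "l \<in> points ?P"
    if "l \<in> points ?Y" for l
    using that stratum_iff[OF pi] homog_coords_point[of l "insert i E"]
    unfolding pY by (auto simp: x_def mp_eval_mult)
  have chi_eq: "\<phi> (\<chi> l) = (\<lambda>j. (1 / x l i) * x l j)" if "l \<in> points ?Y" for l
    using Yl[OF that] i by (auto simp: \<phi>_def \<chi>_def coord_space_def fun_eq_iff)
  have phi0: "\<phi> y \<noteq> 0" for y by (auto simp: \<phi>_def fun_eq_iff intro: exI[of _ i])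
  have phiE: "\<phi> y \<in> coord_space (insert i E)" if "y \<in> coord_space E" for y
    using that by (auto simp: \<phi>_def coord_space_def)
  have pphi: "mp_eval p (\<phi> y) = mp_eval p y" for y
    by (rule depends_onD[OF p(2)]) (use i in \<open>auto simp: \<phi>_def\<close>)
  have pchi: "mp_eval p (\<chi> l) \<noteq> 0" if "l \<in> points ?Y" for l
    using Yl(4,5)[OF that] pphi[of "\<chi> l"] unfolding chi_eq[OF that] mp_eval_scale[OF p(1)] by auto
  have chiE: "\<chi> l \<in> coord_space E" for l by (auto simp: \<chi>_def coord_space_def)
  show ?thesis
  proof (rule kisoI)
    show "kmorphism ?X ?Y (\<lambda>y. line (\<phi> y))"
    proof (rule kmorphism_corestrict[OF ringed_sheaf[OF ringed_affine_complement]
          kmorphism_to_projective_space_global[OF ringed_affine_complement]])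
      show "(\<lambda>y. \<phi> y j) \<in> regular ?X (points ?X)" for j
      proof (cases "j = i")
        case True
        then show ?thesis
          using regular_one[OF ringed_affine_complement openin_topspace, of E p] by (simp add: \<phi>_def)
      next
        case False
        have "(\<lambda>y. y j) \<in> regular ?X (points ?X)"
          by (rule kmorphism_regular_on[OF kmorphism_inclusion ringed_sheaf[OF ringed_affine_complement]
                openin_topspace _ openin_topspace])
            (use regular_coordinate[of j E] in \<open>auto simp: points_induced\<close>)
        then show ?thesis using False by (simp add: \<phi>_def)
      qed
      fix y assume y: "y \<in> points ?X"
      show "\<phi> y \<in> coord_space (insert i E) \<and> \<phi> y \<noteq> 0" using y phiE phi0 by (auto simp: pX)
      show "line (\<phi> y) \<in> stratum (insert i E) {} (p * mp_var i)"
        using y line_in_stratum_iff[OF pi phiE phi0] pphi by (auto simp: pX mp_eval_mult \<phi>_def)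
    qed
    show "kmorphism ?Y ?X \<chi>"
    proof (rule kmorphism_corestrict[OF ringed_sheaf[OF ringed_stratum]
          kmorphism_to_affine_space[OF ringed_stratum]])
      fix j assume "j \<in> E"
      then show "(\<lambda>l. \<chi> l j) \<in> regular ?Y (points ?Y)"
        using regular_stratum_ratio[of "stratum (insert i E) {} (p * mp_var i)" "insert i E" i j] Yl(4,6)
        by (simp add: \<chi>_def x_def pY)
    qed (use pchi chiE in auto)
    fix y assume y: "y \<in> points ?X"
    then have yE: "y \<in> coord_space E" by (simp add: pX)
    obtain c where c: "c \<noteq> 0" "x (line (\<phi> y)) = (\<lambda>j. c * \<phi> y j)"
      unfolding x_def by (rule homog_coords_line[OF phiE[OF yE] phi0])
    show "\<chi> (line (\<phi> y)) = y"
      using c yE i by (auto simp: \<chi>_def \<phi>_def coord_space_def fun_eq_iff)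
  next
    fix l assume l: "l \<in> points ?Y"
    show "line (\<phi> (\<chi> l)) = l"
      unfolding chi_eq[OF l] using line_scale[of "1 / x l i" "x l"] Yl[OF l] by simp
  qed
qed

lemma representable_affine_complement:
  assumes "finite E" "i \<notin> E" "mp_homogeneous d p" "depends_on E p"
  shows "representable (affine_complement E p)"
  by (rule representable_kiso[OF affine_complement_cone[OF assms(2-4)] representable_stratum])
    (use assms mp_homogeneous_mult[OF assms(3) mp_homogeneous_var] in auto)

text \<open>
  Over the chart \<open>x\<^sub>i \<noteq> 0\<close> of the first factor every line has a unique representative with
  \<open>x\<^sub>i = 1\<close>. Its coordinates in \<open>E\<close> and in \<open>F\<close> vary independently, since \<open>p\<close> and \<open>q\<close> involve
  disjoint sets of variables; the former form a point of the base and the latter a point of the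
  affine complement of \<open>q\<close>.
\<close>

lemma join_trivial_over_chart:
  fixes p q :: "('i, 'k::field) mpoly"
  assumes disj: "E \<inter> F = {}" and i: "i \<in> E" and A: "A \<subseteq> E"
    and p: "mp_homogeneous d p" "depends_on E p" and q: "mp_homogeneous d' q" "depends_on F q"
  shows "kiso (induced (projective_space (E \<union> F)) (stratum (E \<union> F) A (p * q * mp_var i)))
    (kprod (induced (projective_space E) (stratum E A (p * mp_var i))) (affine_complement F q))"
proof -
  let ?G = "E \<union> F"
  let ?X = "induced (projective_space ?G) (stratum ?G A (p * q * mp_var i))"
  let ?Y = "induced (projective_space E) (stratum E A (p * mp_var i))"
  let ?F = "affine_complement F q"
  note pi = mp_homogeneous_mult[OF p(1) mp_homogeneous_var, of i]
  note pqi = mp_homogeneous_mult[OF mp_homogeneous_mult[OF p(1) q(1)] mp_homogeneous_var, of i]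
  note rX = ringed_stratum[of ?G A "p * q * mp_var i"] and rY = ringed_stratum[of E A "p * mp_var i"]
    and rF = ringed_affine_complement[of F q]
  note rYF = ringed_kprod[OF rY rF]
  define x where "x l = homog_coords ?G l" for l :: "('i \<Rightarrow> 'k alg_closure) set"
  define y where "y l = homog_coords E l" for l :: "('i \<Rightarrow> 'k alg_closure) set"
  \<comment> \<open>\<open>a\<close> and \<open>b\<close> are the two parts of the representative with \<open>x\<^sub>i = 1\<close>, and \<open>c\<close> reassembles it.\<close>
  define a where "a l = (\<lambda>j. if j \<in> E then x l j / x l i else 0)" for l
  define b where "b l = (\<lambda>j. if j \<in> F then x l j / x l i else 0)" for l
  define c where "c z = (\<lambda>j. if j \<in> E then y (fst z) j / y (fst z) i else snd z j)"
    for z :: "('i \<Rightarrow> 'k alg_closure) set \<times> ('i \<Rightarrow> 'k alg_closure)"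
  have pX: "points ?X = stratum ?G A (p * q * mp_var i)" by (rule points_stratum[OF pqi])
  have pY: "points ?Y = stratum E A (p * mp_var i)" by (rule points_stratum[OF pi])
  have pF: "points ?F = {y \<in> coord_space F. mp_eval q y \<noteq> 0}" by (auto simp: points_induced)
  have Xl: "x l \<in> coord_space ?G" "line (x l) = l" "x l i \<noteq> 0" "mp_eval p (x l) \<noteq> 0" "mp_eval q (x l) \<noteq> 0"
      "\<forall>j\<in>A. x l j = 0" "l \<in> points (projective_space ?G :: (_, 'k) kspace)"
    if "l \<in> points ?X" for l
    using that stratum_iff[OF pqi] homog_coords_point[of l ?G]
    unfolding pX by (auto simp: x_def mp_eval_mult)
  have Yl: "y l \<in> coord_space E" "line (y l) = l" "y l i \<noteq> 0" "mp_eval p (y l) \<noteq> 0"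
      "\<forall>j\<in>A. y l j = 0" "l \<in> points (projective_space E :: (_, 'k) kspace)"
    if "l \<in> points ?Y" for l
    using that stratum_iff[OF pi] homog_coords_point[of l E]
    unfolding pY by (auto simp: y_def mp_eval_mult)
  have iF: "i \<notin> F" using i disj by blast
  have pa: "mp_eval p (a l) \<noteq> 0" "mp_eval q (b l) \<noteq> 0" if "l \<in> points ?X" for l
  proof -
    have "mp_eval p (a l) = mp_eval p (\<lambda>j. (1 / x l i) * x l j)"
      by (rule depends_onD[OF p(2)]) (simp add: a_def)
    then show "mp_eval p (a l) \<noteq> 0" unfolding mp_eval_scale[OF p(1)] using Xl[OF that] by simp
    have "mp_eval q (b l) = mp_eval q (\<lambda>j. (1 / x l i) * x l j)"
      by (rule depends_onD[OF q(2)]) (simp add: b_def)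
    then show "mp_eval q (b l) \<noteq> 0" unfolding mp_eval_scale[OF q(1)] using Xl[OF that] by simp
  qed
  have ai: "a l i = 1" if "l \<in> points ?X" for l using Xl[OF that] i by (simp add: a_def)
  have aE: "a l \<in> coord_space E" and bF: "b l \<in> coord_space F" for l
    by (auto simp: a_def b_def coord_space_def)
  have nz: "v \<noteq> 0" if "v i = 1" for v :: "'i \<Rightarrow> 'k alg_closure"
    using that by auto
  have ratio: "(\<lambda>l. x l j / x l i) \<in> regular ?X (points ?X)" for j
    unfolding x_def by (rule regular_stratum_ratio) (use Xl in \<open>auto simp: pX x_def\<close>)
  have ratioY: "(\<lambda>l. y l j / y l i) \<in> regular ?Y (points ?Y)" for j
    unfolding y_def by (rule regular_stratum_ratio) (use Yl in \<open>auto simp: pY y_def\<close>)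
  have coordF: "(\<lambda>y. y j) \<in> regular ?F (points ?F)" for j
    by (rule kmorphism_regular_on[OF kmorphism_inclusion ringed_sheaf[OF rF]
          openin_topspace _ openin_topspace])
      (use regular_coordinate[of j F] in \<open>auto simp: points_induced\<close>)
  have pYF: "points (kprod ?Y ?F) = points ?Y \<times> points ?F" by (rule points_kprod[OF rY rF])
  have ci: "c z i = 1" if "z \<in> points (kprod ?Y ?F)" for z
    using that Yl[of "fst z"] i by (auto simp: c_def pYF)
  have cG: "c z \<in> coord_space ?G" if "z \<in> points (kprod ?Y ?F)" for z
    using that by (auto simp: c_def coord_space_def pYF pF)
  show ?thesis
  proof (rule kisoI)
    show "kmorphism ?X (kprod ?Y ?F) (\<lambda>l. (line (a l), b l))"
    proof (rule kmorphism_pair[OF rY rF rX])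
      show "kmorphism ?X ?Y (\<lambda>l. line (a l))"
      proof (rule kmorphism_corestrict[OF ringed_sheaf[OF rX] kmorphism_to_projective_space_global[OF rX]])
        show "(\<lambda>l. a l j) \<in> regular ?X (points ?X)" for j
          using ratio[of j] regular_zero[OF rX openin_topspace]
          by (cases "j \<in> E") (simp_all add: a_def)
        fix l assume l: "l \<in> points ?X"
        show "a l \<in> coord_space E \<and> a l \<noteq> 0" using aE nz ai[OF l] by blast
        show "line (a l) \<in> stratum E A (p * mp_var i)"
          using line_in_stratum_iff[OF pi aE nz[of "a l", OF ai[OF l]], of A] pa(1)[OF l] ai[OF l] Xl(6)[OF l]
          by (auto simp: mp_eval_mult a_def)
      qed
      show "kmorphism ?X ?F b"
      proof (rule kmorphism_corestrict[OF ringed_sheaf[OF rX] kmorphism_to_affine_space[OF rX bF]])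
        show "(\<lambda>l. b l j) \<in> regular ?X (points ?X)" if "j \<in> F" for j
          using ratio[of j] that by (simp add: b_def)
      qed (use pa(2) in simp)
    qed
    show "kmorphism (kprod ?Y ?F) ?X (\<lambda>z. line (c z))"
    proof (rule kmorphism_corestrict[OF ringed_sheaf[OF rYF] kmorphism_to_projective_space_global[OF rYF]])
      show "(\<lambda>z. c z j) \<in> regular (kprod ?Y ?F) (points (kprod ?Y ?F))" for j
      proof (cases "j \<in> E")
        case True
        have "(\<lambda>z. y (fst z) j / y (fst z) i) \<in> regular (kprod ?Y ?F) (points (kprod ?Y ?F))"
          by (rule kmorphism_regular_on[OF kmorphism_fst[OF rY rF] ringed_sheaf[OF rYF]
                openin_topspace ratioY openin_topspace])
            (auto simp: pYF)
        then show ?thesis using True by (simp add: c_def)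
      next
        case False
        have "(\<lambda>z. snd z j) \<in> regular (kprod ?Y ?F) (points (kprod ?Y ?F))"
          by (rule kmorphism_regular_on[OF kmorphism_snd[OF rY rF] ringed_sheaf[OF rYF]
                openin_topspace coordF openin_topspace])
            (auto simp: pYF)
        then show ?thesis using False by (simp add: c_def)
      qed
      fix z assume z: "z \<in> points (kprod ?Y ?F)"
      show "c z \<in> coord_space ?G \<and> c z \<noteq> 0" using cG[OF z] nz[of "c z", OF ci[OF z]] by blast
      have zY: "fst z \<in> points ?Y" and zF: "snd z \<in> points ?F" using z by (auto simp: pYF)
      have "mp_eval p (c z) = mp_eval p (\<lambda>j. (1 / y (fst z) i) * y (fst z) j)"
        by (rule depends_onD[OF p(2)]) (simp add: c_def)
      then have "mp_eval p (c z) \<noteq> 0"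
        unfolding mp_eval_scale[OF p(1)] using Yl[OF zY] by simp
      moreover have "mp_eval q (c z) = mp_eval q (snd z)"
        by (rule depends_onD[OF q(2)]) (use disj in \<open>auto simp: c_def\<close>)
      ultimately show "line (c z) \<in> stratum ?G A (p * q * mp_var i)"
        using line_in_stratum_iff[OF pqi cG[OF z] nz[of "c z", OF ci[OF z]], of A] zF ci[OF z] Yl(5)[OF zY] A
        by (auto simp: mp_eval_mult pF c_def)
    qed
    fix l assume l: "l \<in> points ?X"
    obtain t where t: "t \<noteq> 0" "y (line (a l)) = (\<lambda>j. t * a l j)"
      unfolding y_def by (rule homog_coords_line[OF aE nz[of "a l", OF ai[OF l]]])
    have "c (line (a l), b l) = (\<lambda>j. (1 / x l i) * x l j)"
    proof
      fix j
      show "c (line (a l), b l) j = (1 / x l i) * x l j"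
        using t ai[OF l] Xl(1)[OF l] by (auto simp: c_def a_def b_def coord_space_def)
    qed
    then show "line (c (line (a l), b l)) = l"
      using line_scale[of "1 / x l i" "x l"] Xl[OF l] by simp
  next
    fix z assume z: "z \<in> points (kprod ?Y ?F)"
    then have zY: "fst z \<in> points ?Y" and zF: "snd z \<in> coord_space F" by (auto simp: pYF pF)
    obtain t where t: "t \<noteq> 0" "x (line (c z)) = (\<lambda>j. t * c z j)"
      unfolding x_def by (rule homog_coords_line[OF cG[OF z] nz[of "c z", OF ci[OF z]]])
    have "a (line (c z)) = (\<lambda>j. (1 / y (fst z) i) * y (fst z) j)"
    proof
      fix j show "a (line (c z)) j = (1 / y (fst z) i) * y (fst z) j"
        using t ci[OF z] Yl(1)[OF zY] by (auto simp: a_def c_def coord_space_def)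
    qed
    then have "line (a (line (c z))) = fst z"
      using line_scale[of "1 / y (fst z) i" "y (fst z)"] Yl[OF zY] by simp
    moreover have "b (line (c z)) = snd z"
    proof
      fix j show "b (line (c z)) j = snd z j"
        using t ci[OF z] zF disj by (auto simp: b_def c_def coord_space_def)
    qed
    ultimately show "(line (a (line (c z))), b (line (c z))) = z" by simp
  qed
qed

lemma mp_eval_at_zero:
  fixes p :: "('a, 'b::field) mpoly"
  assumes "mp_homogeneous d p" "d > 0" "\<And>i. x i = 0"
  shows "mp_eval p x = 0"
proof -
  have "x = (\<lambda>i. 0 * x i)" using assms(3) by auto
  then have "mp_eval p x = 0 ^ d * mp_eval p x" using mp_eval_scale[OF assms(1), of 0 x] by metis
  moreover have "(0 :: 'b alg_closure) ^ d = 0" using assms(2) by simp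
  ultimately show ?thesis by simp
qed

text \<open>
  The projection to the coordinates in \<open>E\<close> makes the complement of \<open>p q\<close> a bundle over the complement
  of \<open>p\<close> with fibre the affine complement of \<open>q\<close>. The bundle need not be trivial, but it is so over
  every chart. Peeling off one coordinate hyperplane after the other, the classes of total space and
  base therefore change in the same way, and both vanish once all coordinates in \<open>E\<close> are zero,
  because a homogeneous polynomial of positive degree vanishes at the origin.
\<close>

theorem K0_class_join:
  fixes p q :: "('i, 'k::field) mpoly"
  assumes fin: "finite E" "finite F" and disj: "E \<inter> F = {}" and E: "E \<noteq> {}"
    and p: "mp_homogeneous d p" "d > 0" "depends_on E p"
    and q: "mp_homogeneous d' q" "depends_on F q"
  shows "K0_class (proj_complement (E \<union> F) (p * q)) =
    K0_class (proj_complement E p) * K0_class (affine_complement F q)"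
proof -
  let ?G = "E \<union> F"
  let ?X = "\<lambda>A. induced (projective_space ?G) (stratum ?G A (p * q))"
  let ?Y = "\<lambda>A. induced (projective_space E) (stratum E A p)"
  note pq = mp_homogeneous_mult[OF p(1) q(1)]
  have finG: "finite ?G" using fin by simp
  obtain i0 where "i0 \<in> E" using E by blast
  then have rF: "representable (affine_complement F q)"
    using representable_affine_complement[OF fin(2) _ q, of i0] disj by blast
  \<comment> \<open>The coordinates in \<open>B\<close> are still free; all others in \<open>E\<close> are already zero.\<close>
  have "K0_class (?X (E - B)) = K0_class (?Y (E - B)) * K0_class (affine_complement F q)"
    if "finite B" "B \<subseteq> E" for B
    using that
  proof (induction B rule: finite_induct)
    case empty
    have "mp_eval p x = 0" if "\<forall>j\<in>E. x j = 0" for x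
    proof -
      have "mp_eval p x = mp_eval p (\<lambda>_. 0)"
        by (rule depends_onD[OF p(3)]) (use that in simp)
      then show ?thesis using mp_eval_at_zero[OF p(1,2)] by simp
    qed
    then have "stratum ?G E (p * q) = {}" "stratum E E p = {}"
      unfolding stratum_def by (auto simp: proj_locus_def mp_eval_mult)
    then have "points (?X E) = {}" "points (?Y E) = {}"
      unfolding points_stratum[OF pq] points_stratum[OF p(1)] by blast+
    then have "K0_class (?X E) = 0" "K0_class (?Y E) = 0"
      using K0_class_empty[OF ringed_stratum representable_stratum[OF finG pq]]
        K0_class_empty[OF ringed_stratum representable_stratum[OF fin(1) p(1)]] by blast+
    then show ?case by simp
  next
    case (insert i B)
    let ?A = "E - insert i B"
    have i: "i \<in> E" and B: "B \<subseteq> E" and eq: "insert i ?A = E - B" using insert by auto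
    note pi = mp_homogeneous_mult[OF p(1) mp_homogeneous_var, of i]
    note pqi = mp_homogeneous_mult[OF pq mp_homogeneous_var, of i]
    have "K0_class (induced (projective_space ?G) (stratum ?G ?A (p * q * mp_var i))) =
        K0_class (induced (projective_space E) (stratum E ?A (p * mp_var i))) *
        K0_class (affine_complement F q)"
      by (rule K0_class_product[OF ringed_stratum representable_stratum[OF fin(1) pi]
            ringed_affine_complement rF join_trivial_over_chart[OF disj i _ p(1,3) q]
            representable_stratum[OF finG pqi]]) auto
    moreover have "K0_class (?X (insert i ?A)) = K0_class (?Y (insert i ?A)) * K0_class (affine_complement F q)"
      unfolding eq by (rule insert.IH[OF B])
    ultimately show ?case
      unfolding K0_stratum_split[OF finG pq, of ?A i] K0_stratum_split[OF fin(1) p(1), of ?A i]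
      by (simp only: distrib_right)
  qed
  from this[OF fin(1) subset_refl] show ?thesis by simp
qed

section \<open>The affine line and the torus\<close>


lemma kiso_affine_line:
  fixes P :: "'k::field alg_closure \<Rightarrow> bool"
  shows "kiso (induced (affine_space {e}) {y. P (y e)}) (induced affine_line {x. P (x 0)})"
proof -
  have l: "affine_line = affine_space {0}"
    unfolding affine_line_def by (simp add: lessThan_Suc)
  have coord: "y = (\<lambda>j. if j = a then y a else 0)" if "y \<in> coord_space {a}"
    for a :: 'b and y :: "'b \<Rightarrow> 'k alg_closure"
    using that by (auto simp: coord_space_def fun_eq_iff)
  show ?thesis
    unfolding l
  proof (rule kiso_induced[OF ringed_affine_space ringed_affine_space])
    show "kmorphism (affine_space {e} :: (_, 'k) kspace) (affine_space {0})
        (\<lambda>x j. if j = (0 :: nat) then x e else 0)"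
      by (rule kmorphism_to_affine_space[OF ringed_affine_space])
        (use regular_coordinate[of e "{e}", where 'k='k] in \<open>auto simp: coord_space_def\<close>)
    show "kmorphism (affine_space {0} :: (_, 'k) kspace) (affine_space {e})
        (\<lambda>x j. if j = e then x (0 :: nat) else 0)"
    proof (rule kmorphism_to_affine_space[OF ringed_affine_space])
      show "(\<lambda>x. if i = e then x (0 :: nat) else 0) \<in>
          regular (affine_space {0} :: (_, 'k) kspace) (points (affine_space {0} :: (_, 'k) kspace))"
        if "i \<in> {e}" for i
        using regular_coordinate[of "0 :: nat" "{0}", where 'k='k] that by simp
    qed (auto simp: coord_space_def)
  qed (auto simp: coord[symmetric])
qed

lemma K0_class_line_complement: "K0_class (affine_complement {e} (mp_var e :: ('i, 'k::field) mpoly)) = K0_T"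
  unfolding K0_T_def
  using K0_class_kiso[OF kiso_affine_line[of e "\<lambda>t. t \<noteq> 0"]] by simp

lemma K0_class_affine_line: "K0_class (affine_complement {e} (1 :: ('i, 'k::field) mpoly)) = K0_L"
proof -
  have "kiso (induced affine_line {x. True}) (affine_line :: (_, 'k) kspace)"
    unfolding affine_line_def
    by (rule kiso_trans[OF kiso_induced_cong[OF ringed_affine_space, of _ _ "coord_space {..<1}"]])
      (use kiso_induced_points[OF ringed_affine_space, of "{..<1 :: nat}"] in auto)
  from kiso_trans[OF kiso_affine_line[of e "\<lambda>_. True"] this] show ?thesis
    unfolding K0_L_def by (intro K0_class_kiso) simp
qed

lemma depends_on_var: "i \<in> E \<Longrightarrow> depends_on E (mp_var i)"
  by (simp add: depends_on_def)

lemma depends_on_one: "depends_on E 1"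
  by (simp add: depends_on_def)

text \<open>
  The affine line is cut into the origin, a point of class \<open>1\<close>, and the torus.
\<close>

lemma K0_L_eq: "(K0_L :: 'k::field K0) = 1 + K0_T"
proof -
  let ?A = "affine_space {0} :: (nat \<Rightarrow> 'k alg_closure, 'k) kspace"
  let ?X = "affine_complement {0} (1 :: (nat, 'k) mpoly)"
  let ?C = "{y \<in> points ?X. y 0 = 0}"
  have rep: "representable (affine_complement F q)"
    if "mp_homogeneous d q" "depends_on F q" "finite F" for F d and q :: "(nat, 'k) mpoly"
    using representable_affine_complement[OF that(3) _ that(1,2)] ex_new_if_finite[OF _ that(3)] by auto
  note r = ringed_affine_complement[of "{0}" "1 :: (nat, 'k) mpoly"]
  have reg: "(\<lambda>y. y j) \<in> regular ?X (points ?X)" for j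
    by (rule kmorphism_regular_on[OF kmorphism_inclusion ringed_sheaf[OF r]
          openin_topspace _ openin_topspace])
      (use regular_coordinate[of j "{0}"] in \<open>auto simp: points_induced\<close>)
  have C: "closedin (ktop ?X) ?C" by (rule ringed_closedin_zero[OF r reg])
  have zero: "x i = 0" if "x \<in> points (induced ?X ?C)" for x i
    using that by (cases "i = 0") (auto simp: points_induced coord_space_def)
  have pt: "kiso (induced ?X ?C) (affine_space ({} :: nat set) :: (_, 'k) kspace)"
  proof (rule kisoI)
    show "kmorphism (induced ?X ?C) (affine_space {}) (\<lambda>x. x)"
      by (rule kmorphism_to_affine_space[OF ringed_induced[OF r]])
        (use zero in \<open>auto simp: coord_space_def\<close>)
    show "kmorphism (affine_space {}) (induced ?X ?C) (\<lambda>x. x)"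
    proof (intro kmorphism_corestrict ringed_sheaf ringed_affine_space kmorphism_to_affine_space)
      show "(\<lambda>x. x i) \<in> regular (affine_space {} :: (nat \<Rightarrow> _, 'k) kspace)
          (points (affine_space {} :: (nat \<Rightarrow> _, 'k) kspace))" for i
        using regular_coordinate[of i "{}"] by simp
    qed (auto simp: points_induced coord_space_def)
  qed (auto simp: points_induced coord_space_def)
  have pt': "kiso (induced ?X ?C) (affine_complement ({} :: nat set) (1 :: (nat, 'k) mpoly))"
    by (rule kiso_trans[OF pt kiso_sym[OF kiso_trans[OF
              kiso_induced_cong[OF ringed_affine_space, of _ _ "coord_space {}"]]]])
      (use kiso_induced_points[OF ringed_affine_space, of "{}"] in auto)
  have U: "kiso (induced ?X (points ?X - ?C)) (affine_complement {0} (mp_var 0 :: (nat, 'k) mpoly))"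
    by (rule kiso_trans[OF kiso_induced_induced[OF ringed_affine_space]
          kiso_induced_cong[OF ringed_affine_space]])
      (auto simp: points_induced)
  note rC = representable_kiso[OF pt' rep[OF mp_homogeneous_one depends_on_one finite.emptyI]]
  have rU: "representable (induced ?X (points ?X - ?C))"
    by (rule representable_kiso[OF U rep[OF mp_homogeneous_var depends_on_var]]) auto
  have "K0_class ?X = K0_class (induced ?X ?C) + K0_class (induced ?X (points ?X - ?C))"
    by (rule K0_class_scissor[OF r C rep[OF mp_homogeneous_one depends_on_one] rC rU]) simp
  then show ?thesis
    by (simp only: K0_class_affine_line K0_class_point[OF pt rC] K0_class_kiso[OF U] K0_class_line_complement)
qed

text \<open>
  The cone is the complement of \<open>p x\<^sub>i\<close> for a new variable, to which the join formula applies with the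
  torus as fibre.
\<close>

lemma K0_class_cone:
  fixes p :: "('i, 'k::field) mpoly"
  assumes "finite E" "E \<noteq> {}" "i \<notin> E" and p: "mp_homogeneous d p" "d > 0" "depends_on E p"
  shows "K0_class (affine_complement E p) = K0_class (proj_complement E p) * K0_T"
proof -
  have "K0_class (affine_complement E p) = K0_class (proj_complement (E \<union> {i}) (p * mp_var i))"
    using K0_class_kiso[OF affine_complement_cone[OF assms(3) p(1,3)]] by simp
  also have "\<dots> = K0_class (proj_complement E p) * K0_class (affine_complement {i} (mp_var i :: (_, 'k) mpoly))"
    by (rule K0_class_join[OF assms(1) _ _ assms(2) p mp_homogeneous_var depends_on_var])
      (use assms(3) in auto)
  finally show ?thesis by (simp only: K0_class_line_complement)
qed

text \<open>
  The shear \<open>x\<^sub>f \<mapsto> x\<^sub>f + a x\<^sub>e\<close> is a linear automorphism of projective space, hence identifies the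
  complements of two hypersurfaces that it maps to one another.
\<close>

lemma kiso_shear:
  fixes p q :: "('i, 'k::field) mpoly"
  assumes ef: "e \<in> E" "f \<in> E" "e \<noteq> f" and p: "mp_homogeneous d p" and q: "mp_homogeneous d' q"
    and pq: "\<And>x. x \<in> coord_space E \<Longrightarrow>
      mp_eval p x \<noteq> 0 \<longleftrightarrow> mp_eval q (x(f := x f + to_ac a * x e)) \<noteq> 0"
  shows "kiso (proj_complement E p) (proj_complement E q)"
proof -
  let ?P = "projective_space E :: (_, 'k) kspace"
  \<comment> \<open>Keeping \<open>a\<close> as a parameter provides the inverse \<open>T (- a)\<close> of \<open>T a\<close> by the same construction.\<close>
  define T where "T a x = x(f := x f + to_ac a * x e)" for a and x :: "'i \<Rightarrow> 'k alg_closure"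
  define \<phi> where "\<phi> a l = line (T a (homog_coords E l))" for a l
  have TT: "T (- a) (T a x) = x" for a x using ef by (auto simp: T_def fun_eq_iff)
  have TT': "T a (T (- a) x) = x" for a x using TT[of "- a" x] by simp
  have T0: "T a x \<noteq> 0" if "x \<noteq> 0" for a x
  proof
    assume "T a x = 0"
    then have "T (- a) (T a x) = T (- a) 0" by simp
    also have "\<dots> = 0" by (auto simp: T_def fun_eq_iff)
    finally have "T (- a) (T a x) = 0" .
    with that show False by (simp add: TT)
  qed
  have TE: "T a x \<in> coord_space E" if "x \<in> coord_space E" for a x
    using that ef by (auto simp: T_def coord_space_def)
  have Tscale: "T a (\<lambda>i. c * x i) = (\<lambda>i. c * T a x i)" for a c x
    by (auto simp: T_def fun_eq_iff algebra_simps)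
  have m: "kmorphism ?P ?P (\<phi> a)" for a
  proof (rule kmorphism_to_projective_space[OF ringed_projective_space])
    fix l assume l: "l \<in> points ?P"
    obtain i where i: "i \<in> E" "homog_coords E l i \<noteq> 0"
      by (rule nonzero_coordinate[OF homog_coords_point(1,2)[OF l]])
    let ?U = "proj_open E (mp_var i) :: ('i \<Rightarrow> 'k alg_closure) set set"
    let ?g = "\<lambda>l. T a (\<lambda>j. homog_coords E l j / homog_coords E l i)"
    have o: "openin (ktop ?P) ?U" by (rule openin_proj_open[OF mp_homogeneous_var])
    note r = ringed_projective_space[of E]
    have "(\<lambda>l. ?g l j) \<in> regular ?P ?U" for j
      using regular_coordinate_ratio[of E j i]
        regular_add[OF r o regular_coordinate_ratio[of E f i]
          regular_mult[OF r o regular_const[OF r o, of a] regular_coordinate_ratio[of E e i]]]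
      by (cases "j = f") (simp_all add: T_def)
    moreover have "?g m \<in> coord_space E \<and> ?g m \<noteq> 0 \<and> \<phi> a m = line (?g m)" if "m \<in> ?U" for m
    proof -
      have m: "m \<in> points ?P" "homog_coords E m i \<noteq> 0"
        using that proj_open_iff[OF mp_homogeneous_var, of m E i] by auto
      have eq: "(\<lambda>j. homog_coords E m j / homog_coords E m i) =
          (\<lambda>j. (1 / homog_coords E m i) * homog_coords E m j)" by simp
      have g: "?g m = (\<lambda>j. (1 / homog_coords E m i) * T a (homog_coords E m) j)"
        unfolding eq Tscale ..
      have "T a (homog_coords E m) \<in> coord_space E" "T a (homog_coords E m) \<noteq> 0"
        using TE T0 homog_coords_point[OF m(1)] by auto
      then show ?thesis
        unfolding g using m(2) line_scale[of "1 / homog_coords E m i" "T a (homog_coords E m)"]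
        by (auto simp: \<phi>_def coord_space_def fun_eq_iff)
    qed
    ultimately show "\<exists>U g. openin (ktop ?P) U \<and> l \<in> U \<and> (\<forall>i. (\<lambda>y. g y i) \<in> regular ?P U) \<and>
      (\<forall>y\<in>U. g y \<in> coord_space E \<and> g y \<noteq> 0 \<and> \<phi> a y = line (g y))"
      by (intro exI[of _ ?U] exI[of _ ?g])
        (use o l i proj_open_iff[OF mp_homogeneous_var, of l E i] in auto)
  qed
  have inv: "\<phi> (- a) (\<phi> a l) = l" if l: "l \<in> points ?P" for a l
  proof -
    have h: "T a (homog_coords E l) \<in> coord_space E" "T a (homog_coords E l) \<noteq> 0"
      using TE T0 homog_coords_point[OF l] by auto
    obtain c where c: "c \<noteq> 0" "homog_coords E (\<phi> a l) = (\<lambda>i. c * T a (homog_coords E l) i)"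
      unfolding \<phi>_def by (rule homog_coords_line[OF h])
    have "\<phi> (- a) (\<phi> a l) = line (T (- a) (\<lambda>i. c * T a (homog_coords E l) i))"
      by (simp only: \<phi>_def[of "- a"] c(2))
    also have "\<dots> = l"
      unfolding Tscale TT by (rule trans[OF line_scale[OF c(1)] homog_coords_point(3)[OF l]])
    finally show ?thesis .
  qed
  show ?thesis
  proof (rule kiso_induced[OF ringed_projective_space ringed_projective_space m m inv])
    show "\<phi> a (\<phi> (- a) l) = l" if "l \<in> points ?P" for l using inv[OF that, of "- a"] by simp
    fix l assume l: "l \<in> points ?P"
    note h = homog_coords_point[OF l]
    have "\<phi> a l \<in> stratum E {} q \<longleftrightarrow> mp_eval q (T a (homog_coords E l)) \<noteq> 0"
      unfolding \<phi>_def using line_in_stratum_iff[OF q TE[OF h(1)] T0[OF h(2)], where A = "{}"] by simp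
    then show "l \<in> stratum E {} p \<longleftrightarrow> \<phi> a l \<in> stratum E {} q"
      using pq[OF h(1)] stratum_iff[OF p, of l E "{}"] l by (simp add: T_def)
  qed
qed

section \<open>Configuration polynomials and nondegenerate forms\<close>

lemma sum_fun_apply: "(\<Sum>a\<in>A. f a) e = (\<Sum>a\<in>A. f a e)"
  by (induction A rule: infinite_finite_induct) auto

lemma module_hom_fun_space:
  assumes "\<And>a b. T (a + b) = T a + T b" "\<And>r a. T (fun_scale r a) = fun_scale r (T a)"
  shows "module_hom fun_scale fun_scale T"
  by (intro module_hom.intro module_hom_axioms.intro fun_space.module_axioms assms)

text \<open>
  Independent functionals on \<open>W\<close>, here the coordinates in \<open>I\<close>, possess a dual family in \<open>W\<close>. In the
  inductive step the new functional cannot vanish on the common kernel of the old ones, as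
  subtracting the dual expansion of a vector would otherwise express it through them. The
  matroid arguments and the extension of scalars both rest on this.
\<close>

lemma dual_family:
  fixes W :: "('e \<Rightarrow> 'k::field) set"
  assumes W: "fun_space.subspace W" and I: "finite I"
    and indep: "\<And>c. (\<And>w. w \<in> W \<Longrightarrow> (\<Sum>e\<in>I. c e * w e) = 0) \<Longrightarrow> \<forall>e\<in>I. c e = 0"
    and e: "e \<in> I"
  shows "\<exists>w\<in>W. w e = 1 \<and> (\<forall>f\<in>I - {e}. w f = 0)"
proof -
  have "\<exists>d. \<forall>i\<in>I. d i \<in> W \<and> (\<forall>j\<in>I. d i j = (if i = j then 1 else 0))"
    using I indep
  proof (induction I rule: finite_induct)
    case empty
    then show ?case by simp
  next
    case (insert a I)
    have "\<forall>e\<in>I. c e = 0" if c: "\<And>w. w \<in> W \<Longrightarrow> (\<Sum>e\<in>I. c e * w e) = 0" for c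
    proof -
      have "\<forall>e\<in>insert a I. (if e = a then 0 else c e) = 0"
      proof (rule insert.prems)
        fix w assume "w \<in> W"
        have "(\<Sum>e\<in>I. (if e = a then 0 else c e) * w e) = (\<Sum>e\<in>I. c e * w e)"
          by (rule sum.cong) (use insert.hyps in auto)
        then show "(\<Sum>e\<in>insert a I. (if e = a then 0 else c e) * w e) = 0"
          using c[OF \<open>w \<in> W\<close>] insert.hyps by simp
      qed
      then show ?thesis using insert.hyps by (metis insertI2)
    qed
    then obtain d where d: "\<forall>i\<in>I. d i \<in> W \<and> (\<forall>j\<in>I. d i j = (if i = j then 1 else 0))"
      using insert.IH by blast
    \<comment> \<open>Subtracting the dual expansion projects onto the common kernel of the coordinates in \<open>I\<close>.\<close>
    define r where "r w = w - (\<Sum>i\<in>I. fun_scale (w i) (d i))" for w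
    have rW: "r w \<in> W" if "w \<in> W" for w
      unfolding r_def
      by (intro fun_space.subspace_diff fun_space.subspace_sum fun_space.subspace_scale W)
        (use that d in auto)
    have rI: "r w j = 0" if "j \<in> I" for w j
    proof -
      have "(\<Sum>i\<in>I. w i * d i j) = (\<Sum>i\<in>I. if i = j then w i else 0)"
        by (rule sum.cong) (use d that in auto)
      then show ?thesis using that insert.hyps by (simp add: r_def sum_fun_apply fun_scale_def)
    qed
    have "\<exists>w\<in>W. r w a \<noteq> 0"
    proof (rule ccontr)
      assume n: "\<not> (\<exists>w\<in>W. r w a \<noteq> 0)"
      have "\<forall>e\<in>insert a I. (if e = a then 1 else - d e a) = 0"
      proof (rule insert.prems)
        fix w assume "w \<in> W"
        then have "w a = (\<Sum>i\<in>I. w i * d i a)"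
          using n by (simp add: r_def sum_fun_apply fun_scale_def)
        moreover have "(\<Sum>e\<in>I. (if e = a then 1 else - d e a) * w e) = (\<Sum>i\<in>I. - (w i * d i a))"
          by (rule sum.cong) (use insert.hyps in auto)
        ultimately show "(\<Sum>e\<in>insert a I. (if e = a then 1 else - d e a) * w e) = 0"
          using insert.hyps by (simp add: sum_negf)
      qed
      then show False by simp
    qed
    then obtain w where w: "w \<in> W" "r w a \<noteq> 0" by blast
    define u where "u = fun_scale (1 / r w a) (r w)"
    have u: "u \<in> W" "u a = 1" "\<And>j. j \<in> I \<Longrightarrow> u j = 0"
      using fun_space.subspace_scale[OF W rW[OF w(1)], of "1 / r w a"] w(2) rI
      by (simp_all add: u_def fun_scale_def)
    define d' where "d' i = (if i = a then u else d i - fun_scale (d i a) u)" for i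
    have "d' i \<in> W \<and> (\<forall>j\<in>insert a I. d' i j = (if i = j then 1 else 0))" if i: "i \<in> insert a I" for i
    proof
      show "d' i \<in> W"
        using i d u(1) fun_space.subspace_diff[OF W] fun_space.subspace_scale[OF W] by (auto simp: d'_def)
      show "\<forall>j\<in>insert a I. d' i j = (if i = j then 1 else 0)"
        using i d u(2,3) insert.hyps by (auto simp: d'_def fun_scale_def)
    qed
    then show ?case by blast
  qed
  then obtain d where "\<forall>i\<in>I. d i \<in> W \<and> (\<forall>j\<in>I. d i j = (if i = j then 1 else 0))" by blast
  then show ?thesis using e by (intro bexI[of _ "d e"]) auto
qed

text \<open>
  The configuration after extension of scalars to the algebraic closure.
\<close>

definition config_ext :: "('e \<Rightarrow> 'k::field) set \<Rightarrow> ('e \<Rightarrow> 'k alg_closure) set" where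
  "config_ext W = fun_space.span ((\<lambda>w e. to_ac (w e)) ` W)"

text \<open>
  The basis-free counterpart of the non-vanishing of the configuration polynomial at \<open>x\<close>.
\<close>

definition nondegenerate :: "'e set \<Rightarrow> ('e \<Rightarrow> 'a::field) \<Rightarrow> ('e \<Rightarrow> 'a) set \<Rightarrow> bool" where
  "nondegenerate E x V \<longleftrightarrow> (\<forall>v\<in>V. (\<forall>w\<in>V. (\<Sum>e\<in>E. x e * v e * w e) = 0) \<longrightarrow> v = 0)"

lemma config_ext_base: "w \<in> W \<Longrightarrow> (\<lambda>e. to_ac (w e)) \<in> config_ext W"
  unfolding config_ext_def by (intro fun_space.span_base) blast

lemma subspace_config_ext: "fun_space.subspace (config_ext W)"
  unfolding config_ext_def by (rule fun_space.subspace_span)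

lemma config_ext_induct:
  assumes v: "v \<in> config_ext W" and P: "fun_space.subspace {v. P v}"
    and base: "\<And>w. w \<in> W \<Longrightarrow> P (\<lambda>e. to_ac (w e))"
  shows "P v"
proof -
  have "(\<lambda>w e. to_ac (w e)) ` W \<subseteq> {v. P v}" using base by auto
  from fun_space.span_minimal[OF this P] show ?thesis using v by (auto simp: config_ext_def)
qed

lemma config_ext_coord:
  assumes "v \<in> config_ext W" "W \<subseteq> coord_space E"
  shows "v \<in> coord_space E"
  using assms(1)
proof (rule config_ext_induct)
  show "fun_space.subspace {v. v \<in> coord_space E}"
    by (rule fun_space.subspaceI) (auto simp: coord_space_def fun_scale_def)
qed (use assms(2) in \<open>auto simp: coord_space_def\<close>)

lemma basis_list_exists:
  assumes E: "finite E" and W: "configuration E (W :: ('e \<Rightarrow> 'k::field) set)"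
  shows "\<exists>bs. basis_list W bs"
proof -
  have sub: "fun_space.subspace W" and WE: "W \<subseteq> coord_space E"
    using W by (auto simp: configuration_def)
  obtain B where B: "B \<subseteq> W" "fun_space.independent B" "W \<subseteq> fun_space.span B"
    using fun_space.maximal_independent_subset[of W] by blast
  let ?u = "\<lambda>e f. if f = e then 1 else 0 :: 'k"
  have "coord_space E \<subseteq> fun_space.span (?u ` E)"
  proof
    fix w :: "'e \<Rightarrow> 'k" assume w: "w \<in> coord_space E"
    have "w = (\<Sum>e\<in>E. fun_scale (w e) (?u e))"
    proof
      fix f
      have "(\<Sum>e\<in>E. w e * ?u e f) = (\<Sum>e\<in>E. if e = f then w e else 0)" by (rule sum.cong) auto
      then show "w f = (\<Sum>e\<in>E. fun_scale (w e) (?u e)) f"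
        using w E by (auto simp: sum_fun_apply fun_scale_def coord_space_def)
    qed
    also have "\<dots> \<in> fun_space.span (?u ` E)"
      by (intro fun_space.span_sum fun_space.span_scale fun_space.span_base) auto
    finally show "w \<in> fun_space.span (?u ` E)" .
  qed
  then have "finite B"
    using fun_space.independent_span_bound[of "?u ` E" B] B(1,2) WE E by auto
  then obtain bs where "set bs = B" "distinct bs" using finite_distinct_list by blast
  moreover have "fun_space.span B = W"
    using B fun_space.span_minimal[OF B(1) sub] by blast
  ultimately show ?thesis using B(2) by (auto simp: basis_list_def)
qed

lemma mp_eval_config_form:
  "mp_eval (config_form E w w') x = (\<Sum>e\<in>E. to_ac (w e) * to_ac (w' e) * x e)"
  by (simp add: config_form_def mp_eval_sum mp_eval_mult)

lemma mp_homogeneous_config_form: "mp_homogeneous (Suc 0) (config_form E w w')"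
  unfolding config_form_def
  by (rule mp_homogeneous_sum) (use mp_homogeneous_mult[OF mp_homogeneous_const mp_homogeneous_var] in auto)

lemma mp_homogeneous_det:
  assumes "A \<in> carrier_mat n n" "\<And>i j. i < n \<Longrightarrow> j < n \<Longrightarrow> mp_homogeneous (Suc 0) (A $$ (i, j))"
  shows "mp_homogeneous n (det A)"
proof -
  have "mp_homogeneous n (signof p * (\<Prod>i = 0..<n. A $$ (i, p i)))" if p: "p permutes {0..<n}" for p
  proof -
    have "mp_homogeneous (card {0..<n}) (\<Prod>i\<in>{0..<n}. A $$ (i, p i))"
    proof (rule mp_homogeneous_prod)
      fix i assume "i \<in> {0..<n}"
      moreover then have "p i \<in> {0..<n}" using permutes_in_image[OF p] by blast
      ultimately show "mp_homogeneous (Suc 0) (A $$ (i, p i))" using assms(2) by simp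
    qed simp
    then show ?thesis by (auto simp: sign_def mp_homogeneous_uminus)
  qed
  then show ?thesis
    unfolding det_def using assms(1) by (auto intro: mp_homogeneous_sum)
qed

text \<open>
  Row rank equals column rank in disguise: independent vectors, read as coordinate functionals on the
  span of the columns of their matrix, have a dual family over the small field, and pairing a
  relation over the big field with it isolates each coefficient.
\<close>

lemma independent_list_scalar_extension:
  fixes bs :: "('e \<Rightarrow> 'k::field) list"
  assumes E: "finite E" and bs: "distinct bs" "fun_space.independent (set bs)" "set bs \<subseteq> coord_space E"
    and c: "\<And>e. e \<in> E \<Longrightarrow> (\<Sum>j<length bs. c j * to_ac ((bs ! j) e)) = 0" and i: "i < length bs"
  shows "c i = 0"
proof -
  let ?n = "length bs"
  \<comment> \<open>The column span of the matrix with rows \<open>bs\<close>.\<close>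
  let ?W = "range (\<lambda>a (j :: nat). \<Sum>e\<in>E. a e * (bs ! j) e) :: (nat \<Rightarrow> 'k) set"
  have "module_hom fun_scale fun_scale (\<lambda>a (j :: nat). \<Sum>e\<in>E. a e * (bs ! j) e)"
    by (rule module_hom_fun_space)
      (auto simp: fun_scale_def ring_distribs sum.distrib sum_distrib_left mult.assoc)
  from module_hom.subspace_image[OF this fun_space.subspace_UNIV] have sub: "fun_space.subspace ?W" .
  have indep: "\<forall>j\<in>{..<?n}. d j = 0" if d: "\<And>w. w \<in> ?W \<Longrightarrow> (\<Sum>j<?n. d j * w j) = 0" for d
  proof -
    have z: "(\<Sum>j<?n. d j * (bs ! j) e) = 0" for e
    proof (cases "e \<in> E")
      case True
      have "(\<Sum>f\<in>E. (if f = e then 1 else 0) * (bs ! j) f) = (bs ! j) e" for j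
        using E True by (simp add: if_distrib[of "\<lambda>x. x * _"] cong: if_cong)
      then have "(\<lambda>j. (bs ! j) e) \<in> ?W" by (intro range_eqI[of _ _ "\<lambda>f. if f = e then 1 else 0"]) simp
      then show ?thesis by (rule d)
    next
      case False
      then have "(bs ! j) e = 0" if "j < ?n" for j
        using bs(3) nth_mem[OF that] by (auto simp: coord_space_def)
      then show ?thesis by simp
    qed
    have inj: "inj_on ((!) bs) {..<?n}" using bs(1) by (simp add: inj_on_nth)
    define u where "u v = d (the_inv_into {..<?n} ((!) bs) v)" for v
    have bij: "bij_betw ((!) bs) {..<?n} (set bs)" by (rule bij_betw_nth[OF bs(1)]) auto
    have u: "u (bs ! j) = d j" if "j < ?n" for j
      using the_inv_into_f_f[OF inj] that by (simp add: u_def)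
    have "(\<Sum>v\<in>set bs. fun_scale (u v) v) = (\<Sum>j<?n. fun_scale (d j) (bs ! j))"
      unfolding sum.reindex_bij_betw[OF bij, symmetric] by (rule sum.cong) (use u in auto)
    also have "\<dots> = 0"
      by (rule ext) (use z in \<open>simp add: sum_fun_apply fun_scale_def\<close>)
    finally have "u v = 0" if "v \<in> set bs" for v
      using fun_space.independentD[OF bs(2) finite_set subset_refl] that by blast
    then show ?thesis using u nth_mem by (metis lessThan_iff)
  qed
  obtain w where "w \<in> ?W" and w: "w i = 1" "\<forall>j\<in>{..<?n} - {i}. w j = 0"
    using dual_family[OF sub finite_lessThan indep, of i] i by blast
  then obtain a where a: "w = (\<lambda>j. \<Sum>e\<in>E. a e * (bs ! j) e)" by blast
  have "0 = (\<Sum>e\<in>E. to_ac (a e) * (\<Sum>j<?n. c j * to_ac ((bs ! j) e)))"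
    using c by simp
  also have "\<dots> = (\<Sum>j<?n. c j * to_ac (w j))"
    unfolding a to_ac_sum to_ac_mult sum_distrib_left
    by (subst sum.swap) (simp add: mult_ac)
  also have "\<dots> = (\<Sum>j<?n. if j = i then c j else 0)"
    by (rule sum.cong) (use w in auto)
  also have "\<dots> = c i" using i by simp
  finally show ?thesis by simp
qed

lemma config_polynomial_basis:
  assumes E: "finite E" and W: "configuration E W"
  obtains bs where "basis_list W bs"
    "config_polynomial E W = det (mat (length bs) (length bs) (\<lambda>(i, j). config_form E (bs ! i) (bs ! j)))"
proof -
  have "basis_list W (SOME bs. basis_list W bs)"
    by (rule someI_ex[OF basis_list_exists[OF E W]])
  then show ?thesis by (rule that) (simp add: config_polynomial_def Let_def)
qed

lemma mp_homogeneous_config_polynomial: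
  assumes E: "finite E" and W: "configuration E W"
  obtains d where "mp_homogeneous d (config_polynomial E W)" "W \<noteq> {0} \<Longrightarrow> d > 0"
proof -
  obtain bs where bs: "basis_list W bs"
    "config_polynomial E W = det (mat (length bs) (length bs) (\<lambda>(i, j). config_form E (bs ! i) (bs ! j)))"
    by (rule config_polynomial_basis[OF E W])
  have "mp_homogeneous (length bs) (config_polynomial E W)"
    unfolding bs(2) by (rule mp_homogeneous_det) (auto simp: mp_homogeneous_config_form)
  moreover have "length bs > 0" if "W \<noteq> {0}"
    using that bs(1) by (cases bs) (auto simp: basis_list_def)
  ultimately show ?thesis by (rule that)
qed

text \<open>
  The configuration polynomial at \<open>x\<close> is the Gram determinant of the form in a basis, and a Gram
  determinant vanishes exactly if some nonzero vector is orthogonal to everything. All further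
  comparisons of configuration polynomials go through this basis-free criterion.
\<close>

lemma mp_eval_config_polynomial_nonzero_iff:
  assumes E: "finite E" and W: "configuration E (W :: ('e \<Rightarrow> 'k::field) set)"
  shows "mp_eval (config_polynomial E W) x \<noteq> 0 \<longleftrightarrow> nondegenerate E x (config_ext W)"
proof -
  obtain bs where bl: "basis_list W bs" and cp:
    "config_polynomial E W = det (mat (length bs) (length bs) (\<lambda>(i, j). config_form E (bs ! i) (bs ! j)))"
    by (rule config_polynomial_basis[OF E W])
  let ?n = "length bs"
  have bs: "distinct bs" "fun_space.independent (set bs)" "fun_space.span (set bs) = W"
    using bl by (auto simp: basis_list_def)
  have bsW: "bs ! j \<in> W" if "j < ?n" for j
    using bs(3) fun_space.span_base[of "bs ! j" "set bs"] that by simp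
  have WE: "W \<subseteq> coord_space E" and subW: "fun_space.subspace W" using W by (auto simp: configuration_def)
  have bsE: "set bs \<subseteq> coord_space E" using bs(3) fun_space.span_superset WE by blast
  \<comment> \<open>Coordinate vectors are matched with vectors of the extended configuration, which turns the
    kernel of \<open>M\<close> into the radical of the form.\<close>
  define comb where "comb c = (\<lambda>e. \<Sum>j<?n. c j * to_ac ((bs ! j) e))" for c
  define M where "M = mat ?n ?n (\<lambda>(i, j). \<Sum>e\<in>E. to_ac ((bs ! i) e) * to_ac ((bs ! j) e) * x e)"
  interpret ev: comm_ring_hom "\<lambda>p. mp_eval p x" by (rule mp_eval_hom)
  have "mp_eval (config_polynomial E W) x = det (map_mat (\<lambda>p. mp_eval p x)
      (mat ?n ?n (\<lambda>(i, j). config_form E (bs ! i) (bs ! j))))"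
    unfolding cp by (rule ev.hom_det[symmetric])
  also have "map_mat (\<lambda>p. mp_eval p x) (mat ?n ?n (\<lambda>(i, j). config_form E (bs ! i) (bs ! j))) = M"
    unfolding M_def by (rule eq_matI) (auto simp: mp_eval_config_form)
  finally have evdet: "mp_eval (config_polynomial E W) x = det M" .
  have "module_hom fun_scale fun_scale comb"
    by (rule module_hom_fun_space)
      (auto simp: comb_def fun_scale_def ring_distribs sum.distrib sum_distrib_left mult.assoc)
  from module_hom.subspace_image[OF this fun_space.subspace_UNIV]
  have subc: "fun_space.subspace (range comb)" .
  have combW: "comb c \<in> config_ext W" for c
  proof -
    have "comb c = (\<Sum>j<?n. fun_scale (c j) (\<lambda>e. to_ac ((bs ! j) e)))"
      by (auto simp: comb_def sum_fun_apply fun_scale_def)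
    also have "\<dots> \<in> config_ext W"
      by (intro fun_space.subspace_sum subspace_config_ext fun_space.subspace_scale config_ext_base bsW)
        auto
    finally show ?thesis .
  qed
  have base: "(\<lambda>e. to_ac (w e)) \<in> range comb" if "w \<in> W" for w
  proof -
    have "W \<subseteq> {w. (\<lambda>e. to_ac (w e)) \<in> range comb}"
      unfolding bs(3)[symmetric]
    proof (rule fun_space.span_minimal)
      show "set bs \<subseteq> {w. (\<lambda>e. to_ac (w e)) \<in> range comb}"
      proof
        fix b assume "b \<in> set bs"
        then obtain i where i: "i < ?n" "b = bs ! i" by (metis in_set_conv_nth)
        have "(\<Sum>j<?n. (if j = i then 1 else 0) * to_ac ((bs ! j) e)) = to_ac (b e)" for e
          using i by (simp add: if_distrib[of "\<lambda>x. x * _"] cong: if_cong)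
        then have "(\<lambda>e. to_ac (b e)) = comb (\<lambda>j. if j = i then 1 else 0)" by (simp add: comb_def)
        then show "b \<in> {w. (\<lambda>e. to_ac (w e)) \<in> range comb}" by blast
      qed
      show "fun_space.subspace {w. (\<lambda>e. to_ac (w e)) \<in> range comb}"
      proof (rule fun_space.subspaceI)
        show "0 \<in> {w. (\<lambda>e. to_ac (w e)) \<in> range comb}"
          using fun_space.subspace_0[OF subc] by (simp add: zero_fun_def)
        show "y + z \<in> {w. (\<lambda>e. to_ac (w e)) \<in> range comb}"
          if "y \<in> {w. (\<lambda>e. to_ac (w e)) \<in> range comb}" "z \<in> {w. (\<lambda>e. to_ac (w e)) \<in> range comb}" for y z
          using fun_space.subspace_add[OF subc, of "\<lambda>e. to_ac (y e)" "\<lambda>e. to_ac (z e)"] that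
          by (simp add: plus_fun_def)
        show "fun_scale t y \<in> {w. (\<lambda>e. to_ac (w e)) \<in> range comb}"
          if "y \<in> {w. (\<lambda>e. to_ac (w e)) \<in> range comb}" for t y
          using fun_space.subspace_scale[OF subc, of "\<lambda>e. to_ac (y e)" "to_ac t"] that
          by (simp add: fun_scale_def)
      qed
    qed
    then show ?thesis using that by blast
  qed
  have ext: "config_ext W = range comb"
  proof
    show "config_ext W \<subseteq> range comb"
      unfolding config_ext_def by (rule fun_space.span_minimal[OF _ subc]) (use base in blast)
  qed (use combW in blast)
  have mv: "(M *\<^sub>v vec ?n c) $ i = (\<Sum>e\<in>E. (x e * comb c e) * to_ac ((bs ! i) e))" if "i < ?n" for c i
  proof -
    have "(M *\<^sub>v vec ?n c) $ i = (\<Sum>j<?n. (\<Sum>e\<in>E. to_ac ((bs ! i) e) * to_ac ((bs ! j) e) * x e) * c j)"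
      using that by (simp add: M_def scalar_prod_def lessThan_atLeast0)
    also have "\<dots> = (\<Sum>e\<in>E. (x e * comb c e) * to_ac ((bs ! i) e))"
      unfolding comb_def sum_distrib_left sum_distrib_right
      by (subst sum.swap) (simp add: mult_ac)
    finally show ?thesis .
  qed
  have orth: "M *\<^sub>v vec ?n c = 0\<^sub>v ?n \<longleftrightarrow> (\<forall>w\<in>config_ext W. (\<Sum>e\<in>E. x e * comb c e * w e) = 0)" for c
  proof
    assume M0: "M *\<^sub>v vec ?n c = 0\<^sub>v ?n"
    have b0: "(\<Sum>e\<in>E. (x e * comb c e) * to_ac ((bs ! i) e)) = 0" if "i < ?n" for i
      using mv[OF that, of c] M0 that by simp
    show "\<forall>w\<in>config_ext W. (\<Sum>e\<in>E. x e * comb c e * w e) = 0"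
    proof
      fix w assume "w \<in> config_ext W"
      then obtain a where a: "w = comb a" using ext by blast
      have "(\<Sum>e\<in>E. x e * comb c e * w e) =
          (\<Sum>j<?n. a j * (\<Sum>e\<in>E. (x e * comb c e) * to_ac ((bs ! j) e)))"
        unfolding a comb_def[of a] sum_distrib_left by (subst sum.swap) (simp add: mult_ac)
      then show "(\<Sum>e\<in>E. x e * comb c e * w e) = 0" using b0 by simp
    qed
  next
    assume o: "\<forall>w\<in>config_ext W. (\<Sum>e\<in>E. x e * comb c e * w e) = 0"
    show "M *\<^sub>v vec ?n c = 0\<^sub>v ?n"
    proof (rule eq_vecI)
      fix i assume "i < dim_vec (0\<^sub>v ?n)"
      then have i: "i < ?n" by simp
      show "(M *\<^sub>v vec ?n c) $ i = 0\<^sub>v ?n $ i"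
        using mv[OF i] o config_ext_base[OF bsW[OF i]] i by simp
    qed (simp add: M_def)
  qed
  have comb0: "comb c = 0 \<longleftrightarrow> vec ?n c = 0\<^sub>v ?n" for c
  proof
    assume "comb c = 0"
    then have "(\<Sum>j<?n. c j * to_ac ((bs ! j) e)) = 0" for e by (simp add: comb_def fun_eq_iff)
    then have "c i = 0" if "i < ?n" for i
      using independent_list_scalar_extension[OF E bs(1,2) bsE _ that] by blast
    then show "vec ?n c = 0\<^sub>v ?n" by auto
  next
    assume v: "vec ?n c = 0\<^sub>v ?n"
    have "c j = 0" if "j < ?n" for j using arg_cong[OF v, of "\<lambda>v. vec_index v j"] that by simp
    then show "comb c = 0" by (auto simp: comb_def)
  qed
  have Mc: "M \<in> carrier_mat ?n ?n" by (simp add: M_def)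
  have vec: "v = vec ?n (\<lambda>i. v $ i)" if "v \<in> carrier_vec ?n" for v :: "'k alg_closure Matrix.vec"
    using that by (intro eq_vecI) auto
  have "det M = 0 \<longleftrightarrow> (\<exists>v. v \<in> carrier_vec ?n \<and> v \<noteq> 0\<^sub>v ?n \<and> M *\<^sub>v v = 0\<^sub>v ?n)"
    by (rule det_0_iff_vec_prod_zero[OF Mc])
  also have "\<dots> \<longleftrightarrow> (\<exists>c. vec ?n c \<noteq> 0\<^sub>v ?n \<and> M *\<^sub>v vec ?n c = 0\<^sub>v ?n)"
    using vec vec_carrier by metis
  also have "\<dots> \<longleftrightarrow> \<not> nondegenerate E x (config_ext W)"
    unfolding orth comb0[symmetric] nondegenerate_def ext by blast
  finally show ?thesis using evdet by auto
qed

lemma depends_on_config_polynomial: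
  assumes E: "finite E" and W: "configuration E W"
  shows "depends_on E (config_polynomial E W)"
proof -
  obtain bs where cp:
    "config_polynomial E W = det (mat (length bs) (length bs) (\<lambda>(i, j). config_form E (bs ! i) (bs ! j)))"
    by (rule config_polynomial_basis[OF E W])
  let ?n = "length bs"
  let ?M = "mat ?n ?n (\<lambda>(i, j). config_form E (bs ! i) (bs ! j))"
  show ?thesis
    unfolding depends_on_def
  proof (intro allI impI)
    fix x y :: "'a \<Rightarrow> 'b alg_closure" assume xy: "\<forall>i\<in>E. x i = y i"
    interpret x: comm_ring_hom "\<lambda>p. mp_eval p x" by (rule mp_eval_hom)
    interpret y: comm_ring_hom "\<lambda>p. mp_eval p y" by (rule mp_eval_hom)
    have "map_mat (\<lambda>p. mp_eval p x) ?M = map_mat (\<lambda>p. mp_eval p y) ?M"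
      by (rule eq_matI) (use xy in \<open>auto simp: mp_eval_config_form intro!: sum.cong\<close>)
    then show "mp_eval (config_polynomial E W) x = mp_eval (config_polynomial E W) y"
      unfolding cp by (simp only: x.hom_det[symmetric] y.hom_det[symmetric])
  qed
qed

lemma config_complement_eq:
  assumes E: "finite E" and W: "configuration E (W :: ('e \<Rightarrow> 'k::field) set)"
  shows "config_complement E W = proj_complement E (config_polynomial E W)"
proof -
  obtain d where d: "mp_homogeneous d (config_polynomial E W)"
    by (rule mp_homogeneous_config_polynomial[OF E W])
  have "l \<in> config_hypersurface E W \<longleftrightarrow> l \<in> points (projective_space E :: (_, 'k) kspace) \<and>
      mp_eval (config_polynomial E W) (homog_coords E l) = 0" for l
    unfolding config_hypersurface_def
  proof (rule proj_locus_iff)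
    show "mp_eval (config_polynomial E W) (\<lambda>i. c * x i) = 0 \<longleftrightarrow> mp_eval (config_polynomial E W) x = 0"
      if "c \<noteq> 0" for c x
      using that by (simp add: mp_eval_scale[OF d])
  qed
  then have "points (projective_space E :: (_, 'k) kspace) - config_hypersurface E W =
      stratum E {} (config_polynomial E W)"
    using stratum_iff[OF d, of _ E "{}"] by auto
  then show ?thesis by (simp add: config_complement_def)
qed

section \<open>Operations on configurations\<close>

definition restrict_to :: "'e set \<Rightarrow> ('e \<Rightarrow> 'a::zero) \<Rightarrow> 'e \<Rightarrow> 'a" where
  "restrict_to S w = (\<lambda>e. if e \<in> S then w e else 0)"

lemma module_hom_restrict_to: "module_hom fun_scale fun_scale (restrict_to S)"
  by (rule module_hom_fun_space) (auto simp: restrict_to_def fun_scale_def)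

lemma config_ext_restrict_to: "config_ext (restrict_to S ` W) = restrict_to S ` config_ext W"
proof -
  have "(\<lambda>w e. to_ac (w e)) ` restrict_to S ` W = restrict_to S ` (\<lambda>w e. to_ac (w e)) ` W"
    unfolding image_image by (rule image_cong[OF refl]) (auto simp: restrict_to_def)
  then show ?thesis
    unfolding config_ext_def by (simp only: module_hom.span_image[OF module_hom_restrict_to])
qed

lemma configuration_restrict_to:
  assumes W: "configuration E W"
  shows "configuration S (restrict_to S ` W)"
  using module_hom.subspace_image[OF module_hom_restrict_to] W
  by (auto simp: configuration_def restrict_to_def coord_space_def)

lemma config_delete_eq_restrict_to:
  assumes "configuration E W"
  shows "config_delete W e = restrict_to (E - {e}) ` W"
  unfolding config_delete_def
proof (rule image_cong[OF refl])
  fix w assume "w \<in> W"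
  then have "w \<in> coord_space E" using assms by (auto simp: configuration_def)
  then show "w(e := 0) = restrict_to (E - {e}) w"
    by (auto simp: restrict_to_def coord_space_def fun_eq_iff)
qed

text \<open>
  Vectors supported on \<open>E\<close> and on \<open>F\<close> are orthogonal for every diagonal form, so the form on a direct
  sum is nondegenerate if and only if both summands are.
\<close>

lemma nondegenerate_direct_sum:
  assumes E: "finite E" "finite F" "E \<inter> F = {}" and W: "configuration (E \<union> F) W"
    and split: "\<And>w. w \<in> W \<Longrightarrow> restrict_to E w \<in> W"
  shows "nondegenerate (E \<union> F) x (config_ext W) \<longleftrightarrow>
    nondegenerate E x (config_ext (restrict_to E ` W)) \<and> nondegenerate F x (config_ext (restrict_to F ` W))"
proof -
  let ?B = "\<lambda>E v w. \<Sum>e\<in>E. x e * v e * w e"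
  have sub: "fun_space.subspace W" and WE: "W \<subseteq> coord_space (E \<union> F)"
    using W by (auto simp: configuration_def)
  have splitF: "restrict_to F w \<in> W" if "w \<in> W" for w
  proof -
    have "restrict_to F w = w - restrict_to E w"
      using WE that E(3) by (fastforce simp: restrict_to_def coord_space_def fun_eq_iff)
    then show ?thesis using fun_space.subspace_diff[OF sub that split[OF that]] by simp
  qed
  have mono: "config_ext A \<subseteq> config_ext W" if "A \<subseteq> W" for A
    unfolding config_ext_def by (rule fun_space.span_mono) (use that in blast)
  have inE: "config_ext (restrict_to E ` W) \<subseteq> config_ext W" by (rule mono) (use split in blast)
  have inF: "config_ext (restrict_to F ` W) \<subseteq> config_ext W" by (rule mono) (use splitF in blast)
  have coord: "v \<in> coord_space (E \<union> F)" if "v \<in> config_ext W" for v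
    using config_ext_coord[OF that WE] .
  have BE: "?B (E \<union> F) v w = ?B E v (restrict_to E w)" "?B (E \<union> F) w v = ?B E (restrict_to E w) v"
    if "v \<in> coord_space E" for v w
  proof -
    have z: "v e = 0" if "e \<in> F" for e
      using that \<open>v \<in> coord_space E\<close> E(3) by (auto simp: coord_space_def)
    show "?B (E \<union> F) v w = ?B E v (restrict_to E w)" "?B (E \<union> F) w v = ?B E (restrict_to E w) v"
      using z by (simp_all add: sum.union_disjoint[OF E] restrict_to_def)
  qed
  have BF: "?B (E \<union> F) v w = ?B F v (restrict_to F w)" "?B (E \<union> F) w v = ?B F (restrict_to F w) v"
    if "v \<in> coord_space F" for v w
  proof -
    have z: "v e = 0" if "e \<in> E" for e
      using that \<open>v \<in> coord_space F\<close> E(3) by (auto simp: coord_space_def)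
    show "?B (E \<union> F) v w = ?B F v (restrict_to F w)" "?B (E \<union> F) w v = ?B F (restrict_to F w) v"
      using z by (simp_all add: sum.union_disjoint[OF E] restrict_to_def)
  qed
  have cE: "v \<in> coord_space E" if "v \<in> config_ext (restrict_to E ` W)" for v
    by (rule config_ext_coord[OF that]) (auto simp: restrict_to_def coord_space_def)
  have cF: "v \<in> coord_space F" if "v \<in> config_ext (restrict_to F ` W)" for v
    by (rule config_ext_coord[OF that]) (auto simp: restrict_to_def coord_space_def)
  have rE: "restrict_to E v \<in> config_ext (restrict_to E ` W)"
    and rF: "restrict_to F v \<in> config_ext (restrict_to F ` W)" if "v \<in> config_ext W" for v
    using that by (auto simp: config_ext_restrict_to)
  show ?thesis
  proof
    assume n: "nondegenerate (E \<union> F) x (config_ext W)"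
    show "nondegenerate E x (config_ext (restrict_to E ` W)) \<and> nondegenerate F x (config_ext (restrict_to F ` W))"
      unfolding nondegenerate_def
    proof (intro conjI ballI impI)
      fix v assume v: "v \<in> config_ext (restrict_to E ` W)" "\<forall>w\<in>config_ext (restrict_to E ` W). ?B E v w = 0"
      then have "\<forall>w\<in>config_ext W. ?B (E \<union> F) v w = 0" using BE(1)[OF cE[OF v(1)]] rE by simp
      then show "v = 0" using n v(1) inE unfolding nondegenerate_def by blast
    next
      fix v assume v: "v \<in> config_ext (restrict_to F ` W)" "\<forall>w\<in>config_ext (restrict_to F ` W). ?B F v w = 0"
      then have "\<forall>w\<in>config_ext W. ?B (E \<union> F) v w = 0" using BF(1)[OF cF[OF v(1)]] rF by simp
      then show "v = 0" using n v(1) inF unfolding nondegenerate_def by blast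
    qed
  next
    assume n: "nondegenerate E x (config_ext (restrict_to E ` W)) \<and> nondegenerate F x (config_ext (restrict_to F ` W))"
    show "nondegenerate (E \<union> F) x (config_ext W)"
      unfolding nondegenerate_def
    proof (intro ballI impI)
      fix v assume v: "v \<in> config_ext W" "\<forall>w\<in>config_ext W. ?B (E \<union> F) v w = 0"
      have "\<forall>w\<in>config_ext (restrict_to E ` W). ?B E (restrict_to E v) w = 0"
        using v(2) inE BE(2)[OF cE] by fastforce
      then have 1: "restrict_to E v = 0" using n rE[OF v(1)] unfolding nondegenerate_def by blast
      have "\<forall>w\<in>config_ext (restrict_to F ` W). ?B F (restrict_to F v) w = 0"
        using v(2) inF BF(2)[OF cF] by fastforce
      then have 2: "restrict_to F v = 0" using n rF[OF v(1)] unfolding nondegenerate_def by blast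
      show "v = 0"
      proof
        fix e
        show "v e = 0 e"
          using fun_cong[OF 1, of e] fun_cong[OF 2, of e] coord[OF v(1)]
          by (auto simp: restrict_to_def coord_space_def split: if_splits)
      qed
    qed
  qed
qed

lemma stratum_cong:
  assumes "\<And>x. x \<in> coord_space E \<Longrightarrow> mp_eval p x \<noteq> 0 \<longleftrightarrow> mp_eval q x \<noteq> 0"
  shows "stratum E {} p = stratum E {} q"
  unfolding stratum_def proj_locus_def using assms by auto

lemma proj_complement_direct_sum:
  assumes E: "finite E" "finite F" "E \<inter> F = {}" and W: "configuration (E \<union> F) W"
    and split: "\<And>w. w \<in> W \<Longrightarrow> restrict_to E w \<in> W"
  shows "config_complement (E \<union> F) W = proj_complement (E \<union> F)
    (config_polynomial E (restrict_to E ` W) * config_polynomial F (restrict_to F ` W))"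
proof -
  have "stratum (E \<union> F) {} (config_polynomial (E \<union> F) W) = stratum (E \<union> F) {}
      (config_polynomial E (restrict_to E ` W) * config_polynomial F (restrict_to F ` W))"
  proof (rule stratum_cong)
    fix x
    show "mp_eval (config_polynomial (E \<union> F) W) x \<noteq> 0 \<longleftrightarrow>
        mp_eval (config_polynomial E (restrict_to E ` W) * config_polynomial F (restrict_to F ` W)) x \<noteq> 0"
      using nondegenerate_direct_sum[OF E W split, of x] E(1,2)
        mp_eval_config_polynomial_nonzero_iff[OF _ W, of x]
        mp_eval_config_polynomial_nonzero_iff[OF E(1) configuration_restrict_to[OF W], of x]
        mp_eval_config_polynomial_nonzero_iff[OF E(2) configuration_restrict_to[OF W], of x]
      by (simp add: mp_eval_mult)
  qed
  then show ?thesis using config_complement_eq[OF _ W] E by simp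
qed

text \<open>
  If \<open>w\<^sub>e = c w\<^sub>f\<close> on \<open>W\<close>, then \<open>x\<^sub>e v\<^sub>e w\<^sub>e + x\<^sub>f v\<^sub>f w\<^sub>f = (x\<^sub>f + c\<^sup>2 x\<^sub>e) v\<^sub>f w\<^sub>f\<close>, and forgetting
  the coordinate \<open>e\<close> is injective. The value \<open>c = 0\<close> accounts for loops.
\<close>

lemma nondegenerate_parallel:
  assumes E: "finite E" and ef: "e \<in> E" "f \<in> E" "e \<noteq> f" and W: "configuration E W"
    and par: "\<And>w. w \<in> W \<Longrightarrow> w e = c * w f"
  shows "nondegenerate E x (config_ext W) \<longleftrightarrow>
    nondegenerate (E - {e}) (x(f := x f + to_ac (c ^ 2) * x e)) (config_ext (config_delete W e))"
proof -
  let ?x = "x(f := x f + to_ac (c ^ 2) * x e)"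
  let ?r = "restrict_to (E - {e}) :: _ \<Rightarrow> _ \<Rightarrow> 'b alg_closure"
  have WE: "W \<subseteq> coord_space E" using W by (auto simp: configuration_def)
  have ve: "v e = to_ac c * v f" if "v \<in> config_ext W" for v
    using that
  proof (rule config_ext_induct)
    show "fun_space.subspace {v. v e = to_ac c * v f}"
      by (rule fun_space.subspaceI) (auto simp: fun_scale_def algebra_simps)
    show "to_ac (w e) = to_ac c * to_ac (w f)" if "w \<in> W" for w
      using arg_cong[OF par[OF that], of to_ac] by simp
  qed
  have B: "(\<Sum>i\<in>E. x i * v i * w i) = (\<Sum>i\<in>E - {e}. ?x i * ?r v i * ?r w i)"
    if "v \<in> config_ext W" "w \<in> config_ext W" for v w
  proof -
    have fE: "f \<in> E - {e}" using ef by simp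
    have "(\<Sum>i\<in>E. x i * v i * w i) = x e * v e * w e + (\<Sum>i\<in>E - {e}. x i * v i * w i)"
      by (rule sum.remove[OF E ef(1)])
    also have "\<dots> = x e * v e * w e + (x f * v f * w f + (\<Sum>i\<in>E - {e} - {f}. x i * v i * w i))"
      using sum.remove[OF _ fE, of "\<lambda>i. x i * v i * w i"] E by simp
    also have "\<dots> = ?x f * v f * w f + (\<Sum>i\<in>E - {e} - {f}. x i * v i * w i)"
      unfolding ve[OF that(1)] ve[OF that(2)] by (simp add: algebra_simps power2_eq_square)
    also have "\<dots> = ?x f * ?r v f * ?r w f + (\<Sum>i\<in>E - {e} - {f}. ?x i * ?r v i * ?r w i)"
      using fE by (auto simp: restrict_to_def intro!: sum.cong)
    also have "\<dots> = (\<Sum>i\<in>E - {e}. ?x i * ?r v i * ?r w i)"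
      using sum.remove[OF _ fE, of "\<lambda>i. ?x i * ?r v i * ?r w i"] E by simp
    finally show ?thesis .
  qed
  have z: "?r v = 0 \<longleftrightarrow> v = 0" if v: "v \<in> config_ext W" for v
  proof
    assume r: "?r v = 0"
    have "v i = 0" for i
    proof (cases "i \<in> E - {e}")
      case True
      then show ?thesis using fun_cong[OF r, of i] by (simp add: restrict_to_def)
    next
      case False
      have "v f = 0" using fun_cong[OF r, of f] ef by (simp add: restrict_to_def)
      then show ?thesis using False ve[OF v] config_ext_coord[OF v WE] by (auto simp: coord_space_def)
    qed
    then show "v = 0" by auto
  qed (auto simp: restrict_to_def)
  show ?thesis
    unfolding nondegenerate_def config_delete_eq_restrict_to[OF W] config_ext_restrict_to
    using B z by auto
qed

section \<open>Configuration matroids\<close>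

lemma config_indep_iff:
  "I \<in> indep (config_matroid E W) \<longleftrightarrow> I \<subseteq> E \<and>
    (\<forall>c. (\<forall>w\<in>W. (\<Sum>e\<in>I. c e * w e) = 0) \<longrightarrow> (\<forall>e\<in>I. c e = 0))"
  by (simp add: config_matroid_def)

lemma ground_config_matroid [simp]: "ground (config_matroid E W) = E"
  by (simp add: config_matroid_def)

lemma empty_config_indep: "{} \<in> indep (config_matroid E W)"
  by (simp add: config_indep_iff)

lemma config_indep_dual:
  assumes E: "finite E" and W: "configuration E W" and I: "I \<in> indep (config_matroid E W)" and e: "e \<in> I"
  shows "\<exists>w\<in>W. w e = 1 \<and> (\<forall>f\<in>I - {e}. w f = 0)"
proof (rule dual_family[OF _ _ _ e])
  show "fun_space.subspace W" using W by (simp add: configuration_def)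
  show "finite I" using I finite_subset[OF _ E] by (simp add: config_indep_iff)
  show "\<forall>e\<in>I. c e = 0" if "\<And>w. w \<in> W \<Longrightarrow> (\<Sum>e\<in>I. c e * w e) = 0" for c
    using I that by (simp add: config_indep_iff)
qed

text \<open>
  A maximal independent subset of \<open>S\<close> spans: a relation that involves a further element \<open>g\<close>
  must do so with nonzero coefficient.
\<close>

lemma config_indep_spanning:
  assumes E: "finite E" and S: "S \<subseteq> E"
  shows "\<exists>I\<subseteq>S. I \<in> indep (config_matroid E W) \<and>
    (\<forall>w\<in>W. (\<forall>i\<in>I. w i = 0) \<longrightarrow> (\<forall>i\<in>S. w i = 0))"
proof -
  let ?F = "{I. I \<subseteq> S \<and> I \<in> indep (config_matroid E W)}"
  have "finite (Pow S)" using finite_subset[OF S E] by simp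
  then have fin: "finite (card ` ?F)" by (rule finite_imageI[OF finite_subset[rotated]]) blast
  moreover have "{} \<in> ?F" using empty_config_indep[of E W] by simp
  then have "card ` ?F \<noteq> {}" by (rule imageI[THEN ex_in_conv[THEN iffD1, OF exI]])
  ultimately have "Max (card ` ?F) \<in> card ` ?F" by (rule Max_in)
  then obtain I where I: "I \<in> ?F" "card I = Max (card ` ?F)" by (rule imageE) (rule that, simp_all)
  have Imax: "card J \<le> card I" if "J \<in> ?F" for J
    unfolding I(2) by (rule Max_ge[OF fin imageI[OF that]])
  have "I \<subseteq> E" using I(1) S by auto
  then have fI: "finite I" using E by (rule finite_subset)
  have "w g = 0" if w: "w \<in> W" "\<forall>i\<in>I. w i = 0" and g: "g \<in> S" for w g
  proof (cases "g \<in> I")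
    case False
    have "insert g I \<notin> ?F" using Imax[of "insert g I"] False fI by auto
    then have "insert g I \<notin> indep (config_matroid E W)" using I(1) g by auto
    then obtain c where c: "\<forall>w\<in>W. (\<Sum>e\<in>insert g I. c e * w e) = 0" "\<exists>e\<in>insert g I. c e \<noteq> 0"
      using I(1) S g by (auto simp: config_indep_iff)
    have "c g \<noteq> 0"
    proof
      assume "c g = 0"
      then have "\<forall>w\<in>W. (\<Sum>e\<in>I. c e * w e) = 0" using c(1) False fI by simp
      then have "\<forall>e\<in>I. c e = 0" using I(1) by (simp add: config_indep_iff)
      then show False using c(2) \<open>c g = 0\<close> by auto
    qed
    moreover have "(\<Sum>e\<in>insert g I. c e * w e) = c g * w g"
      using False fI w(2) by simp
    ultimately show ?thesis using c(1) w(1) by auto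
  qed (use w in blast)
  then show ?thesis using I(1) by blast
qed

lemma matroid_rank_config:
  assumes E: "finite E" and k: "k < matroid_rank (config_matroid E W)"
  obtains I where "I \<in> indep (config_matroid E W)" "k < card I"
proof -
  have "indep (config_matroid E W) \<subseteq> Pow E" by (auto simp: config_indep_iff)
  then have "finite (card ` indep (config_matroid E W))"
    by (intro finite_imageI finite_subset[OF _ finite_Pow_iff[THEN iffD2, OF E]])
  then have "Max (card ` indep (config_matroid E W)) \<in> card ` indep (config_matroid E W)"
    using empty_config_indep by (intro Max_in) auto
  then show ?thesis using that k by (auto simp: matroid_rank_def)
qed

lemma config_not_loop:
  assumes E: "finite E" and W: "configuration E W" and e: "e \<in> E"
    and nl: "\<not> matroid_loop (config_matroid E W) e"
  obtains w where "w \<in> W" "w e = 1"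
proof -
  have "D \<in> indep (config_matroid E W)" if "D \<subset> {e}" for D
    using that empty_config_indep by (auto simp: subset_singleton_iff psubset_eq)
  then have "{e} \<in> indep (config_matroid E W)"
    using nl e by (auto simp: matroid_loop_def circuit_def)
  then show ?thesis using config_indep_dual[OF E W] that by blast
qed

text \<open>
  Loops and parallel elements are treated together: in both cases the coordinate \<open>e\<close> is a multiple of
  another one, with factor \<open>0\<close> for a loop. For a loop the other element exists because the rank is
  positive.
\<close>

lemma config_loop_or_parallel:
  assumes E: "finite E" and W: "configuration E W" and e: "e \<in> E"
    and r: "matroid_rank (config_matroid E W) > 0"
    and lp: "matroid_loop (config_matroid E W) e \<or> (\<exists>f\<in>E. matroid_parallel (config_matroid E W) e f)"
  obtains f c where "f \<in> E" "f \<noteq> e" "\<And>w. w \<in> W \<Longrightarrow> w e = c * w f" "W \<noteq> {0}"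
proof -
  obtain I where I: "I \<in> indep (config_matroid E W)" "0 < card I"
    by (rule matroid_rank_config[OF E r])
  then obtain g where g: "g \<in> I" by fastforce
  then have gE: "g \<in> E" using I by (auto simp: config_indep_iff)
  obtain u where u: "u \<in> W" "u g = 1" using config_indep_dual[OF E W I(1) g] by blast
  then have W0: "W \<noteq> {0}" by auto
  show ?thesis
    using lp
  proof
    assume "matroid_loop (config_matroid E W) e"
    then have "{e} \<notin> indep (config_matroid E W)" by (simp add: matroid_loop_def circuit_def)
    then obtain c where "\<forall>w\<in>W. c e * w e = 0" "c e \<noteq> 0" using e by (auto simp: config_indep_iff)
    then have z: "w e = 0" if "w \<in> W" for w using that by auto
    then have "g \<noteq> e" using u by force
    then show ?thesis using that[OF gE, of 0] z W0 by simp
  next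
    assume "\<exists>f\<in>E. matroid_parallel (config_matroid E W) e f"
    then obtain f where f: "f \<in> E" "e \<noteq> f" "circuit (config_matroid E W) {e, f}"
      by (auto simp: matroid_parallel_def)
    have "{f} \<in> indep (config_matroid E W)" "{e, f} \<notin> indep (config_matroid E W)"
      using f by (auto simp: circuit_def)
    then obtain v where v: "v \<in> W" "v f = 1" using config_indep_dual[OF E W] by blast
    obtain c where c: "\<forall>w\<in>W. c e * w e + c f * w f = 0" "c e \<noteq> 0 \<or> c f \<noteq> 0"
      using \<open>{e, f} \<notin> indep (config_matroid E W)\<close> e f by (auto simp: config_indep_iff)
    have ce: "c e \<noteq> 0"
    proof
      assume "c e = 0"
      then show False using c v by auto
    qed
    have "w e = - (c f / c e) * w f" if "w \<in> W" for w
    proof -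
      have "c e * w e = - (c f * w f)" using c(1) that by (simp add: eq_neg_iff_add_eq_0)
      then show ?thesis using ce by (simp add: field_simps)
    qed
    then show ?thesis using that[OF f(1) f(2)[symmetric]] W0 by blast
  qed
qed

text \<open>
  A maximal independent set avoiding the coloop is not a basis. Extending it by one element and
  taking the dual vector of this element gives a vector vanishing at all elements other than the
  coloop, so the added element is the coloop itself.
\<close>

lemma config_coloop:
  assumes E: "finite E" and W: "configuration E W" and col: "matroid_coloop (config_matroid E W) e"
  obtains u where "u \<in> W" "u e = 1" "\<And>f. f \<in> E \<Longrightarrow> f \<noteq> e \<Longrightarrow> u f = 0"
proof -
  obtain I where I: "I \<subseteq> E - {e}" "I \<in> indep (config_matroid E W)"
      "\<forall>w\<in>W. (\<forall>i\<in>I. w i = 0) \<longrightarrow> (\<forall>i\<in>E - {e}. w i = 0)"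
    using config_indep_spanning[OF E, of "E - {e}" W] by blast
  have "\<not> matroid_basis (config_matroid E W) I"
    using col I(1) by (auto simp: matroid_coloop_def)
  then obtain J where J: "J \<in> indep (config_matroid E W)" "I \<subseteq> J" "J \<noteq> I"
    using I(2) by (auto simp: matroid_basis_def)
  then obtain g where g: "g \<in> J" "g \<notin> I" by blast
  obtain u where u: "u \<in> W" "u g = 1" "\<forall>f\<in>J - {g}. u f = 0"
    using config_indep_dual[OF E W J(1) g(1)] by blast
  then have z: "\<forall>i\<in>E - {e}. u i = 0" using I(3) J(2) g(2) by blast
  moreover have "g \<in> E" using J(1) g by (auto simp: config_indep_iff)
  ultimately have "g = e" using u(2) by force
  then show ?thesis using that[OF u(1)] u(2) z by auto
qed

text \<open>
  Choose spanning independent sets in \<open>S\<close> and in its complement. Their union is independent, and the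
  dual vectors belonging to \<open>S\<close> vanish on the complement because they vanish on its spanning set.
  Expanding \<open>w\<close> in those gives exactly the part of \<open>w\<close> in \<open>S\<close>.
\<close>

lemma config_disconnected:
  assumes E: "finite E" and W: "configuration E W" and S: "S \<subseteq> E"
    and split: "\<forall>I\<subseteq>E. I \<in> indep (config_matroid E W) \<longleftrightarrow>
      I \<inter> S \<in> indep (config_matroid E W) \<and> I - S \<in> indep (config_matroid E W)"
    and w: "w \<in> W"
  shows "restrict_to S w \<in> W"
proof -
  have sub: "fun_space.subspace W" and WE: "W \<subseteq> coord_space E" using W by (auto simp: configuration_def)
  obtain I where I: "I \<subseteq> S" "I \<in> indep (config_matroid E W)"
      "\<forall>w\<in>W. (\<forall>i\<in>I. w i = 0) \<longrightarrow> (\<forall>i\<in>S. w i = 0)"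
    using config_indep_spanning[OF E S, of W] by blast
  obtain J where J: "J \<subseteq> E - S" "J \<in> indep (config_matroid E W)"
      "\<forall>w\<in>W. (\<forall>i\<in>J. w i = 0) \<longrightarrow> (\<forall>i\<in>E - S. w i = 0)"
    using config_indep_spanning[OF E, of "E - S" W] by blast
  have fI: "finite I" using finite_subset[of I E] I(1) S E by simp
  have IJ: "(I \<union> J) \<inter> S = I" "(I \<union> J) - S = J" "I \<union> J \<subseteq> E" "I \<inter> J = {}" using I(1) J(1) S by auto
  then have "I \<union> J \<in> indep (config_matroid E W)" using split I(2) J(2) by metis
  then have "\<forall>i\<in>I. \<exists>u\<in>W. u i = 1 \<and> (\<forall>f\<in>I \<union> J - {i}. u f = 0)"
    using config_indep_dual[OF E W] by blast
  then obtain d where d: "\<forall>i\<in>I. d i \<in> W \<and> d i i = 1 \<and> (\<forall>f\<in>I \<union> J - {i}. d i f = 0)" by metis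
  define z where "z = (\<Sum>i\<in>I. fun_scale (w i) (d i))"
  have zW: "z \<in> W"
    unfolding z_def by (intro fun_space.subspace_sum fun_space.subspace_scale sub) (use d in auto)
  have z: "z j = (\<Sum>i\<in>I. w i * d i j)" for j by (simp add: z_def sum_fun_apply fun_scale_def)
  have zI: "z j = w j" if "j \<in> I" for j
  proof -
    have "(\<Sum>i\<in>I. w i * d i j) = (\<Sum>i\<in>I. if i = j then w i else 0)"
      by (rule sum.cong) (use d that in auto)
    then show ?thesis using that fI by (simp add: z)
  qed
  have "z j = 0" if "j \<in> J" for j
    unfolding z by (rule sum.neutral) (use d that IJ(4) in auto)
  then have z2: "\<forall>i\<in>E - S. z i = 0" using J(3) zW by blast
  have "w - z \<in> W" by (rule fun_space.subspace_diff[OF sub w zW])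
  moreover have "\<forall>i\<in>I. (w - z) i = 0" using zI by simp
  ultimately have z1: "\<forall>i\<in>S. (w - z) i = 0" using I(3) by blast
  have "restrict_to S w = z"
  proof
    fix i
    have "i \<notin> E \<Longrightarrow> z i = 0" using zW WE by (auto simp: coord_space_def)
    then show "restrict_to S w i = z i" using z1 z2 by (auto simp: restrict_to_def)
  qed
  then show ?thesis using zW by simp
qed

section \<open>Complements of configuration hypersurfaces\<close>

lemma restrict_to_nonzero:
  assumes "w \<in> W" "w e \<noteq> 0" "e \<in> S"
  shows "restrict_to S ` W \<noteq> {0}"
proof -
  have "restrict_to S w e \<noteq> 0" using assms by (simp add: restrict_to_def)
  then have "restrict_to S w \<noteq> 0" by auto
  then show ?thesis using assms(1) by blast
qed

text \<open>
  A shear makes the polynomial independent of \<open>x\<^sub>e\<close>; the join with the constant \<open>1\<close> in the single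
  variable \<open>x\<^sub>e\<close> then contributes the affine line.
\<close>

lemma K0_class_delete_parallel:
  assumes E: "finite E" and W: "configuration E (W :: ('e \<Rightarrow> 'k::field) set)"
    and ef: "e \<in> E" "f \<in> E" "f \<noteq> e" and par: "\<And>w. w \<in> W \<Longrightarrow> w e = c * w f" and W0: "W \<noteq> {0}"
  shows "K0_class (config_complement E W) =
    K0_class (config_complement (E - {e}) (config_delete W e)) * K0_L"
proof -
  let ?E = "E - {e}" and ?W = "config_delete W e"
  let ?p = "config_polynomial E W" and ?q = "config_polynomial ?E ?W"
  have W': "configuration ?E ?W"
    unfolding config_delete_eq_restrict_to[OF W] by (rule configuration_restrict_to[OF W])
  have fin: "finite ?E" using E by simp
  have "0 \<in> W" by (rule fun_space.subspace_0) (use W in \<open>simp add: configuration_def\<close>)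
  then obtain w where w: "w \<in> W" "w \<noteq> 0" using W0 by blast
  then obtain g where g: "g \<in> E" "w g \<noteq> 0"
    using W nonzero_coordinate[of w E] by (auto simp: configuration_def)
  have "\<exists>g\<in>?E. w g \<noteq> 0"
    using g ef par[OF w(1)] by (cases "g = e") auto
  then obtain h where h: "h \<in> ?E" "w h \<noteq> 0" by blast
  have W0': "?W \<noteq> {0}"
    unfolding config_delete_eq_restrict_to[OF W] by (rule restrict_to_nonzero[OF w(1) h(2,1)])
  obtain d where d: "mp_homogeneous d ?p" by (rule mp_homogeneous_config_polynomial[OF E W])
  obtain d' where d': "mp_homogeneous d' ?q" "d' > 0"
    by (rule mp_homogeneous_config_polynomial[OF fin W']) (use W0' in blast)
  \<comment> \<open>The factor \<open>1\<close> stands for a polynomial in the variable \<open>e\<close> alone, as the join formula requires.\<close>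
  have "K0_class (config_complement E W) = K0_class (proj_complement E (?q * 1))"
    unfolding config_complement_eq[OF E W]
  proof (rule K0_class_kiso, rule kiso_shear[OF ef(1,2) ef(3)[symmetric] d mp_homogeneous_mult[OF d'(1) mp_homogeneous_one]])
    fix x
    show "mp_eval ?p x \<noteq> 0 \<longleftrightarrow> mp_eval (?q * 1) (x(f := x f + to_ac (c ^ 2) * x e)) \<noteq> 0"
      using nondegenerate_parallel[OF E ef(1,2) ef(3)[symmetric] W par, of x]
        mp_eval_config_polynomial_nonzero_iff[OF E W, of x]
        mp_eval_config_polynomial_nonzero_iff[OF fin W', of "x(f := x f + to_ac (c ^ 2) * x e)"]
      by simp
  qed
  also have "\<dots> = K0_class (proj_complement (?E \<union> {e}) (?q * 1))"
    using ef(1) by (simp add: insert_absorb)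
  also have "\<dots> = K0_class (proj_complement ?E ?q) * K0_class (affine_complement {e} (1 :: ('e, 'k) mpoly))"
    by (rule K0_class_join[OF fin _ _ _ d' depends_on_config_polynomial[OF fin W']
          mp_homogeneous_one depends_on_one]) (use ef in auto)
  finally show ?thesis
    by (simp only: K0_class_affine_line config_complement_eq[OF fin W'])
qed

text \<open>
  The unit vector at \<open>e\<close> splits off, so the polynomial acquires the factor \<open>x\<^sub>e\<close> and the join
  contributes the torus.
\<close>

lemma K0_class_delete_coloop:
  assumes E: "finite E" and W: "configuration E (W :: ('e \<Rightarrow> 'k::field) set)" and e: "e \<in> E"
    and u: "u \<in> W" "u e = 1" "\<And>f. f \<in> E \<Longrightarrow> f \<noteq> e \<Longrightarrow> u f = 0"
    and w: "w \<in> W" "w f \<noteq> 0" "f \<in> E - {e}"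
  shows "K0_class (config_complement E W) =
    K0_class (config_complement (E - {e}) (config_delete W e)) * K0_T"
proof -
  let ?E = "E - {e}" and ?W = "config_delete W e"
  let ?q = "config_polynomial ?E ?W"
  note del = config_delete_eq_restrict_to[OF W, of e]
  have sub: "fun_space.subspace W" and WE: "W \<subseteq> coord_space E" using W by (auto simp: configuration_def)
  have Eu: "?E \<union> {e} = E" using e by blast
  have W1: "configuration (?E \<union> {e}) W" unfolding Eu by (rule W)
  have W': "configuration ?E ?W" unfolding del by (rule configuration_restrict_to[OF W])
  have fin: "finite ?E" using E by simp
  have split: "restrict_to ?E v \<in> W" if "v \<in> W" for v
  proof -
    have "restrict_to ?E v = v - fun_scale (v e) u"
    proof
      fix i
      have "i \<notin> E \<Longrightarrow> v i = 0 \<and> u i = 0" using that u(1) WE by (auto simp: coord_space_def)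
      then show "restrict_to ?E v i = (v - fun_scale (v e) u) i"
        using u(2,3) by (auto simp: restrict_to_def fun_scale_def)
    qed
    then show ?thesis
      using fun_space.subspace_diff[OF sub that fun_space.subspace_scale[OF sub u(1)]] by simp
  qed
  have "?W \<noteq> {0}" unfolding del using restrict_to_nonzero[OF w] .
  then obtain d where d: "mp_homogeneous d ?q" "d > 0"
    using mp_homogeneous_config_polynomial[OF fin W'] by metis
  have nd: "nondegenerate {e} x (config_ext (restrict_to {e} ` W)) \<longleftrightarrow> x e \<noteq> 0" for x
  proof
    let ?u = "\<lambda>i. to_ac (restrict_to {e} u i)"
    assume n: "nondegenerate {e} x (config_ext (restrict_to {e} ` W))"
    have "?u \<in> config_ext (restrict_to {e} ` W)" by (rule config_ext_base) (use u(1) in blast)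
    moreover have "?u e = 1" using u(2) by (simp add: restrict_to_def)
    then have "?u \<noteq> 0" by (metis zero_fun_apply zero_neq_one)
    ultimately show "x e \<noteq> 0" using n unfolding nondegenerate_def by auto
  next
    let ?u = "\<lambda>i. to_ac (restrict_to {e} u i)"
    assume xe: "x e \<noteq> 0"
    have uW: "?u \<in> config_ext (restrict_to {e} ` W)" by (rule config_ext_base) (use u(1) in blast)
    have ue: "?u e = 1" using u(2) by (simp add: restrict_to_def)
    show "nondegenerate {e} x (config_ext (restrict_to {e} ` W))"
      unfolding nondegenerate_def
    proof (intro ballI impI)
      fix v assume v: "v \<in> config_ext (restrict_to {e} ` W)"
        "\<forall>w\<in>config_ext (restrict_to {e} ` W). (\<Sum>i\<in>{e}. x i * v i * w i) = 0"
      have "(\<Sum>i\<in>{e}. x i * v i * ?u i) = 0" by (rule bspec[OF v(2) uW])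
      then have "v e = 0" using xe ue by simp
      moreover have "v \<in> coord_space {e}"
        by (rule config_ext_coord[OF v(1)]) (auto simp: restrict_to_def coord_space_def)
      ultimately show "v = 0" by (auto simp: coord_space_def fun_eq_iff)
    qed
  qed
  have "stratum E {} (config_polynomial E W) = stratum E {} (?q * mp_var e)"
  proof (rule stratum_cong)
    fix x
    show "mp_eval (config_polynomial E W) x \<noteq> 0 \<longleftrightarrow> mp_eval (?q * mp_var e) x \<noteq> 0"
      using nondegenerate_direct_sum[OF fin _ _ W1 split, of x] nd[of x]
        mp_eval_config_polynomial_nonzero_iff[OF E W, of x]
        mp_eval_config_polynomial_nonzero_iff[OF fin W', of x]
      by (simp add: insert_absorb[OF e] mp_eval_mult del)
  qed
  then have "K0_class (config_complement E W) = K0_class (proj_complement (?E \<union> {e}) (?q * mp_var e))"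
    unfolding config_complement_eq[OF E W] Eu by simp
  also have "\<dots> = K0_class (proj_complement ?E ?q) * K0_class (affine_complement {e} (mp_var e :: ('e, 'k) mpoly))"
    by (rule K0_class_join[OF fin _ _ _ d depends_on_config_polynomial[OF fin W']
          mp_homogeneous_var depends_on_var]) (use w(3) in auto)
  finally show ?thesis
    by (simp only: K0_class_line_complement config_complement_eq[OF fin W'])
qed

text \<open>
  The fibre of the join is the affine cone over the second complement, and this cone contributes a
  torus.
\<close>

lemma K0_class_direct_sum:
  assumes E: "finite E" "finite F" "E \<inter> F = {}" and W: "configuration (E \<union> F) (W :: ('e \<Rightarrow> 'k::field) set)"
    and split: "\<And>w. w \<in> W \<Longrightarrow> restrict_to E w \<in> W"
    and u: "u \<in> W" "u e \<noteq> 0" "e \<in> E" and v: "v \<in> W" "v f \<noteq> 0" "f \<in> F"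
  shows "K0_class (config_complement (E \<union> F) W) =
    K0_class (config_complement E (restrict_to E ` W)) *
    (K0_class (config_complement F (restrict_to F ` W)) * K0_T)"
proof -
  let ?p = "config_polynomial E (restrict_to E ` W)" and ?q = "config_polynomial F (restrict_to F ` W)"
  note WE = configuration_restrict_to[OF W, of E] and WF = configuration_restrict_to[OF W, of F]
  obtain d where d: "mp_homogeneous d ?p" "d > 0"
    using mp_homogeneous_config_polynomial[OF E(1) WE] restrict_to_nonzero[OF u] by metis
  obtain d' where d': "mp_homogeneous d' ?q" "d' > 0"
    using mp_homogeneous_config_polynomial[OF E(2) WF] restrict_to_nonzero[OF v] by metis
  note dep = depends_on_config_polynomial[OF E(1) WE] depends_on_config_polynomial[OF E(2) WF]
  have "K0_class (config_complement (E \<union> F) W) = K0_class (proj_complement (E \<union> F) (?p * ?q))"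
    by (simp only: proj_complement_direct_sum[OF E W split])
  also have "\<dots> = K0_class (proj_complement E ?p) * K0_class (affine_complement F ?q)"
    by (rule K0_class_join[OF E _ d dep(1) d'(1) dep(2)]) (use u in auto)
  also have "K0_class (affine_complement F ?q) = K0_class (proj_complement F ?q) * K0_T"
    by (rule K0_class_cone[OF E(2) _ _ d' dep(2), of e]) (use u v E(3) in auto)
  finally show ?thesis
    by (simp only: config_complement_eq[OF E(1) WE] config_complement_eq[OF E(2) WF])
qed

lemma cong_mod_T_mult: "cong_mod_T (a * K0_T) 0"
  unfolding cong_mod_T_def by (simp add: ideal_generated_mult ideal_generated_base)

lemma cong_mod_T_mult_L: "cong_mod_T (a * K0_L) a"
proof -
  have "a * K0_L - a = a * K0_T" by (simp add: K0_L_eq distrib_left)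
  then show ?thesis unfolding cong_mod_T_def by (simp add: ideal_generated_mult ideal_generated_base)
qed

lemma cong_mod_T_direct_sum:
  assumes E: "finite E" and W: "configuration E (W :: ('e \<Rightarrow> 'k::field) set)" and S: "S \<subseteq> E"
    and split: "\<And>w. w \<in> W \<Longrightarrow> restrict_to S w \<in> W"
    and u: "u \<in> W" "u e \<noteq> 0" "e \<in> S" and v: "v \<in> W" "v f \<noteq> 0" "f \<in> E - S"
  shows "cong_mod_T (K0_class (config_complement E W)) 0"
proof -
  have eq: "S \<union> (E - S) = E" using S by blast
  then have W': "configuration (S \<union> (E - S)) W" using W by (simp only:)
  have "K0_class (config_complement (S \<union> (E - S)) W) =
      K0_class (config_complement S (restrict_to S ` W)) *
      (K0_class (config_complement (E - S) (restrict_to (E - S) ` W)) * K0_T)"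
    by (rule K0_class_direct_sum[OF finite_subset[OF S E] _ _ W' split u v]) (use E in auto)
  then show ?thesis
    using cong_mod_T_mult unfolding eq by (simp only: mult.assoc[symmetric])
qed

section \<open>Graphs\<close>

text \<open>
  \<open>C\<close> is a connected component, of the graph itself or of the graph without its nexus \<open>z\<close>. In the
  first case any vertex outside \<open>C\<close> may play the role of \<open>z\<close>. Since no vertex is isolated, there are
  edges on both sides.
\<close>

lemma graph_split:
  assumes G: "multigraph G" "\<forall>e\<in>edges G. \<not> graph_loop G e" "\<forall>v. \<not> isolated_vertex G v"
    and dis: "graph_disconnected G \<or> (\<exists>v. nexus G v)"
  obtains C z e f where "C \<subseteq> verts G" "z \<notin> C"
    "\<And>e. e \<in> edges G \<Longrightarrow> ends G e \<inter> C \<noteq> {} \<Longrightarrow> ends G e \<subseteq> insert z C"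
    "e \<in> edges G" "ends G e \<inter> C \<noteq> {}" "f \<in> edges G" "ends G f \<inter> C = {}"
proof -
  have ends: "\<exists>a b. ends G e = {a, b} \<and> a \<in> verts G \<and> b \<in> verts G" if "e \<in> edges G" for e
  proof -
    have "ends G e \<subseteq> verts G" "card (ends G e) = 2"
      using G(1,2) that by (auto simp: multigraph_def graph_loop_def)
    then show ?thesis by (auto simp: card_2_iff)
  qed
  have edge: "\<exists>e\<in>edges G. v \<in> ends G e" if "v \<in> verts G" for v
    using G(3) that by (auto simp: isolated_vertex_def)
  from dis show ?thesis
  proof
    assume "graph_disconnected G"
    then obtain u v where uv: "u \<in> verts G" "v \<in> verts G" "(u, v) \<notin> (adjacency G)\<^sup>*"
      by (auto simp: graph_disconnected_def)
    define C where "C = {w \<in> verts G. (u, w) \<in> (adjacency G)\<^sup>*}"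
    have step: "ends G e \<subseteq> C" if e: "e \<in> edges G" "ends G e \<inter> C \<noteq> {}" for e
    proof -
      obtain a b where ab: "ends G e = {a, b}" "a \<in> verts G" "b \<in> verts G" using ends[OF e(1)] by blast
      have "(a, b) \<in> adjacency G" "(b, a) \<in> adjacency G"
        using e(1) ab(1) by (auto simp: adjacency_def insert_commute)
      then show ?thesis
        using e(2) ab by (auto simp: C_def intro: rtrancl_into_rtrancl)
    qed
    obtain e where e: "e \<in> edges G" "u \<in> ends G e" using edge[OF uv(1)] by blast
    obtain f where f: "f \<in> edges G" "v \<in> ends G f" using edge[OF uv(2)] by blast
    have uC: "u \<in> C" "v \<notin> C" using uv by (auto simp: C_def)
    show ?thesis
      by (rule that[of C v e f]) (use e f uC step in \<open>auto simp: C_def\<close>)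
  next
    assume "\<exists>v. nexus G v"
    then obtain z where z: "graph_disconnected (delete_vertex G z)" by (auto simp: nexus_def)
    let ?H = "delete_vertex G z"
    obtain u v where uv: "u \<in> verts G - {z}" "v \<in> verts G - {z}" "(u, v) \<notin> (adjacency ?H)\<^sup>*"
      using z by (auto simp: graph_disconnected_def delete_vertex_def)
    define C where "C = {w \<in> verts G - {z}. (u, w) \<in> (adjacency ?H)\<^sup>*}"
    have step: "ends G e \<subseteq> insert z C" if e: "e \<in> edges G" "ends G e \<inter> C \<noteq> {}" for e
    proof (cases "z \<in> ends G e")
      case True
      obtain a b where ab: "ends G e = {a, b}" using ends[OF e(1)] by blast
      then show ?thesis using True e(2) by (auto simp: C_def)
    next
      case False
      obtain a b where ab: "ends G e = {a, b}" "a \<in> verts G" "b \<in> verts G" using ends[OF e(1)] by blast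
      have "(a, b) \<in> adjacency ?H" "(b, a) \<in> adjacency ?H"
        using e(1) ab(1) False by (auto simp: adjacency_def delete_vertex_def insert_commute)
      then show ?thesis
        using e(2) ab False by (auto simp: C_def intro: rtrancl_into_rtrancl)
    qed
    obtain e where e: "e \<in> edges G" "u \<in> ends G e" using edge uv(1) by blast
    obtain f where f: "f \<in> edges G" "v \<in> ends G f" using edge uv(2) by blast
    have uC: "u \<in> C" "v \<notin> C" using uv by (auto simp: C_def)
    have "ends G f \<inter> C = {}"
    proof (rule ccontr)
      assume "ends G f \<inter> C \<noteq> {}"
      then have "v \<in> insert z C" using step[OF f(1)] f(2) by blast
      then show False using uC uv by blast
    qed
    then show ?thesis
      by (intro that[of C z e f]) (use e f uC step in \<open>auto simp: C_def\<close>)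
  qed
qed

lemma configuration_graph:
  "configuration (edges G) (graph_config G s t :: ('f \<Rightarrow> 'k::field) set)"
  unfolding configuration_def
proof
  show "fun_space.subspace (graph_config G s t :: ('f \<Rightarrow> 'k) set)"
    unfolding graph_config_def by (rule fun_space.subspace_span)
  show "(graph_config G s t :: ('f \<Rightarrow> 'k) set) \<subseteq> coord_space (edges G)"
    unfolding graph_config_def
  proof (rule fun_space.span_minimal)
    show "fun_space.subspace (coord_space (edges G) :: ('f \<Rightarrow> 'k) set)"
      by (rule fun_space.subspaceI) (auto simp: coord_space_def fun_scale_def)
  qed (auto simp: incidence_vector_def coord_space_def)
qed

text \<open>
  Restricted to the edges meeting \<open>C\<close>, incidence vectors of vertices in \<open>C\<close> are unchanged and those of
  vertices other than \<open>z\<close> outside \<open>C\<close> become zero. For \<open>z\<close> the restriction is the negative of the sum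
  of the incidence vectors over \<open>C\<close>, as each edge contributes \<open>1\<close> and \<open>-1\<close> at its two ends.
\<close>

lemma graph_cut_restrict_to:
  fixes G :: "('v, 'f) multigraph" and w :: "'f \<Rightarrow> 'k::field"
  assumes G: "finite (verts G)" and st: "\<And>e. e \<in> edges G \<Longrightarrow> ends G e = {s e, t e}"
    and C: "C \<subseteq> verts G" "z \<notin> C"
    and sep: "\<And>e. e \<in> edges G \<Longrightarrow> ends G e \<inter> C \<noteq> {} \<Longrightarrow> ends G e \<subseteq> insert z C"
    and w: "w \<in> graph_config G s t"
  shows "restrict_to {e \<in> edges G. ends G e \<inter> C \<noteq> {}} w \<in> graph_config G s t"
proof -
  let ?S = "{e \<in> edges G. ends G e \<inter> C \<noteq> {}}"
  let ?W = "graph_config G s t :: ('f \<Rightarrow> 'k) set"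
  let ?i = "incidence_vector G s t :: 'v \<Rightarrow> 'f \<Rightarrow> 'k"
  have sub: "fun_space.subspace ?W"
    unfolding graph_config_def by (rule fun_space.subspace_span)
  have inc: "?i v \<in> ?W" if "v \<in> verts G" for v
    unfolding graph_config_def by (rule fun_space.span_base) (use that in blast)
  have fC: "finite C" by (rule finite_subset[OF C(1) G])
  have sumC: "(\<Sum>v\<in>C. ?i v e) = (if e \<in> edges G \<and> s e \<noteq> t e
      then (if t e \<in> C then 1 else 0) - (if s e \<in> C then 1 else 0) else 0)" for e
  proof (cases "e \<in> edges G \<and> s e \<noteq> t e")
    case True
    have "(\<Sum>v\<in>C. ?i v e) = (\<Sum>v\<in>C. (if v = t e then 1 else 0) - (if v = s e then 1 else 0))"
      by (rule sum.cong) (use True in \<open>auto simp: incidence_vector_def\<close>)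
    then show ?thesis using True fC by (simp add: sum_subtractf)
  qed (auto simp: incidence_vector_def)
  have base: "restrict_to ?S (?i v) \<in> ?W" if v: "v \<in> verts G" for v
  proof -
    consider "v \<in> C" | "v \<notin> C" "v \<noteq> z" | "v = z" by blast
    then show ?thesis
    proof cases
      case 1
      have "restrict_to ?S (?i v) = ?i v"
        using 1 st by (auto simp: restrict_to_def incidence_vector_def fun_eq_iff)
      then show ?thesis using inc[OF v] by simp
    next
      case 2
      have "restrict_to ?S (?i v) = 0"
      proof
        fix e
        show "restrict_to ?S (?i v) e = 0 e"
          using 2 st[of e] sep[of e] by (auto simp: restrict_to_def incidence_vector_def)
      qed
      then show ?thesis using fun_space.subspace_0[OF sub] by (simp only:)
    next
      case 3
      have "restrict_to ?S (?i v) = - (\<Sum>v\<in>C. ?i v)"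
      proof
        fix e
        show "restrict_to ?S (?i v) e = (- (\<Sum>v\<in>C. ?i v)) e"
        proof (cases "e \<in> edges G \<and> s e \<noteq> t e")
          case True
          then have S: "e \<in> ?S \<longleftrightarrow> s e \<in> C \<or> t e \<in> C" using st[of e] by auto
          have "s e \<in> C \<Longrightarrow> t e \<in> insert z C" "t e \<in> C \<Longrightarrow> s e \<in> insert z C"
            using sep[of e] st[of e] True by auto
          moreover have "?i v e = (if z = s e then - 1 else if z = t e then 1 else 0)"
            using True 3 by (simp add: incidence_vector_def)
          moreover have "(- (\<Sum>v\<in>C. ?i v)) e = (if s e \<in> C then 1 else 0) - (if t e \<in> C then 1 else 0)"
            using True by (simp add: sum_fun_apply sumC)
          ultimately show ?thesis
            using True S C(2) unfolding restrict_to_def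
            by (cases "s e \<in> C"; cases "t e \<in> C") auto
        next
          case False
          then have "?i u e = 0" for u by (auto simp: incidence_vector_def)
          then show ?thesis by (simp add: sum_fun_apply restrict_to_def)
        qed
      qed
      also have "\<dots> \<in> ?W"
        by (intro fun_space.subspace_neg fun_space.subspace_sum sub inc) (use C(1) in auto)
      finally show ?thesis .
    qed
  qed
  have "?W \<subseteq> {w. restrict_to ?S w \<in> ?W}"
    unfolding graph_config_def[of G s t]
  proof (rule fun_space.span_minimal, fold graph_config_def)
    show "?i ` verts G \<subseteq> {w. restrict_to ?S w \<in> ?W}" using base by blast
    show "fun_space.subspace {w. restrict_to ?S w \<in> ?W}"
      using module_hom.subspace_vimage[OF module_hom_restrict_to sub] by (simp add: vimage_def)
  qed
  then show ?thesis using w by blast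
qed

lemma cong_mod_T_graph:
  fixes G :: "('v, 'f) multigraph"
  assumes G: "multigraph G" "\<forall>e\<in>edges G. \<not> graph_loop G e" "\<forall>v. \<not> isolated_vertex G v"
    and dis: "graph_disconnected G \<or> (\<exists>v. nexus G v)" and st: "orientation G s t"
  shows "cong_mod_T (K0_class (graph_complement G s t :: (('f \<Rightarrow> 'k alg_closure) set, 'k::field) kspace)) 0"
proof -
  have st': "ends G e = {s e, t e}" if "e \<in> edges G" for e using st that by (simp add: orientation_def)
  have fin: "finite (verts G)" "finite (edges G)" using G(1) by (auto simp: multigraph_def)
  obtain C z e f where C: "C \<subseteq> verts G" "z \<notin> C"
    "\<And>e. e \<in> edges G \<Longrightarrow> ends G e \<inter> C \<noteq> {} \<Longrightarrow> ends G e \<subseteq> insert z C"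
    and ef: "e \<in> edges G" "ends G e \<inter> C \<noteq> {}" "f \<in> edges G" "ends G f \<inter> C = {}"
    by (rule graph_split[OF G dis]) (rule that)
  have ns: "\<exists>w\<in>(graph_config G s t :: ('f \<Rightarrow> 'k) set). w e \<noteq> 0" if e: "e \<in> edges G" for e
  proof -
    have se: "s e \<in> verts G" "s e \<noteq> t e"
      using G(1,2) st'[OF e] e by (auto simp: multigraph_def graph_loop_def)
    then have "(incidence_vector G s t (s e) :: 'f \<Rightarrow> 'k) \<in> graph_config G s t"
      unfolding graph_config_def by (intro fun_space.span_base) blast
    moreover have "(incidence_vector G s t (s e) :: 'f \<Rightarrow> 'k) e \<noteq> 0"
      using se e by (simp add: incidence_vector_def)
    ultimately show ?thesis by blast
  qed
  obtain u where u: "u \<in> (graph_config G s t :: ('f \<Rightarrow> 'k) set)" "u e \<noteq> 0" using ns[OF ef(1)] by blast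
  obtain v where v: "v \<in> (graph_config G s t :: ('f \<Rightarrow> 'k) set)" "v f \<noteq> 0" using ns[OF ef(3)] by blast
  show ?thesis
    unfolding graph_complement_def
    by (rule cong_mod_T_direct_sum[OF fin(2) configuration_graph _
          graph_cut_restrict_to[OF fin(1) st' C] u _ v])
      (use ef u(2) v(2) in simp_all)
qed

theorem proposition5p3:
  fixes E :: "'e set" and W :: "('e \<Rightarrow> 'k::field) set"
  assumes "finite E" and "E \<noteq> {}" and "configuration E W"
  shows
    "(\<forall>e\<in>E.
        matroid_rank (config_matroid E W) > 0 \<and>
        (matroid_loop (config_matroid E W) e \<or>
          (\<exists>f\<in>E. matroid_parallel (config_matroid E W) e f)) \<longrightarrow>
        K0_class (config_complement E W) =
          K0_class (config_complement (E - {e}) (config_delete W e)) * K0_L \<and>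
        cong_mod_T (K0_class (config_complement E W))
          (K0_class (config_complement (E - {e}) (config_delete W e)))) \<and>
     (\<forall>e\<in>E.
        matroid_rank (config_matroid E W) > 1 \<and> matroid_coloop (config_matroid E W) e \<longrightarrow>
        K0_class (config_complement E W) =
          K0_class (config_complement (E - {e}) (config_delete W e)) * K0_T \<and>
        cong_mod_T (K0_class (config_complement E W)) 0) \<and>
     ((\<forall>e\<in>E. \<not> matroid_loop (config_matroid E W) e) \<and>
        matroid_disconnected (config_matroid E W) \<longrightarrow>
        cong_mod_T (K0_class (config_complement E W)) 0) \<and>
     (\<forall>(G :: ('v, 'f) multigraph) s t.
        multigraph G \<and> (\<forall>e\<in>edges G. \<not> graph_loop G e) \<and> (\<forall>v. \<not> isolated_vertex G v) \<and>
        (graph_disconnected G \<or> (\<exists>v. nexus G v)) \<and> orientation G s t \<longrightarrow>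
        cong_mod_T (K0_class (graph_complement G s t :: (('f \<Rightarrow> 'k alg_closure) set, 'k) kspace)) 0)"
proof (intro conjI ballI allI impI; (elim conjE)?)
  note E = assms(1) and W = assms(3)
  fix e assume e: "e \<in> E" and r: "0 < matroid_rank (config_matroid E W)"
    and lp: "matroid_loop (config_matroid E W) e \<or> (\<exists>f\<in>E. matroid_parallel (config_matroid E W) e f)"
  obtain f c where f: "f \<in> E" "f \<noteq> e" "\<And>w. w \<in> W \<Longrightarrow> w e = c * w f" "W \<noteq> {0}"
    by (rule config_loop_or_parallel[OF E W e r lp]) (rule that)
  show eq: "K0_class (config_complement E W) =
      K0_class (config_complement (E - {e}) (config_delete W e)) * K0_L"
    by (rule K0_class_delete_parallel[OF E W e f])
  show "cong_mod_T (K0_class (config_complement E W))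
      (K0_class (config_complement (E - {e}) (config_delete W e)))"
    unfolding eq by (rule cong_mod_T_mult_L)
next
  note E = assms(1) and W = assms(3)
  fix e assume e: "e \<in> E" and r: "1 < matroid_rank (config_matroid E W)"
    and col: "matroid_coloop (config_matroid E W) e"
  obtain u where u: "u \<in> W" "u e = 1" "\<And>f. f \<in> E \<Longrightarrow> f \<noteq> e \<Longrightarrow> u f = 0"
    by (rule config_coloop[OF E W col]) (rule that)
  obtain I where I: "I \<in> indep (config_matroid E W)" "1 < card I"
    by (rule matroid_rank_config[OF E r])
  have "\<not> I \<subseteq> {e}" using I(2) card_mono[of "{e}" I] by auto
  then obtain f where f: "f \<in> I" "f \<noteq> e" by blast
  then have fE: "f \<in> E - {e}" using I(1) by (auto simp: config_indep_iff)
  obtain w where w: "w \<in> W" "w f \<noteq> 0" using config_indep_dual[OF E W I(1) f(1)] by force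
  show eq: "K0_class (config_complement E W) =
      K0_class (config_complement (E - {e}) (config_delete W e)) * K0_T"
    by (rule K0_class_delete_coloop[OF E W e u w fE])
  show "cong_mod_T (K0_class (config_complement E W)) 0"
    unfolding eq by (rule cong_mod_T_mult)
next
  note E = assms(1) and W = assms(3)
  assume nl: "\<forall>e\<in>E. \<not> matroid_loop (config_matroid E W) e"
    and "matroid_disconnected (config_matroid E W)"
  then obtain S where S: "S \<noteq> {}" "S \<subset> E"
    "\<forall>I\<subseteq>E. I \<in> indep (config_matroid E W) \<longleftrightarrow>
      I \<inter> S \<in> indep (config_matroid E W) \<and> I - S \<in> indep (config_matroid E W)"
    by (auto simp: matroid_disconnected_def)
  obtain e f where ef: "e \<in> S" "f \<in> E - S" using S(1,2) by blast
  obtain u where u: "u \<in> W" "u e = 1"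
    by (rule config_not_loop[OF E W, of e]) (use nl ef S(2) in auto)
  obtain v where v: "v \<in> W" "v f = 1"
    by (rule config_not_loop[OF E W, of f]) (use nl ef in auto)
  show "cong_mod_T (K0_class (config_complement E W)) 0"
    by (rule cong_mod_T_direct_sum[OF E W _ config_disconnected[OF E W _ S(3)] u(1) _ ef(1) v(1) _ ef(2)])
      (use S(2) u(2) v(2) in auto)
next
  fix G :: "('v, 'f) multigraph" and s t
  assume "multigraph G" "\<forall>e\<in>edges G. \<not> graph_loop G e" "\<forall>v. \<not> isolated_vertex G v"
    "graph_disconnected G \<or> (\<exists>v. nexus G v)" "orientation G s t"
  then show "cong_mod_T (K0_class (graph_complement G s t :: (('f \<Rightarrow> 'k alg_closure) set, 'k) kspace)) 0"
    by (rule cong_mod_T_graph)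
qed

end
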